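(* For the remotely powered channel described in the context, and every $\Gamma\ge 0$, the capacities with generic charger ($C_\emptyset$), receiver charging the transmitter ($C_Y$), charger adjacent to the transmitter ($C_X$) and fully cognitive charger ($C_M$) are given by (in particular all the limits exist) $$C_\emptyset(\Gamma)=\lim_{n\to\infty}\frac1n\max_{\substack{p(x^n),\ e^n:\\ (X^n,e^n)\in\mathcal A_n(\Gamma)\text{ a.s.}}} I(X^n;Y^n),$$ $$C_Y(\Gamma)=\lim_{n\to\infty}\frac1n\max_{\substack{p(x^n\|e^n),\ \{e_t(y^{t-1})\}_{t=1}^n:\\ (X^n,e^n(Y^{n-1}))\in\mathcal A_n(\Gamma)\text{ a.s.}}} I(X^n\to Y^n),$$ where $I(X^n\to Y^n)=\sum_{t=1}^n I(X^t;Y_t|Y^{t-1})$ is directed information and the maximum is over all functions $e_t:\mathcal Y^{t-1}\to\mathcal E$ ($t=1,\dots,n$) and all causally conditioned input distributions $p(x^n\|e^n)=\prod_{t=1}^n p(x_t|x^{t-1},e^t)$, $$C_X(\Gamma)=\lim_{n\to\infty}\frac1n\max_{\substack{p(x^n),\ \{e_t(x^{t-1})\}_{t=1}^n:\\ (X^n,e^n(X^{n-1}))\in\mathcal A_n(\Gamma)\text{ a.s.}}} I(X^n;Y^n),$$ where the maximum is over all distributions on $\mathcal X^n$ and all functions $e_t:\mathcal X^{t-1}\to\mathcal E$, and $$C_M(\Gamma)=\lim_{n\to\infty}\frac1n\max_{\substack{p(x^n,e^n):\\ (X^n,E^n)\in\mathcal A_n(\Gamma)\text{ a.s.}}} I(X^n;Y^n).$$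 In the first expression $e^n\in\mathcal E^n$ is a deterministic sequence.
   Context: Notation: $x^n=(x_1,\dots,x_n)$; logarithms are to base 2. Channel: $\mathcal X,\mathcal Y,\mathcal E$ are finite alphabets; $p(y|x)$ is a discrete memoryless channel from $\mathcal X$ to $\mathcal Y$; $\phi:\mathcal X\to[0,\infty)$ is an energy cost function; $\bar B$ is the battery capacity; $\mathcal E\subseteq[0,\bar B]$ is the energy alphabet. Assumptions: $\phi(x)\le\bar B$ for all $x$; there is a symbol $0\in\mathcal X$ with $\phi(0)=0$; $\mathcal E$ contains at least one strictly positive element. Energy constraints: the battery level $B_t$ satisfies $B_1=\bar B$, $B_{t+1}=\min\{B_t+E_t,\bar B\}-\phi(X_t)$, and the input must satisfy $\phi(X_t)\le\min\{B_t+E_t,\bar B\}$, where $E_t\in\mathcal E$ is the energy sent by the charger at time $t$. Cost constraint: $\frac1n\sum_{t=1}^nE_t\le\Gamma$. The set $\mathcal A_n(\Gamma)$ consists of all pairs $(x^n,e^n)\in\mathcal X^n\times\mathcal E^n$ such that, with $b_1=\bar B$ and $b_{t+1}=\min\{b_t+e_t,\bar B\}-\phi(x_t)$ for $t=1,\dots,n-1$, one has $\phi(x_t)\le\min\{b_t+e_t,\bar B\}$ for $t=1,\dots,n$, and $\sum_{t=1}^ne_t\le n\Gamma$. Codes: an $(R,n)$ code has message set $\mathcal M=\{1,\dots,2^{nR}\}$ (rounded to an integer), transmitter functions $f^{\mathrm{Tx}}_t:\mathcal M\times\mathcal E^t\to\mathcal X$ (so $x_t=f_t^{\mathrm{Tx}}(m,e^t)$)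 satisfying the energy constraint for every $m$ and every $e^n\in\mathcal E^n$, charger functions, and a decoder $\mathcal Y^n\to\mathcal M$ producing $\hat M$ from $Y^n$, where $Y_t$ is the output of $p(y|x)$ with input $X_t$ (conditionally independent of the past given $X_t$). The charger functions are: a fixed sequence $e^n\in\mathcal E^n$ (generic charger, capacity $C_\emptyset$); $f^{\mathrm C}_t:\mathcal Y^{t-1}\to\mathcal E$, $E_t=f_t^{\mathrm C}(Y^{t-1})$ (receiver charges transmitter, $C_Y$); $f^{\mathrm C}_t:\mathcal X^{t-1}\to\mathcal E$, $E_t=f_t^{\mathrm C}(X^{t-1})$ (charger adjacent to transmitter, $C_X$); $f^{\mathrm C}:\mathcal M\to\mathcal E^n$, $E^n=f^{\mathrm C}(M)$ (fully cognitive charger, $C_M$). The cost constraint $\frac1n\sum_tE_t\le\Gamma$ must hold for every realization of the side information observed by the charger. The error probability is $P_e=|\mathcal M|^{-1}\sum_m\Pr(\hat M\ne m\mid m\text{ sent})$. A rate $R$ is achievable if there is a sequence of $(R,n)$ codes with $P_e\to0$ as $n\to\infty$; the capacity is the supremum of achievable rates. Joint laws in the formulas: for $C_\emptyset,C_X,C_M$, $Y^n$ is the output of the memoryless channel with input $X^n$, i.e. $p(y^n|x^n)=\prod_tp(y_t|x_t)$ (and for $C_M$, $E^n$ is conditionally independent of $Y^n$ given $X^n$). For $C_Y$, $p(x^n,y^n)=\prod_{t=1}^np(x_t|x^{t-1},e^t(y^{t-1}))\,p(y_t|x_t)$, where $e^t(y^{t-1})=(e_1,e_2(y^1),\dots,e_t(y^{t-1}))$.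 Convention: suprema and maxima over empty sets (which occur when $\Gamma<\min\mathcal E$) are $-\infty$. *)

theory Defs
  imports "HOL-Probability.Probability"
begin

text \<open>
  Sequences \<open>x\<^sup>n\<close> are lists of length \<open>n\<close>, so time is 0-based (\<open>xs ! t\<close> is the symbol of time
  \<open>t + 1\<close>) and \<open>take t xs\<close> is the prefix of length \<open>t\<close>. A family of functions
  \<open>f\<^sub>t\<close> of prefixes is a single function on lists, the time being the length of the list.
  Throughout, \<open>W\<close> is the channel law, \<open>\<phi>\<close> the energy cost function, \<open>B\<close> the battery capacity,
  \<open>\<E>\<close> the energy alphabet and \<open>\<Gamma>\<close> the cost constraint.
\<close>

section \<open>Battery and feasible pairs\<close>

primrec battery :: "('x \<Rightarrow> real) \<Rightarrow> real \<Rightarrow> 'x list \<Rightarrow> real list \<Rightarrow> nat \<Rightarrow> real" where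
  "battery \<phi> B xs es 0 = B"
| "battery \<phi> B xs es (Suc t) = min (battery \<phi> B xs es t + es ! t) B - \<phi> (xs ! t)"

definition energy_feasible :: "('x \<Rightarrow> real) \<Rightarrow> real \<Rightarrow> nat \<Rightarrow> 'x list \<Rightarrow> real list \<Rightarrow> bool" where
  "energy_feasible \<phi> B n xs es \<longleftrightarrow>
     (\<forall>t<n. \<phi> (xs ! t) \<le> min (battery \<phi> B xs es t + es ! t) B)"

definition admissible ::
  "('x \<Rightarrow> real) \<Rightarrow> real \<Rightarrow> real set \<Rightarrow> real \<Rightarrow> nat \<Rightarrow> ('x list \<times> real list) set" where
  "admissible \<phi> B \<E> \<Gamma> n =
     {(xs, es). length xs = n \<and> length es = n \<and> set es \<subseteq> \<E> \<and>
        energy_feasible \<phi> B n xs es \<and> (\<Sum>t<n. es ! t) \<le> real n * \<Gamma>}"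

section \<open>Codes and capacity\<close>

text \<open>
  A charger chooses the next energy symbol from the message, the past inputs and the past outputs;
  the four settings are distinguished by which of these arguments it may use. The past inputs and
  outputs always have the same length, which is the number of past time steps.
\<close>

type_synonym ('x, 'y) charger = "nat \<Rightarrow> 'x list \<Rightarrow> 'y list \<Rightarrow> real"

definition generic_chargers :: "('x, 'y) charger set" where
  "generic_chargers = {c. \<exists>e :: nat \<Rightarrow> real. c = (\<lambda>m xs ys. e (length ys))}"

definition receiver_chargers :: "('x, 'y) charger set" where
  "receiver_chargers = {c. \<exists>e :: 'y list \<Rightarrow> real. c = (\<lambda>m xs ys. e ys)}"

definition adjacent_chargers :: "('x, 'y) charger set" where
  "adjacent_chargers = {c. \<exists>e :: 'x list \<Rightarrow> real. c = (\<lambda>m xs ys. e xs)}"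

definition cognitive_chargers :: "('x, 'y) charger set" where
  "cognitive_chargers = {c. \<exists>e :: nat \<Rightarrow> nat \<Rightarrow> real. c = (\<lambda>m xs ys. e m (length ys))}"

definition num_messages :: "real \<Rightarrow> nat \<Rightarrow> nat" where
  "num_messages R n = nat \<lceil>2 powr (real n * R)\<rceil>"

definition is_code ::
  "('x \<Rightarrow> real) \<Rightarrow> real \<Rightarrow> real set \<Rightarrow> real \<Rightarrow> real \<Rightarrow> nat \<Rightarrow>
   (nat \<Rightarrow> real list \<Rightarrow> 'x) \<Rightarrow> ('x, 'y) charger \<Rightarrow> ('y list \<Rightarrow> nat) \<Rightarrow> bool" where
  "is_code \<phi> B \<E> \<Gamma> R n f c g \<longleftrightarrow>
     (\<forall>m\<in>{1..num_messages R n}. \<forall>es. length es = n \<and> set es \<subseteq> \<E> \<longrightarrow>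
        energy_feasible \<phi> B n (map (\<lambda>t. f m (take (Suc t) es)) [0..<n]) es) \<and>
     (\<forall>m\<in>{1..num_messages R n}. \<forall>xs ys. length xs = n \<and> length ys = n \<longrightarrow>
        (\<forall>t<n. c m (take t xs) (take t ys) \<in> \<E>) \<and>
        (\<Sum>t<n. c m (take t xs) (take t ys)) \<le> real n * \<Gamma>) \<and>
     (\<forall>ys. length ys = n \<longrightarrow> g ys \<in> {1..num_messages R n})"

text \<open>Law of \<open>(X\<^sup>t, Y\<^sup>t, E\<^sup>t)\<close> when message \<open>m\<close> is sent.\<close>

primrec transmission ::
  "('x \<Rightarrow> 'y pmf) \<Rightarrow> (nat \<Rightarrow> real list \<Rightarrow> 'x) \<Rightarrow> ('x, 'y) charger \<Rightarrow> nat \<Rightarrow> nat \<Rightarrow>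
   ('x list \<times> 'y list \<times> real list) pmf" where
  "transmission W f c m 0 = return_pmf ([], [], [])"
| "transmission W f c m (Suc t) =
     do {
       (xs, ys, es) \<leftarrow> transmission W f c m t;
       let es' = es @ [c m xs ys];
       let x = f m es';
       y \<leftarrow> W x;
       return_pmf (xs @ [x], ys @ [y], es')
     }"

definition error_prob ::
  "('x \<Rightarrow> 'y pmf) \<Rightarrow> real \<Rightarrow> nat \<Rightarrow>
   (nat \<Rightarrow> real list \<Rightarrow> 'x) \<Rightarrow> ('x, 'y) charger \<Rightarrow> ('y list \<Rightarrow> nat) \<Rightarrow> real" where
  "error_prob W R n f c g =
     (\<Sum>m\<in>{1..num_messages R n}.
        measure_pmf.prob (transmission W f c m n) {(xs, ys, es). g ys \<noteq> m})
     / real (num_messages R n)"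

definition achievable ::
  "('x \<Rightarrow> 'y pmf) \<Rightarrow> ('x \<Rightarrow> real) \<Rightarrow> real \<Rightarrow> real set \<Rightarrow> real \<Rightarrow> ('x, 'y) charger set \<Rightarrow>
   real \<Rightarrow> bool" where
  "achievable W \<phi> B \<E> \<Gamma> \<C> R \<longleftrightarrow>
     0 \<le> R \<and>
     (\<exists>f c g. (\<forall>n\<ge>1. c n \<in> \<C> \<and> is_code \<phi> B \<E> \<Gamma> R n (f n) (c n) (g n)) \<and>
        (\<lambda>n. error_prob W R n (f n) (c n) (g n)) \<longlonglongrightarrow> 0)"

text \<open>In \<^typ>\<open>ereal\<close>, the supremum of the empty set is \<open>-\<infinity>\<close>.\<close>

definition capacity ::
  "('x \<Rightarrow> 'y pmf) \<Rightarrow> ('x \<Rightarrow> real) \<Rightarrow> real \<Rightarrow> real set \<Rightarrow> real \<Rightarrow> ('x, 'y) charger set \<Rightarrow>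
   ereal" where
  "capacity W \<phi> B \<E> \<Gamma> \<C> = (SUP R \<in> {R. achievable W \<phi> B \<E> \<Gamma> \<C> R}. ereal R)"

section \<open>Information quantities\<close>

text \<open>
  The reference measure is counting measure on the whole (countable) type, for which the library's
  notions are the usual discrete ones; see \<open>mutual_info_eq_sum\<close> below.
\<close>

definition mutual_info :: "'w pmf \<Rightarrow> ('w \<Rightarrow> 'a) \<Rightarrow> ('w \<Rightarrow> 'b) \<Rightarrow> real" where
  "mutual_info p X Y =
     prob_space.mutual_information (measure_pmf p) 2 (count_space UNIV) (count_space UNIV) X Y"

definition cond_mutual_info ::
  "'w pmf \<Rightarrow> ('w \<Rightarrow> 'a) \<Rightarrow> ('w \<Rightarrow> 'b) \<Rightarrow> ('w \<Rightarrow> 'c) \<Rightarrow> real" where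
  "cond_mutual_info p X Y Z =
     prob_space.conditional_mutual_information (measure_pmf p) 2
       (count_space UNIV) (count_space UNIV) (count_space UNIV) X Y Z"

definition directed_info :: "nat \<Rightarrow> ('x list \<times> 'y list) pmf \<Rightarrow> real" where
  "directed_info n p =
     (\<Sum>t<n. cond_mutual_info p
        (\<lambda>(xs, ys). take (Suc t) xs) (\<lambda>(xs, ys). ys ! t) (\<lambda>(xs, ys). take t ys))"

primrec memoryless :: "('x \<Rightarrow> 'y pmf) \<Rightarrow> 'x list \<Rightarrow> 'y list pmf" where
  "memoryless W [] = return_pmf []"
| "memoryless W (x # xs) =
     do { y \<leftarrow> W x; ys \<leftarrow> memoryless W xs; return_pmf (y # ys) }"

definition channel_joint ::
  "('x \<Rightarrow> 'y pmf) \<Rightarrow> 'x list pmf \<Rightarrow> ('x list \<times> 'y list) pmf" where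
  "channel_joint W p = do { xs \<leftarrow> p; ys \<leftarrow> memoryless W xs; return_pmf (xs, ys) }"

text \<open>\<open>energy_seq e n zs\<close> is \<open>(e\<^sub>1, e\<^sub>2(z\<^sub>1), \<dots>, e\<^sub>n(z\<^sup>n\<^sup>-\<^sup>1))\<close>.\<close>

definition energy_seq :: "('z list \<Rightarrow> real) \<Rightarrow> nat \<Rightarrow> 'z list \<Rightarrow> real list" where
  "energy_seq e n zs = map (\<lambda>t. e (take t zs)) [0..<n]"

text \<open>
  Law of \<open>(X\<^sup>t, Y\<^sup>t)\<close> under the causally conditioned input distribution \<open>q\<close>, where
  \<open>q x\<^sup>t\<^sup>-\<^sup>1 e\<^sup>t\<close> is the conditional law of \<open>X\<^sub>t\<close>.
\<close>

primrec causal_joint ::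
  "('x \<Rightarrow> 'y pmf) \<Rightarrow> ('x list \<Rightarrow> real list \<Rightarrow> 'x pmf) \<Rightarrow> ('y list \<Rightarrow> real) \<Rightarrow> nat \<Rightarrow>
   ('x list \<times> 'y list) pmf" where
  "causal_joint W q e 0 = return_pmf ([], [])"
| "causal_joint W q e (Suc t) =
     do {
       (xs, ys) \<leftarrow> causal_joint W q e t;
       x \<leftarrow> q xs (energy_seq e (Suc t) ys);
       y \<leftarrow> W x;
       return_pmf (xs @ [x], ys @ [y])
     }"

section \<open>Values of the objective functions over the feasible laws\<close>

definition generic_values ::
  "('x \<Rightarrow> 'y pmf) \<Rightarrow> ('x \<Rightarrow> real) \<Rightarrow> real \<Rightarrow> real set \<Rightarrow> real \<Rightarrow> nat \<Rightarrow> real set" where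
  "generic_values W \<phi> B \<E> \<Gamma> n =
     {mutual_info (channel_joint W p) fst snd | p es.
        \<forall>xs\<in>set_pmf p. (xs, es) \<in> admissible \<phi> B \<E> \<Gamma> n}"

definition receiver_values ::
  "('x \<Rightarrow> 'y pmf) \<Rightarrow> ('x \<Rightarrow> real) \<Rightarrow> real \<Rightarrow> real set \<Rightarrow> real \<Rightarrow> nat \<Rightarrow> real set" where
  "receiver_values W \<phi> B \<E> \<Gamma> n =
     {directed_info n (causal_joint W q e n) | q e.
        range e \<subseteq> \<E> \<and>
        (\<forall>(xs, ys)\<in>set_pmf (causal_joint W q e n).
           (xs, energy_seq e n ys) \<in> admissible \<phi> B \<E> \<Gamma> n)}"

definition adjacent_values ::
  "('x \<Rightarrow> 'y pmf) \<Rightarrow> ('x \<Rightarrow> real) \<Rightarrow> real \<Rightarrow> real set \<Rightarrow> real \<Rightarrow> nat \<Rightarrow> real set" where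
  "adjacent_values W \<phi> B \<E> \<Gamma> n =
     {mutual_info (channel_joint W p) fst snd | p e.
        range e \<subseteq> \<E> \<and>
        (\<forall>xs\<in>set_pmf p. (xs, energy_seq e n xs) \<in> admissible \<phi> B \<E> \<Gamma> n)}"

definition cognitive_values ::
  "('x \<Rightarrow> 'y pmf) \<Rightarrow> ('x \<Rightarrow> real) \<Rightarrow> real \<Rightarrow> real set \<Rightarrow> real \<Rightarrow> nat \<Rightarrow> real set" where
  "cognitive_values W \<phi> B \<E> \<Gamma> n =
     {mutual_info (channel_joint W (map_pmf fst p)) fst snd | p.
        set_pmf p \<subseteq> admissible \<phi> B \<E> \<Gamma> n}"

text \<open>\<open>v\<close> is the maximum of \<open>S\<close>, attained unless \<open>S\<close> is empty, where it is \<open>-\<infinity>\<close> by convention.\<close>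

definition is_maximum :: "real set \<Rightarrow> ereal \<Rightarrow> bool" where
  "is_maximum S v \<longleftrightarrow>
     (if S = {} then v = -\<infinity> else (\<exists>s\<in>S. v = ereal s \<and> (\<forall>s'\<in>S. s' \<le> s)))"

definition normalized_max_tendsto :: "(nat \<Rightarrow> real set) \<Rightarrow> ereal \<Rightarrow> bool" where
  "normalized_max_tendsto S C \<longleftrightarrow>
     (\<exists>v. (\<forall>n\<ge>1. is_maximum (S n) (v n)) \<and> (\<lambda>n. v n / ereal (real n)) \<longlonglongrightarrow> C)"

section \<open>The definitions unfold to the usual formulas\<close>

lemma pmf_memoryless:
  fixes W :: "'x \<Rightarrow> 'y pmf"
  shows "pmf (memoryless W xs) ys =
     (if length ys = length xs then \<Prod>t<length xs. pmf (W (xs ! t)) (ys ! t) else 0)"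
proof (induction xs arbitrary: ys)
  case Nil
  then show ?case by (auto simp: indicator_def)
next
  case (Cons x xs)
  have eq: "memoryless W (x # xs) = map_pmf (\<lambda>(y, ys). y # ys) (pair_pmf (W x) (memoryless W xs))"
    by (simp add: pair_pmf_def map_bind_pmf map_pmf_def bind_assoc_pmf bind_return_pmf)
  have inj: "inj (\<lambda>(y :: 'y, ys). y # ys)"
    by (auto simp: inj_on_def)
  show ?case
  proof (cases ys)
    case Nil
    have "[] \<notin> set_pmf (memoryless W (x # xs))"
      unfolding eq by auto
    then show ?thesis using Nil by (simp add: set_pmf_iff del: memoryless.simps)
  next
    case (Cons y zs)
    have "pmf (memoryless W (x # xs)) (y # zs) = pmf (pair_pmf (W x) (memoryless W xs)) (y, zs)"
      unfolding eq using pmf_map_inj'[OF inj, of _ "(y, zs)"] by simp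
    then show ?thesis
      using Cons Cons.IH[of zs] by (simp add: pmf_pair prod.lessThan_Suc_shift del: memoryless.simps prod.lessThan_Suc)
  qed
qed

lemma mutual_info_eq_sum:
  fixes p :: "'w pmf" and X :: "'w \<Rightarrow> 'a :: countable" and Y :: "'w \<Rightarrow> 'b :: countable"
  defines "pXY \<equiv> map_pmf (\<lambda>\<omega>. (X \<omega>, Y \<omega>)) p"
  assumes fin: "finite (set_pmf pXY)"
  shows "mutual_info p X Y =
    (\<Sum>(x, y)\<in>set_pmf pXY. pmf pXY (x, y) *
       log 2 (pmf pXY (x, y) / (pmf (map_pmf X p) x * pmf (map_pmf Y p) y)))"
proof -
  let ?C = "count_space (UNIV :: ('a \<times> 'b) set)"
  let ?q = "pair_pmf (map_pmf X p) (map_pmf Y p)"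
  have prod: "count_space (UNIV :: 'a set) \<Otimes>\<^sub>M count_space (UNIV :: 'b set) = ?C"
    by (simp add: pair_measure_countable)
  have 1: "distr (measure_pmf p) (count_space UNIV) X \<Otimes>\<^sub>M distr (measure_pmf p) (count_space UNIV) Y
      = density ?C (pmf ?q)" (is "?L = _")
  proof -
    have "?L = density (count_space UNIV) (pmf (map_pmf X p))
        \<Otimes>\<^sub>M density (count_space UNIV) (pmf (map_pmf Y p))"
      by (simp add: map_pmf_rep_eq flip: measure_pmf_eq_density)
    also have "\<dots> = density (count_space UNIV \<Otimes>\<^sub>M count_space UNIV)
        (\<lambda>(x, y). ennreal (pmf (map_pmf X p) x) * ennreal (pmf (map_pmf Y p) y))"
      by (rule pair_measure_density)
        (auto simp: sigma_finite_measure_count_space measure_pmf.sigma_finite_measure_axioms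
            simp flip: measure_pmf_eq_density)
    also have "\<dots> = density ?C (pmf ?q)"
      unfolding prod by (intro density_cong) (auto simp: pmf_pair ennreal_mult)
    finally show ?thesis .
  qed
  have 2: "distr (measure_pmf p) (count_space UNIV \<Otimes>\<^sub>M count_space UNIV) (\<lambda>\<omega>. (X \<omega>, Y \<omega>))
      = density ?C (pmf pXY)"
    unfolding prod pXY_def by (simp add: map_pmf_rep_eq flip: measure_pmf_eq_density)
  have ac: "pmf pXY z = 0" if "pmf ?q z = 0" for z
    using that unfolding pXY_def by (auto simp: pmf_eq_0_set_pmf)
  have "mutual_info p X Y = KL_divergence 2 (density ?C (pmf ?q)) (density ?C (pmf pXY))"
    unfolding mutual_info_def prob_space.mutual_information_def[OF measure_pmf.prob_space_axioms] 1 2 ..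
  also have "\<dots> = (\<integral>z. pmf pXY z * log 2 (pmf pXY z / pmf ?q z) \<partial>?C)"
    by (rule sigma_finite_measure.KL_density_density)
      (auto simp: sigma_finite_measure_count_space ac)
  also have "\<dots> = (\<Sum>z\<in>set_pmf pXY. pmf pXY z * log 2 (pmf pXY z / pmf ?q z))"
  proof -
    have "{z. pmf pXY z * log 2 (pmf pXY z / pmf ?q z) \<noteq> 0} \<subseteq> set_pmf pXY"
      by (auto simp: set_pmf_iff)
    then show ?thesis
      by (subst lebesgue_integral_count_space_finite_support)
        (auto intro!: sum.mono_neutral_left finite_subset[OF _ fin] fin)
  qed
  finally show ?thesis
    by (auto simp: pmf_pair intro!: sum.cong)
qed

end

theory Submission
  imports Defs "HOL-Real_Asymp.Real_Asymp"
begin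

text \<open>
  All four settings are treated at once by viewing a code as a family of deterministic policies, a
  policy fixing the reactions of transmitter and charger during a block. The objective functions are
  the mutual information between a random policy and the output sequence: for the receiver, drawing
  the reactions to all histories in advance turns a causally conditioned law into a law on policies
  (Kuhn), Bayes' rule inverts this, and the information density is in both pictures
  \<open>log (\<Prod>t. W x\<^sub>t y\<^sub>t / P(y\<^sup>n))\<close>.

  The converse is Fano's inequality. For achievability, Feinstein's lemma is applied to the channel
  from policies to output blocks; consecutive blocks are separated by a gap in which the transmitter
  is silent and the battery is recharged. If \<open>\<Gamma> > 0\<close>, a gap of fixed length meets the cost constraint.
  If \<open>\<Gamma> = 0\<close>, nothing is ever charged, so only boundedly many inputs have positive cost; a
  Kuhn-Tucker argument shows that they do not increase the rate beyond that of the free symbols,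
  for which no gap is needed.
\<close>

section \<open>Information between a random policy and the output\<close>

text \<open>The limit comes from two one-sided bounds. Feasible laws yield achievable rates, so the
  normalized maximum is eventually below every \<open>r\<close> above the capacity; codes of rate
  \<open>R\<close> force the maximum for block length \<open>n\<close> to be almost
  \<open>n R\<close>. The obstacle is a mismatch of quantifiers: the objective functions constrain
  only histories of positive probability, while a code must respect the battery for every charging
  sequence and the budget for every history. A policy is therefore changed off its support, where
  its law does not notice: the transmitter falls silent rather than overdraw, the charger falls back
  to the cheapest symbol. Unless the charger is cognitive, all messages share one charger, so every
  policy in the support of a law must carry the same charger and only the transmitter is random. If
  the charger ignores the outputs, a policy amounts to a fixed input sequence with its charges, and
  its output law is \<open>memoryless W xs\<close>; only the receiver setting has policies that
  react. Maxima are attained because a block meets finitely many histories and entropy is continuous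
  on a simplex.\<close>

abbreviation "E \<equiv> measure_pmf.expectation"
abbreviation "pr \<equiv> measure_pmf.prob"

lemma expectation_finite:
  fixes f :: "'a \<Rightarrow> real"
  assumes "finite A" "set_pmf p \<subseteq> A"
  shows "E p f = (\<Sum>x\<in>A. pmf p x * f x)"
  using assms by (subst integral_measure_pmf[of A]) (auto simp: set_pmf_iff)

lemma expectation_mono:
  fixes f g :: "'a \<Rightarrow> real"
  assumes "finite (set_pmf p)" "\<And>x. x \<in> set_pmf p \<Longrightarrow> f x \<le> g x"
  shows "E p f \<le> E p g"
  using assms by (simp add: expectation_finite[OF _ order_refl] sum_mono mult_left_mono)

lemma expectation_cong:
  fixes f g :: "'a \<Rightarrow> real"
  assumes "\<And>x. x \<in> set_pmf p \<Longrightarrow> f x = g x"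
  shows "E p f = E p g"
  using assms by (intro integral_cong_AE) (auto simp: AE_measure_pmf_iff)

lemma expectation_bind:
  fixes f :: "'b \<Rightarrow> real"
  assumes "finite (set_pmf p)" "\<And>x. x \<in> set_pmf p \<Longrightarrow> finite (set_pmf (g x))"
  shows "E (bind_pmf p g) f = E p (\<lambda>x. E (g x) f)"
  by (subst pmf_expectation_bind[of "set_pmf p"]) (auto simp: assms expectation_finite[OF assms(1) order_refl])

lemma prob_eq_expectation: "pr p A = E p (indicator A)"
  by simp

lemma prob_bind:
  assumes "finite (set_pmf p)" "\<And>x. x \<in> set_pmf p \<Longrightarrow> finite (set_pmf (g x))"
  shows "pr (bind_pmf p g) A = E p (\<lambda>x. pr (g x) A)"
  unfolding prob_eq_expectation using assms by (rule expectation_bind)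

lemma log2_le: "0 < z \<Longrightarrow> log 2 z \<le> (z - 1) / ln 2"
  unfolding log_def by (intro divide_right_mono) (auto simp: ln_le_minus_one)

abbreviation kl :: "'a pmf \<Rightarrow> 'a pmf \<Rightarrow> real" where
  "kl p q \<equiv> E p (\<lambda>y. log 2 (pmf p y / pmf q y))"

text \<open>The mutual information of \<open>u\<close> drawn from \<open>P\<close> and an output
  drawn from \<open>V u\<close>, as the average divergence from the output mixture. Policies are
  functions and form an uncountable type, while \<open>mutual_info_eq_sum\<close> asks for countable
  ones; this form makes sense for any type.\<close>

definition mixinfo :: "'u pmf \<Rightarrow> ('u \<Rightarrow> 'z pmf) \<Rightarrow> real" where
  "mixinfo P V = E P (\<lambda>u. kl (V u) (bind_pmf P V))"

lemma mixinfo_map: "mixinfo (map_pmf h P) V = mixinfo P (\<lambda>u. V (h u))"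
  unfolding mixinfo_def by (simp add: bind_map_pmf)

lemma mixinfo_cong:
  assumes "\<And>u. u \<in> set_pmf P \<Longrightarrow> V u = V' u"
  shows "mixinfo P V = mixinfo P V'"
proof -
  have "bind_pmf P V = bind_pmf P V'" using assms by (intro bind_pmf_cong) auto
  then show ?thesis unfolding mixinfo_def using assms by (intro expectation_cong) auto
qed

text \<open>Both bounds are Gibbs' inequality; the first one, applied to a decoder, is Fano's inequality.\<close>

lemma mixinfo_ge:
  assumes fP: "finite (set_pmf P)" and fV: "\<And>u. u \<in> set_pmf P \<Longrightarrow> finite (set_pmf (V u))"
    and r: "\<And>u y. 0 < r u y" and r1: "\<And>y. (\<Sum>u\<in>set_pmf P. pmf P u * r u y) \<le> 1"
  shows "E P (\<lambda>u. E (V u) (\<lambda>y. log 2 (r u y))) \<le> mixinfo P V"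
proof -
  define Q where "Q = bind_pmf P V"
  have sQ: "set_pmf Q = (\<Union>u\<in>set_pmf P. set_pmf (V u))" by (auto simp: Q_def)
  have fQ: "finite (set_pmf Q)" using sQ fP fV by auto
  \<comment> \<open>\<open>pmf P u * r u y\<close> acts as a guessed posterior of \<open>u\<close>
    given \<open>y\<close>. Multiplied by the output law it is a subprobability on pairs, and the
    difference is minus the divergence of the true joint law from it.\<close>
  have "E P (\<lambda>u. E (V u) (\<lambda>y. log 2 (r u y))) - mixinfo P V
      = (\<Sum>u\<in>set_pmf P. pmf P u * (\<Sum>y\<in>set_pmf (V u). pmf (V u) y * (log 2 (r u y) - log 2 (pmf (V u) y / pmf Q y))))"
    unfolding mixinfo_def Q_def[symmetric]
    by (simp add: expectation_finite[OF fP order_refl] expectation_finite[OF fV order_refl]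
        sum_subtractf algebra_simps cong: sum.cong)
  also have "\<dots> \<le> (\<Sum>u\<in>set_pmf P. pmf P u * (\<Sum>y\<in>set_pmf (V u). (r u y * pmf Q y - pmf (V u) y) / ln 2))"
  proof (intro sum_mono mult_left_mono)
    fix u y assume u: "u \<in> set_pmf P" "y \<in> set_pmf (V u)"
    have v: "0 < pmf (V u) y" using u by (simp add: pmf_positive)
    have q: "0 < pmf Q y" using u sQ by (auto intro!: pmf_positive)
    have "log 2 (r u y) - log 2 (pmf (V u) y / pmf Q y) = log 2 (r u y * pmf Q y / pmf (V u) y)"
      using v q r[of u y] by (simp add: log_divide log_mult)
    also have "\<dots> \<le> (r u y * pmf Q y / pmf (V u) y - 1) / ln 2"
      using v q r by (intro log2_le) auto
    finally have "pmf (V u) y * (log 2 (r u y) - log 2 (pmf (V u) y / pmf Q y))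
      \<le> pmf (V u) y * ((r u y * pmf Q y / pmf (V u) y - 1) / ln 2)"
      using v by (intro mult_left_mono) auto
    also have "\<dots> = (r u y * pmf Q y - pmf (V u) y) / ln 2"
      using v by (simp add: field_simps)
    finally show "pmf (V u) y * (log 2 (r u y) - log 2 (pmf (V u) y / pmf Q y)) \<le> (r u y * pmf Q y - pmf (V u) y) / ln 2" .
  qed auto
  also have "\<dots> = (\<Sum>u\<in>set_pmf P. pmf P u * (((\<Sum>y\<in>set_pmf (V u). r u y * pmf Q y) - 1) / ln 2))"
    using fV by (intro sum.cong) (auto simp flip: sum_divide_distrib simp: sum_subtractf sum_pmf_eq_1)
  also have "\<dots> \<le> (\<Sum>u\<in>set_pmf P. pmf P u * (((\<Sum>y\<in>set_pmf Q. r u y * pmf Q y) - 1) / ln 2))"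
    using r fQ sQ
    by (intro sum_mono mult_left_mono divide_right_mono diff_right_mono sum_mono2) (auto simp: less_imp_le)
  also have "\<dots> = ((\<Sum>u\<in>set_pmf P. \<Sum>y\<in>set_pmf Q. pmf P u * r u y * pmf Q y) - (\<Sum>u\<in>set_pmf P. pmf P u)) / ln 2"
    by (simp add: sum_subtractf sum_divide_distrib[symmetric] sum_distrib_left algebra_simps diff_divide_distrib)
  also have "\<dots> = ((\<Sum>y\<in>set_pmf Q. (\<Sum>u\<in>set_pmf P. pmf P u * r u y) * pmf Q y) - 1) / ln 2"
    by (subst sum.swap) (simp add: sum_pmf_eq_1 fP sum_distrib_right)
  also have "\<dots> \<le> ((\<Sum>y\<in>set_pmf Q. 1 * pmf Q y) - 1) / ln 2"
    using r1 by (intro divide_right_mono diff_right_mono sum_mono mult_right_mono) auto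
  also have "\<dots> = 0" by (simp add: sum_pmf_eq_1 fQ)
  finally show ?thesis by simp
qed

lemma mixinfo_le:
  assumes fP: "finite (set_pmf P)" and fV: "\<And>u. u \<in> set_pmf P \<Longrightarrow> finite (set_pmf (V u))"
    and q0: "\<And>u y. u \<in> set_pmf P \<Longrightarrow> y \<in> set_pmf (V u) \<Longrightarrow> 0 < q y"
    and q1: "(\<Sum>y\<in>set_pmf (bind_pmf P V). q y) \<le> 1"
  shows "mixinfo P V \<le> E P (\<lambda>u. E (V u) (\<lambda>y. log 2 (pmf (V u) y / q y)))"
proof -
  define Q where "Q = bind_pmf P V"
  have sQ: "set_pmf Q = (\<Union>u\<in>set_pmf P. set_pmf (V u))" by (auto simp: Q_def)
  have fQ: "finite (set_pmf Q)" using sQ fP fV by auto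
  have "mixinfo P V - E P (\<lambda>u. E (V u) (\<lambda>y. log 2 (pmf (V u) y / q y)))
      = (\<Sum>u\<in>set_pmf P. pmf P u * (\<Sum>y\<in>set_pmf (V u). pmf (V u) y * (log 2 (pmf (V u) y / pmf Q y) - log 2 (pmf (V u) y / q y))))"
    unfolding mixinfo_def Q_def[symmetric]
    by (simp add: expectation_finite[OF fP order_refl] expectation_finite[OF fV order_refl]
        sum_subtractf algebra_simps cong: sum.cong)
  \<comment> \<open>The conditional laws cancel, and the average over \<open>u\<close> becomes one
    over the mixture \<open>Q\<close>: the difference is minus the divergence of \<open>Q\<close>
    from \<open>q\<close>.\<close>
  also have "\<dots> = (\<Sum>u\<in>set_pmf P. pmf P u * (\<Sum>y\<in>set_pmf (V u). pmf (V u) y * log 2 (q y / pmf Q y)))"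
  proof (intro sum.cong refl arg_cong2[where f = "(*)"])
    fix u y assume u: "u \<in> set_pmf P" "y \<in> set_pmf (V u)"
    have v: "0 < pmf (V u) y" using u by (simp add: pmf_positive)
    have q: "0 < pmf Q y" using u sQ by (auto intro!: pmf_positive)
    show "log 2 (pmf (V u) y / pmf Q y) - log 2 (pmf (V u) y / q y) = log 2 (q y / pmf Q y)"
      using v q q0[OF u] by (simp add: log_divide)
  qed
  also have "\<dots> = E Q (\<lambda>y. log 2 (q y / pmf Q y))"
    unfolding Q_def by (subst expectation_bind[OF fP fV])
      (simp_all add: expectation_finite[OF fP order_refl] expectation_finite[OF fV order_refl] cong: sum.cong)
  also have "\<dots> \<le> E Q (\<lambda>y. (q y / pmf Q y - 1) / ln 2)"
    using q0 sQ by (intro expectation_mono fQ log2_le) (auto intro!: divide_pos_pos pmf_positive)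
  also have "\<dots> = (\<Sum>y\<in>set_pmf Q. (q y - pmf Q y) / ln 2)"
    unfolding expectation_finite[OF fQ order_refl]
    by (intro sum.cong) (auto simp: field_simps set_pmf_iff)
  also have "\<dots> = ((\<Sum>y\<in>set_pmf Q. q y) - 1) / ln 2"
    by (simp add: sum_divide_distrib[symmetric] sum_subtractf sum_pmf_eq_1 fQ)
  also have "\<dots> \<le> 0" using q1 by (simp add: Q_def field_simps)
  finally show ?thesis by simp
qed

lemma fano:
  assumes fV: "\<And>m. m \<in> {1..M} \<Longrightarrow> finite (set_pmf (V m))" and M: "1 \<le> M"
  shows "(1 - (\<Sum>m\<in>{1..M}. pr (V m) {y. g y \<noteq> m}) / real M) * log 2 (real M)
     \<le> mixinfo (pmf_of_set {1..M}) V + 1"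
proof -
  define P where "P = pmf_of_set {1..M}"
  have sP: "set_pmf P = {1..M}" using M by (simp add: P_def)
  have P: "pmf P m = 1 / real M" if "m \<in> {1..M}" for m using that M by (simp add: P_def)
  \<comment> \<open>The guessed posterior puts one half on the decoded message and spreads the other
    half uniformly, which keeps \<open>r\<close> positive. A correct decision contributes at least
    \<open>log 2 M - 1\<close>, a wrong one exactly \<open>-1\<close>.\<close>
  define r where "r = (\<lambda>m y. (if g y = m then real M / 2 else 0) + 1 / 2)"
  have "(1 - (\<Sum>m\<in>{1..M}. pr (V m) {y. g y \<noteq> m}) / real M) * log 2 (real M) - 1
    = (\<Sum>m\<in>{1..M}. 1 / real M * (log 2 (real M) * (1 - pr (V m) {y. g y \<noteq> m}) - 1))"
    using M by (simp add: sum_subtractf sum_divide_distrib[symmetric] sum.distrib sum_distrib_left[symmetric] field_simps)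
  also have "\<dots> \<le> (\<Sum>m\<in>{1..M}. 1 / real M * E (V m) (\<lambda>y. log 2 (r m y)))"
  proof (intro sum_mono mult_left_mono)
    fix m assume m: "m \<in> {1..M}"
    have "log 2 (real M) * (1 - pr (V m) {y. g y \<noteq> m}) - 1
       = log 2 (real M) * pr (V m) {y. g y = m} - 1"
      using measure_pmf.prob_compl[of "{y. g y \<noteq> m}" "V m"] by (simp add: Compl_eq_Diff_UNIV[symmetric] Collect_neg_eq[symmetric])
    also have "\<dots> = E (V m) (\<lambda>y. log 2 (real M) * indicator {y. g y = m} y - 1)"
      by (simp add: integrable_measure_pmf_finite fV[OF m])
    also have "\<dots> \<le> E (V m) (\<lambda>y. log 2 (r m y))"
    proof (intro expectation_mono fV m)
      fix y
      show "log 2 (real M) * indicator {y. g y = m} y - 1 \<le> log 2 (r m y)"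
      proof (cases "g y = m")
        case True
        have "log 2 (real M) - 1 = log 2 (real M / 2)" using M by (simp add: log_divide)
        also have "\<dots> \<le> log 2 (real M / 2 + 1 / 2)" using M by simp
        finally show ?thesis using True by (simp add: r_def add_divide_distrib)
      next
        case False
        then show ?thesis by (simp add: r_def log_divide)
      qed
    qed
    finally show "log 2 (real M) * (1 - pr (V m) {y. g y \<noteq> m}) - 1 \<le> E (V m) (\<lambda>y. log 2 (r m y))" .
  qed auto
  also have "\<dots> = E P (\<lambda>m. E (V m) (\<lambda>y. log 2 (r m y)))"
    by (subst expectation_finite[of "{1..M}"]) (auto simp: sP P)
  also have "\<dots> \<le> mixinfo P V"
  proof (rule mixinfo_ge)
    fix y
    have "(\<Sum>u\<in>set_pmf P. pmf P u * r u y) = (\<Sum>m\<in>{1..M}. 1 / real M * (if g y = m then real M / 2 else 0) + 1 / real M / 2)"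
      unfolding sP by (intro sum.cong) (auto simp: P r_def field_simps)
    also have "\<dots> = (\<Sum>m\<in>{1..M}. if g y = m then 1 / 2 else 0) + 1 / 2"
      using M by (simp add: sum.distrib if_distrib[of "\<lambda>x. x / real M"] cong: if_cong)
    also have "\<dots> \<le> 1" by (simp add: sum.delta)
    finally show "(\<Sum>u\<in>set_pmf P. pmf P u * r u y) \<le> 1" .
  qed (auto simp: sP fV[simplified] r_def add_nonneg_pos)
  finally show ?thesis by (simp add: P_def)
qed

section \<open>The coding theorem for memoryless channels\<close>

lemma finite_set_memoryless:
  assumes "\<And>x. x \<in> set xs \<Longrightarrow> finite (set_pmf (W x))"
  shows "finite (set_pmf (memoryless W xs))"
  using assms by (induction xs) auto

lemma finite_set_replicate_pmf: "finite (set_pmf p) \<Longrightarrow> finite (set_pmf (replicate_pmf n p))"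
  by (induction n) auto

lemma length_memoryless: "ys \<in> set_pmf (memoryless W xs) \<Longrightarrow> length ys = length xs"
  by (auto simp: set_pmf_iff pmf_memoryless split: if_splits)

text \<open>Feinstein's greedy construction: as long as the decoding sets chosen so far are unlikely under the
  output law, some input still has a large part of its high-information outputs outside them.\<close>

lemma feinstein:
  fixes V :: "'u \<Rightarrow> 'z pmf"
  assumes fP: "finite (set_pmf P)" and fV: "\<And>u. u \<in> set_pmf P \<Longrightarrow> finite (set_pmf (V u))"
    and t: "0 < t"
    and \<delta>: "E P (\<lambda>u. pr (V u) {y. pmf (V u) y \<le> t * pmf (bind_pmf P V) y}) \<le> \<delta>"
    and M: "real M / t + \<delta> \<le> \<epsilon>"
  shows "\<exists>w D. (\<forall>i<M. w i \<in> set_pmf P \<and> pr (V (w i)) (D i) \<ge> 1 - \<epsilon> \<and> pr (bind_pmf P V) (D i) \<le> 1 / t)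
     \<and> (\<forall>i<M. \<forall>j<i. D i \<inter> D j = {})"
  using M
proof (induction M)
  case 0
  then show ?case by simp
next
  case (Suc M)
  define Q where "Q = bind_pmf P V"
  have sQ: "set_pmf Q = (\<Union>u\<in>set_pmf P. set_pmf (V u))" by (auto simp: Q_def)
  have fQ: "finite (set_pmf Q)" using sQ fP fV by auto
  have "real M / t + \<delta> \<le> \<epsilon>" using Suc.prems t by (smt (verit) divide_right_mono of_nat_Suc)
  then obtain w D where wD: "\<And>i. i < M \<Longrightarrow> w i \<in> set_pmf P \<and> pr (V (w i)) (D i) \<ge> 1 - \<epsilon> \<and> pr Q (D i) \<le> 1 / t"
    and disj: "\<And>i j. i < M \<Longrightarrow> j < i \<Longrightarrow> D i \<inter> D j = {}"
    using Suc.IH unfolding Q_def by metis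
  define U where "U = (\<Union>i<M. D i)"
  define G where "G u = {y. pmf (V u) y > t * pmf Q y} - U" for u
  have "pr Q U \<le> (\<Sum>i<M. pr Q (D i))"
    unfolding U_def by (intro measure_pmf.finite_measure_subadditive_finite) auto
  also have "\<dots> \<le> (\<Sum>i<M. 1 / t)" using wD by (intro sum_mono) auto
  finally have U: "pr Q U \<le> real M / t" by simp
  have G: "1 - pr (V u) {y. pmf (V u) y \<le> t * pmf Q y} - pr (V u) U \<le> pr (V u) (G u)" for u
  proof -
    have "1 = pr (V u) UNIV" by simp
    also have "\<dots> \<le> pr (V u) (G u \<union> ({y. pmf (V u) y \<le> t * pmf Q y} \<union> U))"
      by (intro measure_pmf.finite_measure_mono) (auto simp: G_def)
    also have "\<dots> \<le> pr (V u) (G u) + (pr (V u) {y. pmf (V u) y \<le> t * pmf Q y} + pr (V u) U)"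
      by (intro order_trans[OF measure_Un_le] add_left_mono measure_Un_le) auto
    finally show ?thesis by simp
  qed
  have "\<exists>u\<in>set_pmf P. pr (V u) (G u) \<ge> 1 - \<epsilon>"
  proof (rule ccontr)
    assume "\<not> ?thesis"
    then have less: "\<And>u. u \<in> set_pmf P \<Longrightarrow> pr (V u) (G u) < 1 - \<epsilon>" by force
    have "1 - \<delta> - real M / t \<le> 1 - E P (\<lambda>u. pr (V u) {y. pmf (V u) y \<le> t * pmf Q y}) - pr Q U"
      using \<delta> U unfolding Q_def by linarith
    also have "\<dots> = E P (\<lambda>u. 1 - pr (V u) {y. pmf (V u) y \<le> t * pmf Q y} - pr (V u) U)"
      unfolding Q_def by (simp add: prob_bind[OF fP fV] integrable_measure_pmf_finite fP)
    also have "\<dots> \<le> E P (\<lambda>u. pr (V u) (G u))"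
      by (intro expectation_mono fP G)
    also have "\<dots> = (\<Sum>u\<in>set_pmf P. pmf P u * pr (V u) (G u))"
      by (simp add: expectation_finite[OF fP order_refl])
    also have "\<dots> < (\<Sum>u\<in>set_pmf P. pmf P u * (1 - \<epsilon>))"
      using less fP by (intro sum_strict_mono mult_strict_left_mono pmf_positive) (auto simp: set_pmf_not_empty)
    also have "\<dots> = 1 - \<epsilon>" by (simp add: sum_distrib_right[symmetric] sum_pmf_eq_1 fP)
    finally have "\<epsilon> < real M / t + \<delta>" by simp
    moreover have "real M / t \<le> real (Suc M) / t" using t by (intro divide_right_mono) auto
    ultimately show False using Suc.prems by linarith
  qed
  then obtain u where u: "u \<in> set_pmf P" "pr (V u) (G u) \<ge> 1 - \<epsilon>" by blast
  \<comment> \<open>On \<open>G u\<close> the output law is below \<open>1 / t\<close> times the law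
    of \<open>u\<close>. This bound, kept for every decoding set, limits the part of the output
    space already occupied.\<close>
  have "pr Q (G u) = pr Q (G u \<inter> set_pmf Q)" by (simp add: measure_Int_set_pmf)
  also have "\<dots> = (\<Sum>y\<in>G u \<inter> set_pmf Q. pmf Q y)" using fQ by (intro measure_measure_pmf_finite) auto
  also have "\<dots> \<le> (\<Sum>y\<in>G u \<inter> set_pmf Q. pmf (V u) y / t)"
    using t by (intro sum_mono) (auto simp: G_def field_simps)
  also have "\<dots> = pr (V u) (G u \<inter> set_pmf Q) / t"
    using fQ by (subst measure_measure_pmf_finite) (auto simp: sum_divide_distrib)
  also have "\<dots> \<le> 1 / t" using t by (intro divide_right_mono) auto
  finally have "pr Q (G u) \<le> 1 / t" .
  then show ?case
    using wD u disj
    by (intro exI[of _ "w(M := u)"] exI[of _ "D(M := G u)"])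
       (auto simp: Q_def[symmetric] less_Suc_eq G_def U_def)
qed

definition block_law :: "nat \<Rightarrow> 'u pmf \<Rightarrow> ('u \<Rightarrow> 'z pmf) \<Rightarrow> ('u list \<times> 'z list) pmf" where
  "block_law N P V = do { us \<leftarrow> replicate_pmf N P; zs \<leftarrow> memoryless V us; return_pmf (us, zs) }"

lemma block_law_0: "block_law 0 P V = return_pmf ([], [])"
  by (simp add: block_law_def bind_return_pmf)

lemma block_law_Suc:
  "block_law (Suc N) P V =
     do { u \<leftarrow> P; z \<leftarrow> V u; (us, zs) \<leftarrow> block_law N P V; return_pmf (u # us, z # zs) }"
  unfolding block_law_def
  by (simp add: bind_assoc_pmf bind_return_pmf)
    (intro bind_pmf_cong refl, subst bind_commute_pmf, simp)

lemma finite_block_law: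
  assumes "finite (set_pmf P)" "\<And>u. u \<in> set_pmf P \<Longrightarrow> finite (set_pmf (V u))"
  shows "finite (set_pmf (block_law N P V))"
  by (induction N) (auto simp: block_law_0 block_law_Suc assms intro!: finite_UN_I split: prod.splits)

text \<open>The summands are independent and centred, so cross terms vanish and second moments add
  up. This is the variance needed for Chebyshev's inequality.\<close>

lemma block_law_second_moment:
  fixes l :: "'u \<Rightarrow> 'z \<Rightarrow> real"
  assumes fP: "finite (set_pmf P)" and fV: "\<And>u. u \<in> set_pmf P \<Longrightarrow> finite (set_pmf (V u))"
    and l0: "E P (\<lambda>u. E (V u) (l u)) = 0"
  defines "S \<equiv> \<lambda>(us, zs). sum_list (map2 l us zs)"
  shows "E (block_law N P V) S = 0"
    and "E (block_law N P V) (\<lambda>x. (S x)\<^sup>2) = real N * E P (\<lambda>u. E (V u) (\<lambda>z. (l u z)\<^sup>2))"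
proof (induction N)
  case 0
  show "E (block_law 0 P V) S = 0" "E (block_law 0 P V) (\<lambda>x. (S x)\<^sup>2) = real 0 * E P (\<lambda>u. E (V u) (\<lambda>z. (l u z)\<^sup>2))"
    by (simp_all add: block_law_0 S_def)
next
  case (Suc N)
  note [simp] = integrable_measure_pmf_finite fP fV finite_block_law
  have *: "E (block_law (Suc N) P V) f = E P (\<lambda>u. E (V u) (\<lambda>z. E (block_law N P V) (\<lambda>x. f (u # fst x, z # snd x))))" for f :: "_ \<Rightarrow> real"
    unfolding block_law_Suc
    by (subst expectation_bind expectation_cong[OF expectation_bind] | force simp: case_prod_beta intro!: expectation_cong)+
  have S: "S (u # us, z # zs) = l u z + S (us, zs)" for u us z zs by (simp add: S_def)
  show "E (block_law (Suc N) P V) S = 0"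
    by (simp add: * S Suc l0 cong: expectation_cong)
  have "E (block_law (Suc N) P V) (\<lambda>x. (S x)\<^sup>2)
     = E P (\<lambda>u. E (V u) (\<lambda>z. E (block_law N P V) (\<lambda>x. (l u z)\<^sup>2 + 2 * l u z * S x + (S x)\<^sup>2)))"
    by (simp add: * S power2_sum algebra_simps)
  also have "\<dots> = real (Suc N) * E P (\<lambda>u. E (V u) (\<lambda>z. (l u z)\<^sup>2))"
    by (simp add: Suc algebra_simps cong: expectation_cong)
  finally show "E (block_law (Suc N) P V) (\<lambda>x. (S x)\<^sup>2) = real (Suc N) * E P (\<lambda>u. E (V u) (\<lambda>z. (l u z)\<^sup>2))" .
qed

text \<open>Independent inputs give independent outputs. The product law is written as a channel fed
  with dummy inputs so that \<open>pmf_memoryless\<close> also provides its probabilities.\<close>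

lemma bind_replicate_memoryless:
  "bind_pmf (replicate_pmf N P) (memoryless V) = memoryless (\<lambda>_. bind_pmf P V) (replicate N ())"
proof (induction N)
  case (Suc N)
  have "bind_pmf (replicate_pmf (Suc N) P) (memoryless V)
     = do { u \<leftarrow> P; us \<leftarrow> replicate_pmf N P; z \<leftarrow> V u; zs \<leftarrow> memoryless V us; return_pmf (z # zs) }"
    by (simp add: bind_assoc_pmf bind_return_pmf)
  also have "\<dots> = do { u \<leftarrow> P; z \<leftarrow> V u; zs \<leftarrow> bind_pmf (replicate_pmf N P) (memoryless V); return_pmf (z # zs) }"
    by (simp add: bind_assoc_pmf) (intro bind_pmf_cong refl, subst bind_commute_pmf, simp)
  finally show ?case by (simp add: Suc bind_assoc_pmf)
qed (simp add: bind_return_pmf)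

lemma memoryless_ratio:
  assumes len: "length us = N" "length zs = N"
    and pos: "\<And>i. i < N \<Longrightarrow> 0 < pmf (V (us ! i)) (zs ! i) \<and> 0 < pmf Q (zs ! i)"
  shows "log 2 (pmf (memoryless V us) zs / pmf (memoryless (\<lambda>_. Q) (replicate N ())) zs)
    = sum_list (map2 (\<lambda>u z. log 2 (pmf (V u) z / pmf Q z)) us zs)"
proof -
  have "pmf (memoryless V us) zs / pmf (memoryless (\<lambda>_. Q) (replicate N ())) zs
     = (\<Prod>i<N. pmf (V (us ! i)) (zs ! i) / pmf Q (zs ! i))"
    using len by (simp add: pmf_memoryless prod_dividef)
  moreover have "log 2 \<dots> = (\<Sum>i<N. log 2 (pmf (V (us ! i)) (zs ! i) / pmf Q (zs ! i)))"
    using pos unfolding log_def by (subst ln_prod) (force simp: sum_divide_distrib)+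
  ultimately show ?thesis
    using len by (simp add: sum_list_sum_nth atLeast0LessThan)
qed

text \<open>Feinstein's construction on the \<open>N\<close>-fold product, where Chebyshev's
  inequality makes low information densities rare. Every number \<open>m\<close>, message or not,
  receives a word over the support of \<open>P\<close>, because a charger must belong to its class
  for all message numbers.\<close>

theorem coding_theorem:
  fixes V :: "'u \<Rightarrow> 'z pmf"
  assumes fP: "finite (set_pmf P)" and fV: "\<And>u. u \<in> set_pmf P \<Longrightarrow> finite (set_pmf (V u))"
    and R: "R < mixinfo P V" and \<epsilon>: "0 < \<epsilon>"
  shows "\<forall>\<^sub>F N in sequentially. \<forall>M::nat. 1 \<le> M \<and> real M \<le> 2 powr (real N * R) \<longrightarrow>
     (\<exists>w d. (\<forall>m. length (w m) = N \<and> set (w m) \<subseteq> set_pmf P) \<and> (\<forall>zs. d zs \<in> {1..M}) \<and>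
        (\<forall>m\<in>{1..M}. pr (memoryless V (w m)) {zs. d zs \<noteq> m} \<le> \<epsilon>))"
proof -
  define I where "I = mixinfo P V"
  \<comment> \<open>Half of the rate gap: the threshold \<open>t\<close> lies
    \<open>N * \<delta>\<close> below the mean density, in exponent, and the other half makes
    \<open>M / t\<close> vanish.\<close>
  define \<delta> where "\<delta> = (I - R) / 2"
  have \<delta>: "0 < \<delta>" "I - \<delta> = R + \<delta>" using R by (auto simp: \<delta>_def I_def field_simps)
  define Q where "Q = bind_pmf P V"
  define l where "l u z = log 2 (pmf (V u) z / pmf Q z) - I" for u z
  define v where "v = E P (\<lambda>u. E (V u) (\<lambda>z. (l u z)\<^sup>2))"
  note [simp] = integrable_measure_pmf_finite fP fV finite_block_law
  have l0: "E P (\<lambda>u. E (V u) (l u)) = 0"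
  proof -
    have "E P (\<lambda>u. E (V u) (l u)) = E P (\<lambda>u. E (V u) (\<lambda>z. log 2 (pmf (V u) z / pmf Q z)) - I)"
      unfolding l_def by (intro expectation_cong) simp
    also have "\<dots> = 0" by (simp add: I_def mixinfo_def Q_def)
    finally show ?thesis .
  qed
  have "(\<lambda>N. v / (real N * \<delta>\<^sup>2) + 2 powr (- real N * \<delta>)) \<longlonglongrightarrow> 0"
    using \<delta>(1) by real_asymp
  then have "\<forall>\<^sub>F N in sequentially. v / (real N * \<delta>\<^sup>2) + 2 powr (- real N * \<delta>) < \<epsilon>"
    using \<epsilon> by (rule order_tendstoD)
  then show ?thesis
    using eventually_gt_at_top[of 0]
  proof eventually_elim
    case (elim N)
    show ?case
    proof (intro allI impI)
      fix M :: nat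
      assume M: "1 \<le> M \<and> real M \<le> 2 powr (real N * R)"
      define PN where "PN = replicate_pmf N P"
      define QN where "QN = bind_pmf PN (memoryless V)"
      have fPN: "finite (set_pmf PN)" by (simp add: PN_def finite_set_replicate_pmf)
      have sPN: "length us = N \<and> set us \<subseteq> set_pmf P" if "us \<in> set_pmf PN" for us
        using that by (auto simp: PN_def set_replicate_pmf)
      have fVN: "finite (set_pmf (memoryless V us))" if "us \<in> set_pmf PN" for us
        using sPN[OF that] by (intro finite_set_memoryless) auto
      define t where "t = 2 powr (real N * (I - \<delta>))"
      define S where "S = (\<lambda>(us, zs). sum_list (map2 l us zs))"
      have "E PN (\<lambda>us. pr (memoryless V us) {zs. pmf (memoryless V us) zs \<le> t * pmf QN zs})
        = pr (block_law N P V) {(us, zs). pmf (memoryless V us) zs \<le> t * pmf QN zs}"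
        unfolding block_law_def PN_def[symmetric]
        by (subst prob_bind[OF fPN]) (auto simp: fVN map_pmf_def[symmetric] vimage_def intro!: expectation_cong)
      \<comment> \<open>Chebyshev's inequality: a density below the threshold makes the centred sum
        \<open>S\<close> deviate from 0 by at least \<open>N * \<delta>\<close>.\<close>
      also have "\<dots> \<le> E (block_law N P V) (\<lambda>x. (S x)\<^sup>2 / (real N * \<delta>)\<^sup>2)"
        unfolding prob_eq_expectation
      proof (intro expectation_mono)
        fix x assume x: "x \<in> set_pmf (block_law N P V)"
        obtain us zs where xx: "x = (us, zs)" by (cases x)
        have us: "us \<in> set_pmf PN" and zs: "zs \<in> set_pmf (memoryless V us)"
          using x by (auto simp: xx block_law_def PN_def)
        have len: "length us = N" "length zs = N" using sPN[OF us] length_memoryless[OF zs] by auto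
        have pos: "0 < pmf (V (us ! i)) (zs ! i) \<and> 0 < pmf Q (zs ! i)" if i: "i < N" for i
        proof -
          have "0 < pmf (memoryless V us) zs" using zs by (rule pmf_positive)
          then have "0 < (\<Prod>t<N. pmf (V (us ! t)) (zs ! t))" using len by (simp add: pmf_memoryless)
          then have "pmf (V (us ! i)) (zs ! i) \<noteq> 0" using i
            by (metis finite_lessThan lessThan_iff less_irrefl prod_zero_iff)
          moreover from this have "zs ! i \<in> set_pmf Q" unfolding Q_def
            using sPN[OF us] len i by (auto simp: set_pmf_iff[symmetric] intro!: bexI[of _ "us ! i"])
          ultimately show ?thesis by (auto simp: set_pmf_iff less_le)
        qed
        have QN: "QN = memoryless (\<lambda>_. Q) (replicate N ())"
          unfolding QN_def PN_def Q_def by (rule bind_replicate_memoryless)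
        have SI: "S x = log 2 (pmf (memoryless V us) zs / pmf QN zs) - real N * I"
        proof -
          have "S x = (\<Sum>i<N. log 2 (pmf (V (us ! i)) (zs ! i) / pmf Q (zs ! i)) - I)"
            using len by (simp add: S_def xx sum_list_sum_nth atLeast0LessThan l_def)
          then show ?thesis
            unfolding QN using len by (subst memoryless_ratio[OF len pos]) (simp_all add: sum_list_sum_nth atLeast0LessThan sum_subtractf)
        qed
        have QNpos: "0 < pmf QN zs" using us zs unfolding QN_def by (intro pmf_positive) auto
        show "indicator {(us, zs). pmf (memoryless V us) zs \<le> t * pmf QN zs} x \<le> (S x)\<^sup>2 / (real N * \<delta>)\<^sup>2"
        proof (cases "pmf (memoryless V us) zs \<le> t * pmf QN zs")
          case True
          then have "pmf (memoryless V us) zs / pmf QN zs \<le> t" using QNpos by (simp add: field_simps)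
          then have "log 2 (pmf (memoryless V us) zs / pmf QN zs) \<le> real N * (I - \<delta>)"
            using QNpos pmf_positive[OF zs] unfolding t_def by (subst log_le_iff) auto
          then have "S x \<le> - (real N * \<delta>)" unfolding SI by (simp add: algebra_simps)
          moreover have "0 < real N * \<delta>" using \<delta> elim by simp
          ultimately have "(real N * \<delta>)\<^sup>2 \<le> (S x)\<^sup>2" by (smt (verit) power2_minus power_mono)
          then have "1 \<le> (S x)\<^sup>2 / (real N * \<delta>)\<^sup>2"
            using elim \<delta>(1) by (subst le_divide_eq_1_pos) auto
          then show ?thesis using True by (simp add: xx)
        next
          case False
          then show ?thesis by (simp add: xx)
        qed
      qed simp
      also have "\<dots> = v / (real N * \<delta>\<^sup>2)"
        using block_law_second_moment(2)[OF fP fV l0, of N] elim \<delta>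
        by (simp add: S_def v_def power2_eq_square field_simps)
      finally have d: "E PN (\<lambda>us. pr (memoryless V us) {zs. pmf (memoryless V us) zs \<le> t * pmf QN zs}) \<le> v / (real N * \<delta>\<^sup>2)" .
      have "real M / t \<le> 2 powr (real N * R) / t" using M by (intro divide_right_mono) (auto simp: t_def)
      also have "\<dots> = 2 powr (- real N * \<delta>)"
        unfolding t_def \<delta>(2) by (simp add: powr_diff[symmetric] algebra_simps)
      finally have Mt: "real M / t + v / (real N * \<delta>\<^sup>2) \<le> \<epsilon>" using elim by simp
      have "0 < t" by (simp add: t_def)
      then obtain w D where wD': "\<forall>i<M. w i \<in> set_pmf PN \<and> pr (memoryless V (w i)) (D i) \<ge> 1 - \<epsilon> \<and> pr (bind_pmf PN (memoryless V)) (D i) \<le> 1 / t"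
        and disj': "\<forall>i<M. \<forall>j<i. D i \<inter> D j = {}"
        using feinstein[OF fPN fVN _ d[unfolded QN_def] Mt] by blast
      have wD: "w i \<in> set_pmf PN \<and> pr (memoryless V (w i)) (D i) \<ge> 1 - \<epsilon>" if "i < M" for i
        using wD' that by blast
      have disj: "D i \<inter> D j = {}" if "i < M" "j < i" for i j
        using disj' that by blast
      define w' where "w' m = (if m \<in> {1..M} then w (m - 1) else w 0)" for m
      define d' where "d' z = (if \<exists>i<M. z \<in> D i then Suc (LEAST i. i < M \<and> z \<in> D i) else 1)" for z
      have w': "w' m \<in> set_pmf PN" for m using wD M by (auto simp: w'_def)
      have dec: "d' z = Suc i" if "i < M" "z \<in> D i" for z i
      proof -
        have "(LEAST i. i < M \<and> z \<in> D i) = i"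
          using that disj by (intro Least_equality) (auto, meson disjoint_iff not_le)
        then show ?thesis using that by (auto simp: d'_def)
      qed
      have d'M: "d' z \<in> {1..M}" for z
      proof (cases "\<exists>i<M. z \<in> D i")
        case True
        then show ?thesis using dec by fastforce
      qed (use M in \<open>auto simp: d'_def\<close>)
      have err: "pr (memoryless V (w' m)) {zs. d' zs \<noteq> m} \<le> \<epsilon>" if m: "m \<in> {1..M}" for m
      proof -
        have "{zs. d' zs \<noteq> m} \<subseteq> UNIV - D (m - 1)" using dec[of "m - 1"] m by auto
        then have "pr (memoryless V (w' m)) {zs. d' zs \<noteq> m} \<le> pr (memoryless V (w' m)) (UNIV - D (m - 1))"
          by (intro measure_pmf.finite_measure_mono) auto
        also have "\<dots> = 1 - pr (memoryless V (w' m)) (D (m - 1))"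
          using measure_pmf.prob_compl[of "D (m - 1)"] by simp
        also have "\<dots> \<le> \<epsilon>" using wD[of "m - 1"] m by (auto simp: w'_def algebra_simps)
        finally show ?thesis .
      qed
      show "\<exists>w d. (\<forall>m. length (w m) = N \<and> set (w m) \<subseteq> set_pmf P) \<and> (\<forall>zs. d zs \<in> {1..M}) \<and>
        (\<forall>m\<in>{1..M}. pr (memoryless V (w m)) {zs. d zs \<noteq> m} \<le> \<epsilon>)"
        using w' sPN d'M err by (intro exI[of _ w'] exI[of _ d']) auto
    qed
  qed
qed

section \<open>Maxima of the mutual information\<close>

text \<open>The value 0 at 0 agrees with the limit, so entropies stay continuous where probabilities
  vanish.\<close>

lemma continuous_on_x_log: "continuous_on {0..} (\<lambda>x::real. x * log 2 x)"
proof -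
  have "((\<lambda>x::real. x * log 2 x) \<longlongrightarrow> 0) (at_right 0)" by real_asymp
  moreover have "at 0 within {0..} = at_right (0::real)"
    by (rule at_within_nhd[of _ UNIV]) auto
  ultimately have "continuous (at x within {0..}) (\<lambda>x::real. x * log 2 x)" if "x \<ge> 0" for x :: real
    using that by (cases "x = 0") (auto simp: continuous_within intro!: tendsto_eq_intros)
  then show ?thesis by (auto simp: continuous_on_eq_continuous_within)
qed

text \<open>As output entropy minus conditional entropy, the information depends on the weights
  alone and contains no quotients, so continuity can be read off.\<close>

lemma mixinfo_eq_entropies:
  fixes V :: "'u \<Rightarrow> 'z pmf"
  assumes F: "finite F" "set_pmf P \<subseteq> F" and S: "finite S" "\<And>u. u \<in> F \<Longrightarrow> set_pmf (V u) \<subseteq> S"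
  shows "mixinfo P V = (\<Sum>u\<in>F. pmf P u * (\<Sum>y\<in>S. pmf (V u) y * log 2 (pmf (V u) y)))
     - (\<Sum>y\<in>S. (\<Sum>u\<in>F. pmf P u * pmf (V u) y) * log 2 (\<Sum>u\<in>F. pmf P u * pmf (V u) y))"
proof -
  have Q: "pmf (bind_pmf P V) y = (\<Sum>u\<in>F. pmf P u * pmf (V u) y)" for y
    unfolding pmf_bind by (rule expectation_finite[OF F])
  have "mixinfo P V = (\<Sum>u\<in>F. pmf P u * (\<Sum>y\<in>S. pmf (V u) y * log 2 (pmf (V u) y / pmf (bind_pmf P V) y)))"
    unfolding mixinfo_def
    by (subst expectation_finite[OF F]) (auto simp: expectation_finite[OF S] intro!: sum.cong)
  also have "\<dots> = (\<Sum>u\<in>F. \<Sum>y\<in>S. pmf P u * (pmf (V u) y * log 2 (pmf (V u) y)) - pmf P u * pmf (V u) y * log 2 (pmf (bind_pmf P V) y))"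
    unfolding sum_distrib_left
  proof (intro sum.cong refl)
    fix u y
    show "pmf P u * (pmf (V u) y * log 2 (pmf (V u) y / pmf (bind_pmf P V) y))
        = pmf P u * (pmf (V u) y * log 2 (pmf (V u) y)) - pmf P u * pmf (V u) y * log 2 (pmf (bind_pmf P V) y)"
    proof (cases "pmf P u = 0 \<or> pmf (V u) y = 0")
      case False
      then have "y \<in> set_pmf (bind_pmf P V)" by (auto simp: set_pmf_iff[symmetric])
      then have "0 < pmf (bind_pmf P V) y" by (rule pmf_positive)
      moreover have "0 < pmf (V u) y" using False by (simp add: less_le)
      ultimately show ?thesis by (simp add: log_divide algebra_simps)
    qed auto
  qed
  also have "\<dots> = (\<Sum>u\<in>F. pmf P u * (\<Sum>y\<in>S. pmf (V u) y * log 2 (pmf (V u) y)))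
     - (\<Sum>y\<in>S. pmf (bind_pmf P V) y * log 2 (pmf (bind_pmf P V) y))"
    unfolding sum_subtractf by (subst (2) sum.swap) (simp add: sum_distrib_left sum_distrib_right Q mult_ac)
  finally show ?thesis by (simp add: Q)
qed

lemma mixinfo_attains_maximum:
  fixes V :: "'u \<Rightarrow> 'z pmf"
  assumes F: "finite F" "F \<noteq> {}" and fV: "\<And>u. u \<in> F \<Longrightarrow> finite (set_pmf (V u))"
  shows "\<exists>P. set_pmf P \<subseteq> F \<and> (\<forall>P'. set_pmf P' \<subseteq> F \<longrightarrow> mixinfo P' V \<le> mixinfo P V)"
proof -
  define S where "S = (\<Union>u\<in>F. set_pmf (V u))"
  have S: "finite S" "\<And>u. u \<in> F \<Longrightarrow> set_pmf (V u) \<subseteq> S" using F fV by (auto simp: S_def)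
  \<comment> \<open>Weights are functions on the possibly infinite type \<open>'u\<close>; the
    factor \<open>{0}\<close> outside \<open>F\<close> turns the simplex into a closed subset of a
    compact product.\<close>
  define K where "K = PiE UNIV (\<lambda>u. if u \<in> F then {0..1::real} else {0}) \<inter> {w. (\<Sum>u\<in>F. w u) = 1}"
  define J where "J w = (\<Sum>u\<in>F. w u * (\<Sum>y\<in>S. pmf (V u) y * log 2 (pmf (V u) y)))
     - (\<Sum>y\<in>S. (\<Sum>u\<in>F. w u * pmf (V u) y) * log 2 (\<Sum>u\<in>F. w u * pmf (V u) y))" for w
  have J: "mixinfo P V = J (pmf P)" if "set_pmf P \<subseteq> F" for P
    unfolding J_def using mixinfo_eq_entropies[OF F(1) that S] .
  have coord: "continuous_on X (\<lambda>w. w u)" for X :: "('u \<Rightarrow> real) set" and u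
    by (rule continuous_on_subset[OF continuous_on_product_coordinates]) simp
  have "compact (PiE UNIV (\<lambda>u. if u \<in> F then {0..1::real} else {0}))"
    using compactin_PiE[of "\<lambda>_. euclidean :: real topology" UNIV "\<lambda>u. if u \<in> F then {0..1::real} else {0}"]
    by (simp add: euclidean_product_topology)
  moreover have "closed {w :: 'u \<Rightarrow> real. (\<Sum>u\<in>F. w u) = 1}"
    by (intro closed_Collect_eq continuous_on_sum coord continuous_on_const)
  ultimately have "compact K" unfolding K_def by (rule compact_Int_closed)
  have K: "pmf P \<in> K" if "set_pmf P \<subseteq> F" for P
    using that F by (auto simp: K_def pmf_le_1 set_pmf_iff sum_pmf_eq_1 split: if_splits)
  have "K \<noteq> {}" using K[of "pmf_of_set F"] F by auto
  have K0: "0 \<le> (\<Sum>u\<in>F. w u * pmf (V u) y)" if "w \<in> K" for w y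
    using that by (intro sum_nonneg mult_nonneg_nonneg) (fastforce simp: K_def PiE_iff split: if_splits)+
  have "continuous_on K J"
    unfolding J_def
    by (intro continuous_on_diff continuous_on_sum continuous_on_mult_right coord
        continuous_on_compose2[OF continuous_on_x_log]) (use K0 in auto)
  then obtain w where w: "w \<in> K" "\<And>w'. w' \<in> K \<Longrightarrow> J w' \<le> J w"
    using continuous_attains_sup[OF \<open>compact K\<close> \<open>K \<noteq> {}\<close>] by blast
  have w0: "0 \<le> w u" and wF: "u \<notin> F \<Longrightarrow> w u = 0" for u
    using w(1) by (auto simp: K_def PiE_iff split: if_splits dest: spec[of _ u])
  have "(\<integral>\<^sup>+u. ennreal (w u) \<partial>count_space UNIV) = (\<Sum>u\<in>F. ennreal (w u))"
    using F wF by (intro nn_integral_count_space'[of F]) auto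
  also have "\<dots> = 1" using w(1) w0 by (simp add: sum_ennreal K_def)
  finally have pmfP: "pmf (embed_pmf w) = w" using w0 by (intro ext pmf_embed_pmf) auto
  then have sP: "set_pmf (embed_pmf w) \<subseteq> F" using wF by (metis set_pmf_iff subsetI)
  show ?thesis
    using sP w(2) by (intro exI[of _ "embed_pmf w"]) (auto simp: J K pmfP)
qed

text \<open>The index stands for one of finitely many chargers or feasible sets, each with its own
  simplex of laws. An index with empty \<open>F i\<close> admits no law and is dropped before taking
  the maximum.\<close>

lemma mixinfo_set_has_maximum:
  fixes V :: "'i \<Rightarrow> 'u \<Rightarrow> 'z pmf"
  assumes I: "finite I" and F: "\<And>i. i \<in> I \<Longrightarrow> finite (F i)"
    and fV: "\<And>i u. i \<in> I \<Longrightarrow> u \<in> F i \<Longrightarrow> finite (set_pmf (V i u))"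
    and S: "S = {mixinfo P (V i) | P i. i \<in> I \<and> set_pmf P \<subseteq> F i}" and ne: "S \<noteq> {}"
  shows "\<exists>s\<in>S. \<forall>s'\<in>S. s' \<le> s"
proof -
  define I' where "I' = {i\<in>I. F i \<noteq> {}}"
  have "\<exists>P. set_pmf P \<subseteq> F i \<and> (\<forall>P'. set_pmf P' \<subseteq> F i \<longrightarrow> mixinfo P' (V i) \<le> mixinfo P (V i))" if "i \<in> I'" for i
    using that F fV by (intro mixinfo_attains_maximum) (auto simp: I'_def)
  then obtain P where P: "\<And>i. i \<in> I' \<Longrightarrow> set_pmf (P i) \<subseteq> F i"
    "\<And>i P'. i \<in> I' \<Longrightarrow> set_pmf P' \<subseteq> F i \<Longrightarrow> mixinfo P' (V i) \<le> mixinfo (P i) (V i)" by metis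
  have I': "i \<in> I'" if "i \<in> I" "set_pmf P' \<subseteq> F i" for i and P' :: "'u pmf"
    using that set_pmf_not_empty[of P'] by (auto simp: I'_def)
  have fin: "finite ((\<lambda>i. mixinfo (P i) (V i)) ` I')" using I by (simp add: I'_def)
  have ne': "(\<lambda>i. mixinfo (P i) (V i)) ` I' \<noteq> {}" using ne I' S by blast
  let ?s = "Max ((\<lambda>i. mixinfo (P i) (V i)) ` I')"
  have "?s \<in> (\<lambda>i. mixinfo (P i) (V i)) ` I'" using fin ne' by (rule Max_in)
  then have "?s \<in> S" using P(1) unfolding S I'_def by blast
  moreover have "s' \<le> ?s" if s': "s' \<in> S" for s'
  proof -
    obtain P' i where *: "s' = mixinfo P' (V i)" "i \<in> I" "set_pmf P' \<subseteq> F i" using s' S by blast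
    have "s' \<le> mixinfo (P i) (V i)" unfolding *(1) using * I' P(2) by blast
    also have "\<dots> \<le> ?s" using fin I'[OF *(2,3)] by (intro Max_ge) auto
    finally show ?thesis .
  qed
  ultimately show ?thesis by blast
qed

text \<open>The output law \<open>q\<close> plays the role of the capacity-achieving output law for the inputs in \<open>Z\<close>.
  Mixing in a little of every \<open>W x\<close> keeps the divergences of all inputs finite and avoids the
  limit in the usual Kuhn-Tucker argument.\<close>

lemma near_capacity_output:
  fixes W :: "'x::finite \<Rightarrow> 'y::finite pmf"
  assumes Z: "Z \<noteq> {}" and l: "0 < l" "l < 1"
  obtains P q where "set_pmf P \<subseteq> Z"
    "\<And>x y. y \<in> set_pmf (W x) \<Longrightarrow> y \<in> set_pmf q"
    "\<And>x. x \<in> Z \<Longrightarrow> kl (W x) q \<le> mixinfo P W - log 2 (1 - l)"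
    "\<And>x. kl (W x) q \<le> log 2 (real CARD('x) / l)"
proof -
  obtain P where P: "set_pmf P \<subseteq> Z" "\<And>P'. set_pmf P' \<subseteq> Z \<Longrightarrow> mixinfo P' W \<le> mixinfo P W"
    using mixinfo_attains_maximum[of Z W] Z by auto
  have fin [simp]: "finite A" for A :: "'a::finite set" by simp
  define Q where "Q = bind_pmf P W"
  define c where "c = real CARD('x)"
  have c: "1 \<le> c" by (simp add: c_def Suc_le_eq)
  \<comment> \<open>With probability \<open>l\<close> the input is uniform, otherwise it follows the
    optimal law; \<open>m = l / c\<close> below is the share that each single \<open>W x\<close>
    receives from the uniform part.\<close>
  define q where "q = bind_pmf (bernoulli_pmf l) (\<lambda>b. if b then bind_pmf (pmf_of_set UNIV) W else Q)"
  have pq: "pmf q y = l / c * (\<Sum>x\<in>UNIV. pmf (W x) y) + (1 - l) * pmf Q y" for y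
    unfolding q_def pmf_bind using l
    by (simp add: integral_bernoulli_pmf pmf_bind expectation_finite[of UNIV "pmf_of_set UNIV"] c_def sum_divide_distrib[symmetric])
  define m where "m = l / c"
  have m: "0 < m" "m \<le> l" "m < 1" using l c unfolding m_def
    by (auto simp: field_simps)
  have qge: "m * pmf (W x) y \<le> pmf q y" for x y
  proof -
    have "pmf (W x) y \<le> (\<Sum>x\<in>UNIV. pmf (W x) y)" by (rule member_le_sum) auto
    then have "m * pmf (W x) y \<le> l / c * (\<Sum>x\<in>UNIV. pmf (W x) y)" using m unfolding m_def by (intro mult_left_mono) auto
    then show ?thesis unfolding pq using l by (smt (verit) mult_nonneg_nonneg pmf_nonneg)
  qed
  have supp: "y \<in> set_pmf q" if "y \<in> set_pmf (W x)" for x y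
    using qge[of x y] pmf_positive[OF that] m by (simp add: set_pmf_iff) (smt (verit) mult_pos_pos)
  have pos: "0 < pmf (W x) y" "0 < pmf q y" if "y \<in> set_pmf (W x)" for x y
    using that supp by (auto intro: pmf_positive)
  have b2: "kl (W x) q \<le> log 2 (c / l)" for x
  proof -
    have "kl (W x) q \<le> E (W x) (\<lambda>y. log 2 (c / l))"
    proof (intro expectation_mono fin)
      fix y assume y: "y \<in> set_pmf (W x)"
      show "log 2 (pmf (W x) y / pmf q y) \<le> log 2 (c / l)"
        using pos[OF y] qge[of x y] l c unfolding m_def
        by (intro log_mono divide_pos_pos) (auto simp: field_simps)
    qed
    then show ?thesis by simp
  qed
  have b1: "kl (W x) q \<le> mixinfo P W - log 2 (1 - l)" if x: "x \<in> Z" for x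
  proof -
    \<comment> \<open>A perturbation of the optimal law towards \<open>x\<close> of the fixed size
      \<open>m\<close>. Optimality bounds the divergence of \<open>W x\<close> from the perturbed
      output law \<open>Qm\<close>; since \<open>(1 - l) * Qm\<close> lies below \<open>q\<close>,
      passing from \<open>Qm\<close> to \<open>q\<close> costs at most
      \<open>- log 2 (1 - l)\<close>.\<close>
    define Pm where "Pm = bind_pmf (bernoulli_pmf m) (\<lambda>b. if b then return_pmf x else P)"
    define Qm where "Qm = bind_pmf Pm W"
    have EPm: "E Pm f = m * f x + (1 - m) * E P f" for f :: "'x \<Rightarrow> real"
      unfolding Pm_def using m by (subst expectation_bind) (auto simp: integral_bernoulli_pmf)
    have pQm: "pmf Qm y = m * pmf (W x) y + (1 - m) * pmf Q y" for y
      unfolding Qm_def Q_def pmf_bind EPm ..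
    define D where "D u = kl (W u) Qm" for u
    have sPm: "set_pmf Pm \<subseteq> Z" using P(1) x by (auto simp: Pm_def split: if_splits)
    have "mixinfo P W \<le> E P D"
      unfolding D_def
    proof (rule mixinfo_le)
      fix u y assume "u \<in> set_pmf P" "y \<in> set_pmf (W u)"
      then have "0 < pmf Q y" by (auto simp: Q_def intro!: pmf_positive)
      then show "0 < pmf Qm y" unfolding pQm using m by (intro add_nonneg_pos) auto
    next
      have "(\<Sum>y\<in>set_pmf (bind_pmf P W). pmf Qm y) = pr Qm (set_pmf (bind_pmf P W))"
        by (simp add: measure_measure_pmf_finite)
      then show "(\<Sum>y\<in>set_pmf (bind_pmf P W). pmf Qm y) \<le> 1" by simp
    qed auto
    then have "(1 - m) * mixinfo P W \<le> (1 - m) * E P D" using m by (intro mult_left_mono) auto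
    moreover have "m * D x + (1 - m) * E P D = mixinfo Pm W"
      unfolding mixinfo_def D_def Qm_def EPm ..
    moreover have "mixinfo Pm W \<le> mixinfo P W" using P(2) sPm by blast
    ultimately have "m * D x \<le> m * mixinfo P W" by (simp add: algebra_simps)
    then have D: "D x \<le> mixinfo P W" using m by simp
    have "kl (W x) q \<le> E (W x) (\<lambda>y. log 2 (pmf (W x) y / pmf Qm y) - log 2 (1 - l))"
    proof (intro expectation_mono fin)
      fix y assume y: "y \<in> set_pmf (W x)"
      have Qm0: "0 < pmf Qm y" unfolding pQm using m pos[OF y] by (intro add_pos_nonneg) auto
      have "(1 - l) * pmf Qm y \<le> pmf q y"
      proof -
        have "(1 - l) * (m * pmf (W x) y) \<le> l / c * (\<Sum>x\<in>UNIV. pmf (W x) y)"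
        proof -
          have "(1 - l) * (m * pmf (W x) y) \<le> 1 * (m * pmf (W x) y)" using l m by (intro mult_right_mono) auto
          also have "\<dots> \<le> l / c * (\<Sum>x\<in>UNIV. pmf (W x) y)"
            unfolding m_def mult_1 using l c by (intro mult_left_mono member_le_sum) auto
          finally show ?thesis .
        qed
        moreover have "(1 - l) * ((1 - m) * pmf Q y) \<le> (1 - l) * (1 * pmf Q y)"
          using l m by (intro mult_left_mono mult_right_mono) auto
        ultimately show ?thesis unfolding pQm pq by (simp add: algebra_simps)
      qed
      then have "pmf (W x) y / pmf q y \<le> pmf (W x) y / ((1 - l) * pmf Qm y)"
        using pos[OF y] Qm0 l by (intro divide_left_mono) auto
      then have "pmf (W x) y / pmf q y \<le> pmf (W x) y / pmf Qm y / (1 - l)"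
        by (simp add: mult.commute)
      then have "log 2 (pmf (W x) y / pmf q y) \<le> log 2 (pmf (W x) y / pmf Qm y / (1 - l))"
        using pos[OF y] by (intro log_mono) auto
      also have "\<dots> = log 2 (pmf (W x) y / pmf Qm y) - log 2 (1 - l)"
        using pos[OF y] Qm0 l by (simp add: log_divide log_mult)
      finally show "log 2 (pmf (W x) y / pmf q y) \<le> log 2 (pmf (W x) y / pmf Qm y) - log 2 (1 - l)" .
    qed
    also have "\<dots> = D x - log 2 (1 - l)" unfolding D_def by (simp add: integrable_measure_pmf_finite)
    finally show ?thesis using D by simp
  qed
  show thesis using P(1) supp b1 b2 unfolding c_def by (intro that[of P q]) auto
qed

section \<open>Battery levels along input sequences\<close>

text \<open>\<open>energy_feasible\<close> starts from a full battery and speaks of a whole block.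
  The recursion over an arbitrary initial level is the form that splits at block boundaries.\<close>

primrec feas :: "('x \<Rightarrow> real) \<Rightarrow> real \<Rightarrow> real \<Rightarrow> 'x list \<Rightarrow> real list \<Rightarrow> bool" where
  "feas \<phi> B b [] es = True"
| "feas \<phi> B b (x # xs) es =
     (\<phi> x \<le> min (b + hd es) B \<and> feas \<phi> B (min (b + hd es) B - \<phi> x) xs (tl es))"

primrec level :: "('x \<Rightarrow> real) \<Rightarrow> real \<Rightarrow> real \<Rightarrow> 'x list \<Rightarrow> real list \<Rightarrow> real" where
  "level \<phi> B b [] es = b"
| "level \<phi> B b (x # xs) es = level \<phi> B (min (b + hd es) B - \<phi> x) xs (tl es)"

lemma feas_append:
  "length xs = length es \<Longrightarrow>
     feas \<phi> B b (xs @ xs') (es @ es') \<longleftrightarrow> feas \<phi> B b xs es \<and> feas \<phi> B (level \<phi> B b xs es) xs' es'"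
proof (induction xs arbitrary: b es)
  case (Cons x xs)
  then obtain e es'' where "es = e # es''" by (cases es) auto
  then show ?case using Cons by simp
qed simp

lemma level_append:
  "length xs = length es \<Longrightarrow>
     level \<phi> B b (xs @ xs') (es @ es') = level \<phi> B (level \<phi> B b xs es) xs' es'"
proof (induction xs arbitrary: b es)
  case (Cons x xs)
  then obtain e es'' where "es = e # es''" by (cases es) auto
  then show ?case using Cons by simp
qed simp

lemma battery_eq_level:
  assumes "t \<le> length xs" "length xs = length es"
  shows "battery \<phi> B xs es t = level \<phi> B B (take t xs) (take t es)"
  using assms(1)
proof (induction t)
  case (Suc t)
  then show ?case using assms(2) by (simp add: take_Suc_conv_app_nth level_append)
qed simp

lemma feas_iff_nth:
  "length xs = length es \<Longrightarrow> feas \<phi> B b xs es \<longleftrightarrow>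
     (\<forall>t<length xs. \<phi> (xs ! t) \<le> min (level \<phi> B b (take t xs) (take t es) + es ! t) B)"
proof (induction xs arbitrary: b es)
  case (Cons x xs)
  then obtain e es' where es: "es = e # es'" by (cases es) auto
  show ?case
    using Cons.prems Cons.IH[of es' "min (b + e) B - \<phi> x"] unfolding es by (simp add: All_less_Suc2)
qed simp

lemma energy_feasible_iff_feas:
  assumes "length xs = n" "length es = n"
  shows "energy_feasible \<phi> B n xs es \<longleftrightarrow> feas \<phi> B B xs es"
  using assms by (auto simp: energy_feasible_def feas_iff_nth battery_eq_level)

lemma level_bounds:
  assumes "\<And>x. 0 \<le> \<phi> x" "0 \<le> b" "b \<le> B" "length xs = length es" "set es \<subseteq> {0..}" "feas \<phi> B b xs es"
  shows "0 \<le> level \<phi> B b xs es \<and> level \<phi> B b xs es \<le> B"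
  using assms(2-)
proof (induction xs arbitrary: b es)
  case (Cons x xs)
  then obtain e es' where es: "es = e # es'" by (cases es) auto
  show ?case
    using Cons.prems assms(1)[of x] Cons.IH[of "min (b + e) B - \<phi> x" es'] unfolding es by auto
qed simp

text \<open>When nothing is drawn, capping after every step or only at the end gives the same level.
  Hence a silent gap with total charge \<open>B\<close> fills the battery from any level.\<close>

lemma feas_zero_cost:
  assumes "\<And>x. x \<in> set xs \<Longrightarrow> \<phi> x = 0" "0 \<le> b" "b \<le> B" "length xs = length es" "set es \<subseteq> {0..}"
  shows "feas \<phi> B b xs es \<and> level \<phi> B b xs es = min (b + sum_list es) B"
  using assms
proof (induction xs arbitrary: b es)
  case (Cons x xs)
  then obtain e es' where es: "es = e # es'" by (cases es) auto
  have s: "0 \<le> sum_list es'" using Cons.prems(5) unfolding es by (intro sum_list_nonneg) auto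
  have x: "\<phi> x = 0" and e: "0 \<le> e" "set es' \<subseteq> {0..}" and len: "length xs = length es'"
    using Cons.prems(1,4,5) unfolding es by auto
  have bd: "0 \<le> min (b + e) B" "min (b + e) B \<le> B" using Cons.prems(2,3) e by auto
  have "feas \<phi> B (min (b + e) B) xs es' \<and> level \<phi> B (min (b + e) B) xs es' = min (min (b + e) B + sum_list es') B"
    by (rule Cons.IH[OF _ bd len e(2)]) (rule Cons.prems, simp)
  moreover have "min (min (b + e) B + sum_list es') B = min (b + (e + sum_list es')) B"
    using s by (simp add: min_def)
  ultimately show ?case
    using bd unfolding es by (simp add: x)
qed simp

section \<open>Transmission by a single deterministic policy\<close>

text \<open>Once the message is fixed, a code is a single policy \<open>(g, d)\<close>; the message
  number 0 is a dummy.\<close>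

definition run ::
  "('x \<Rightarrow> 'y pmf) \<Rightarrow> (real list \<Rightarrow> 'x) \<Rightarrow> ('x list \<Rightarrow> 'y list \<Rightarrow> real) \<Rightarrow> nat \<Rightarrow>
   ('x list \<times> 'y list \<times> real list) pmf" where
  "run W g d n = transmission W (\<lambda>_. g) (\<lambda>_. d) 0 n"

lemma transmission_eq_run: "transmission W f c m n = run W (f m) (c m) n"
  unfolding run_def by (induction n) (simp_all add: case_prod_unfold Let_def)

lemma run_0: "run W g d 0 = return_pmf ([], [], [])"
  by (simp add: run_def)

lemma run_Suc:
  "run W g d (Suc n) = bind_pmf (run W g d n) (\<lambda>(xs, ys, es).
     map_pmf (\<lambda>y. (xs @ [g (es @ [d xs ys])], ys @ [y], es @ [d xs ys])) (W (g (es @ [d xs ys]))))"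
  by (simp add: run_def Let_def map_pmf_def)

definition out ::
  "('x \<Rightarrow> 'y pmf) \<Rightarrow> (real list \<Rightarrow> 'x) \<Rightarrow> ('x list \<Rightarrow> 'y list \<Rightarrow> real) \<Rightarrow> nat \<Rightarrow> 'y list pmf" where
  "out W g d n = map_pmf (\<lambda>(xs, ys, es). ys) (run W g d n)"

lemma run_length:
  "(xs, ys, es) \<in> set_pmf (run W g d n) \<Longrightarrow> length xs = n \<and> length ys = n \<and> length es = n"
proof (induction n arbitrary: xs ys es)
  case (Suc n)
  then show ?case by (auto simp: run_Suc)
qed (simp add: run_0)

lemma run_inputs:
  "(xs, ys, es) \<in> set_pmf (run W g d n) \<Longrightarrow>
     map (\<lambda>t. g (take (Suc t) es)) [0..<n] = xs \<and>
     map (\<lambda>t. d (take t xs) (take t ys)) [0..<n] = es"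
proof (induction n arbitrary: xs ys es)
  case (Suc n)
  then obtain xs' ys' es' y where *: "(xs', ys', es') \<in> set_pmf (run W g d n)"
    "xs = xs' @ [g (es' @ [d xs' ys'])]" "ys = ys' @ [y]" "es = es' @ [d xs' ys']"
    by (auto simp: run_Suc)
  have len: "length xs' = n" "length ys' = n" "length es' = n" using run_length[OF *(1)] by auto
  have "map (\<lambda>t. g (take (Suc t) es)) [0..<n] = map (\<lambda>t. g (take (Suc t) es')) [0..<n]"
    "map (\<lambda>t. d (take t xs) (take t ys)) [0..<n] = map (\<lambda>t. d (take t xs') (take t ys')) [0..<n]"
    using len by (auto simp: *(2-))
  then have "map (\<lambda>t. g (take (Suc t) es)) [0..<n] = xs'" "map (\<lambda>t. d (take t xs) (take t ys)) [0..<n] = es'"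
    using Suc.IH[OF *(1)] by simp_all
  then show ?case using len by (simp add: *(2-))
qed (simp add: run_0)

lemma finite_run: "finite (set_pmf (run W g d n))" for W :: "'x \<Rightarrow> 'y::finite pmf"
  by (induction n) (auto simp: run_0 run_Suc)

lemma finite_out: "finite (set_pmf (out W g d n))" for W :: "'x \<Rightarrow> 'y::finite pmf"
  by (simp add: out_def finite_run)

definition is_clock :: "('x list \<Rightarrow> 'y list \<Rightarrow> nat) \<Rightarrow> bool" where
  "is_clock lf \<longleftrightarrow> (\<forall>xs ys. length xs = length ys \<longrightarrow> lf xs ys = length ys)"

lemma is_clockD: "is_clock lf \<Longrightarrow> length xs = length ys \<Longrightarrow> lf xs ys = length ys"
  by (simp add: is_clock_def)

text \<open>The list read by the transmitter includes the current charge, hence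
  \<open>\<le> K\<close> here; the charger sees only the past, hence \<open>< K\<close> in
  \<open>then_d\<close>.\<close>

definition then_g :: "nat \<Rightarrow> (real list \<Rightarrow> 'x) \<Rightarrow> (real list \<Rightarrow> 'x) \<Rightarrow> real list \<Rightarrow> 'x" where
  "then_g K a b es = (if length es \<le> K then a es else b (drop K es))"

definition then_d :: "('x list \<Rightarrow> 'y list \<Rightarrow> nat) \<Rightarrow> nat \<Rightarrow> ('x list \<Rightarrow> 'y list \<Rightarrow> real) \<Rightarrow>
   ('x list \<Rightarrow> 'y list \<Rightarrow> real) \<Rightarrow> 'x list \<Rightarrow> 'y list \<Rightarrow> real" where
  "then_d lf K a b xs ys = (if lf xs ys < K then a xs ys else b (drop K xs) (drop K ys))"

lemma run_then_initial:
  assumes lf: "is_clock lf"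
  shows "n \<le> K \<Longrightarrow> run W (then_g K a a') (then_d lf K b b') n = run W a b n"
proof (induction n)
  case (Suc n)
  then have IH: "run W (then_g K a a') (then_d lf K b b') n = run W a b n" by simp
  show ?case
    unfolding run_Suc IH using Suc.prems by (intro bind_pmf_cong) (auto dest!: run_length simp: is_clockD[OF lf] then_g_def then_d_def)
qed (simp add: run_0)

text \<open>The second policy sees only the history after time \<open>K\<close>, so its run is
  independent of the first.\<close>

lemma run_then:
  assumes lf: "is_clock lf"
  shows "run W (then_g K a a') (then_d lf K b b') (K + k) =
    bind_pmf (run W a b K) (\<lambda>(xs, ys, es).
      map_pmf (\<lambda>(xs', ys', es'). (xs @ xs', ys @ ys', es @ es')) (run W a' b' k))"
proof (induction k)
  case 0
  show ?case using run_then_initial[OF lf, of K K] by (simp add: run_0 case_prod_unfold bind_return_pmf')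
next
  case (Suc k)
  have "run W (then_g K a a') (then_d lf K b b') (K + Suc k) =
    bind_pmf (run W a b K) (\<lambda>(xs, ys, es). bind_pmf (run W a' b' k) (\<lambda>(xs', ys', es').
      let e = then_d lf K b b' (xs @ xs') (ys @ ys'); x = then_g K a a' ((es @ es') @ [e])
      in map_pmf (\<lambda>y. ((xs @ xs') @ [x], (ys @ ys') @ [y], (es @ es') @ [e])) (W x)))"
    by (simp add: run_Suc Suc bind_assoc_pmf bind_map_pmf case_prod_unfold Let_def)
  also have "\<dots> = bind_pmf (run W a b K) (\<lambda>(xs, ys, es).
      map_pmf (\<lambda>(xs', ys', es'). (xs @ xs', ys @ ys', es @ es')) (run W a' b' (Suc k)))"
    unfolding run_Suc map_bind_pmf
    by (intro bind_pmf_cong refl)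
      (auto dest!: run_length simp: is_clockD[OF lf] then_g_def then_d_def map_pmf_comp Let_def map_bind_pmf intro!: bind_pmf_cong)
  finally show ?case .
qed

text \<open>A code has to be feasible for every charging sequence, although only the agreed one occurs.\<close>

primrec safe_inputs ::
  "('x \<Rightarrow> real) \<Rightarrow> real \<Rightarrow> 'x \<Rightarrow> (real list \<Rightarrow> 'x) \<Rightarrow> real list \<Rightarrow> nat \<Rightarrow> 'x list" where
  "safe_inputs \<phi> B x0 g es 0 = []"
| "safe_inputs \<phi> B x0 g es (Suc t) = safe_inputs \<phi> B x0 g es t @
     [if \<phi> (g (take (Suc t) es)) \<le> min (level \<phi> B B (safe_inputs \<phi> B x0 g es t) (take t es) + es ! t) B
      then g (take (Suc t) es) else x0]"

definition safe :: "('x \<Rightarrow> real) \<Rightarrow> real \<Rightarrow> 'x \<Rightarrow> (real list \<Rightarrow> 'x) \<Rightarrow> real list \<Rightarrow> 'x" where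
  "safe \<phi> B x0 g es = last (safe_inputs \<phi> B x0 g es (length es))"

lemma length_safe_inputs [simp]: "length (safe_inputs \<phi> B x0 g es t) = t"
  by (induction t) auto

lemma safe_inputs_take:
  "t \<le> k \<Longrightarrow> k \<le> length es \<Longrightarrow> safe_inputs \<phi> B x0 g (take k es) t = safe_inputs \<phi> B x0 g es t"
  by (induction t) (simp_all add: min_absorb1)

lemma map_safe:
  "n \<le> length es \<Longrightarrow> map (\<lambda>t. safe \<phi> B x0 g (take (Suc t) es)) [0..<n] = safe_inputs \<phi> B x0 g es n"
proof (induction n)
  case (Suc n)
  have "safe \<phi> B x0 g (take (Suc n) es) = last (safe_inputs \<phi> B x0 g es (Suc n))"
    using Suc.prems unfolding safe_def by (simp add: min_absorb2 safe_inputs_take del: safe_inputs.simps)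
  then show ?case using Suc by simp
qed simp

lemma feas_safe_inputs:
  assumes \<phi>: "\<And>x. 0 \<le> \<phi> x" and x0: "\<phi> x0 = 0" and B: "0 \<le> B" and es: "set es \<subseteq> {0..}"
  shows "n \<le> length es \<Longrightarrow> feas \<phi> B B (safe_inputs \<phi> B x0 g es n) (take n es)"
proof (induction n)
  case (Suc n)
  have f: "feas \<phi> B B (safe_inputs \<phi> B x0 g es n) (take n es)" using Suc by simp
  have "0 \<le> level \<phi> B B (safe_inputs \<phi> B x0 g es n) (take n es)"
    using level_bounds[OF \<phi> B order_refl _ _ f] Suc.prems es set_take_subset[of n es] by (auto simp: min_absorb2)
  moreover have "0 \<le> es ! n"
  proof -
    have "es ! n \<in> set es" using Suc.prems by (intro nth_mem) simp
    then show ?thesis using es by auto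
  qed
  ultimately show ?case
    using Suc.prems f x0 B by (simp add: take_Suc_conv_app_nth feas_append)
qed simp

lemma safe_inputs_eq:
  "n \<le> length es \<Longrightarrow> feas \<phi> B B (map (\<lambda>t. g (take (Suc t) es)) [0..<n]) (take n es) \<Longrightarrow>
     safe_inputs \<phi> B x0 g es n = map (\<lambda>t. g (take (Suc t) es)) [0..<n]"
  by (induction n) (auto simp: take_Suc_conv_app_nth feas_append)

text \<open>Histories that the policy can produce are feasible by assumption, so along them the
  fallback to \<open>x0\<close> is never taken.\<close>

lemma run_safe:
  assumes "\<forall>(xs, ys, es)\<in>set_pmf (run W g d n). feas \<phi> B B xs es"
  shows "run W (safe \<phi> B x0 g) d n = run W g d n"
  using assms
proof (induction n)
  case (Suc n)
  have f: "feas \<phi> B B (xs @ [g (es @ [d xs ys])]) (es @ [d xs ys])" if "(xs, ys, es) \<in> set_pmf (run W g d n)" for xs ys es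
  proof -
    \<comment> \<open>Feasibility is known for complete runs only; a shorter history extends to one
      because some output has positive probability.\<close>
    obtain y where "y \<in> set_pmf (W (g (es @ [d xs ys])))" using set_pmf_not_empty by fast
    then have "(xs @ [g (es @ [d xs ys])], ys @ [y], es @ [d xs ys]) \<in> set_pmf (run W g d (Suc n))"
      using that by (force simp: run_Suc)
    then show ?thesis using Suc.prems by fast
  qed
  have IH: "run W (safe \<phi> B x0 g) d n = run W g d n"
  proof (intro Suc.IH, clarify)
    fix xs ys es
    assume *: "(xs, ys, es) \<in> set_pmf (run W g d n)"
    then show "feas \<phi> B B xs es"
      using f[OF *] run_length[OF *] by (simp add: feas_append)
  qed
  have "safe \<phi> B x0 g (es @ [d xs ys]) = g (es @ [d xs ys])" if *: "(xs, ys, es) \<in> set_pmf (run W g d n)" for xs ys es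
  proof -
    define es' where "es' = es @ [d xs ys]"
    have len: "length xs = n" "length es = n" "length es' = Suc n" using run_length[OF *] by (auto simp: es'_def)
    have "map (\<lambda>t. g (take (Suc t) es')) [0..<n] = map (\<lambda>t. g (take (Suc t) es)) [0..<n]"
      using len by (simp add: es'_def)
    then have "map (\<lambda>t. g (take (Suc t) es')) [0..<n] = xs"
      using run_inputs[OF *] by simp
    then have "map (\<lambda>t. g (take (Suc t) es')) [0..<Suc n] = xs @ [g es']" using len by simp
    then have "safe_inputs \<phi> B x0 g es' (Suc n) = xs @ [g es']"
      using f[OF *] len by (subst safe_inputs_eq) (auto simp: es'_def)
    then show ?thesis unfolding es'_def[symmetric] safe_def len(3) by (simp del: safe_inputs.simps)
  qed
  then show ?case unfolding run_Suc IH by (intro bind_pmf_cong) auto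
qed (simp add: run_0)

section \<open>Concatenation of blocks\<close>

type_synonym ('x, 'y) policy = "(real list \<Rightarrow> 'x) \<times> ('x list \<Rightarrow> 'y list \<Rightarrow> real)"

text \<open>After the last block the transmitter is idle, and so is the charger in
  \<open>seq_d\<close>; this covers the remainder when the block length does not divide
  \<open>n\<close>.\<close>

primrec seq_g :: "'x \<Rightarrow> nat \<Rightarrow> ('x, 'y) policy list \<Rightarrow> real list \<Rightarrow> 'x" where
  "seq_g x0 K [] = (\<lambda>_. x0)"
| "seq_g x0 K (u # us) = then_g K (fst u) (seq_g x0 K us)"

primrec seq_d :: "real \<Rightarrow> ('x list \<Rightarrow> 'y list \<Rightarrow> nat) \<Rightarrow> nat \<Rightarrow> ('x, 'y) policy list \<Rightarrow>
    'x list \<Rightarrow> 'y list \<Rightarrow> real" where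
  "seq_d e0 lf K [] = (\<lambda>_ _. e0)"
| "seq_d e0 lf K (u # us) = then_d lf K (snd u) (seq_d e0 lf K us)"

primrec blocks :: "nat \<Rightarrow> nat \<Rightarrow> 'y list \<Rightarrow> 'y list list" where
  "blocks K 0 ys = []"
| "blocks K (Suc N) ys = take K ys # blocks K N (drop K ys)"

text \<open>Quantified over all histories, also impossible ones, as \<open>is_code\<close>
  demands.\<close>

definition cost_ok :: "real set \<Rightarrow> real \<Rightarrow> ('x list \<Rightarrow> 'y list \<Rightarrow> real) \<Rightarrow> nat \<Rightarrow> bool" where
  "cost_ok \<E> \<Gamma> d n \<longleftrightarrow> (\<forall>xs ys. length xs = n \<and> length ys = n \<longrightarrow>
     (\<forall>t<n. d (take t xs) (take t ys) \<in> \<E>) \<and> (\<Sum>t<n. d (take t xs) (take t ys)) \<le> real n * \<Gamma>)"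

text \<open>Seen in blocks, the channel is memoryless with policies as input letters, because every
  block starts from an empty history.\<close>

lemma out_seq:
  assumes lf: "is_clock lf"
  shows "map_pmf (blocks K (length us)) (out W (seq_g x0 K us) (seq_d e0 lf K us) (length us * K + r))
     = memoryless (\<lambda>u. out W (fst u) (snd u) K) us"
proof (induction us)
  case Nil
  show ?case by (simp add: map_pmf_const)
next
  case (Cons u us)
  have "map_pmf (blocks K (length (u # us))) (out W (seq_g x0 K (u # us)) (seq_d e0 lf K (u # us)) (length (u # us) * K + r))
     = bind_pmf (run W (fst u) (snd u) K) (\<lambda>(xs, ys, es).
         map_pmf (\<lambda>(xs', ys', es'). take K (ys @ ys') # blocks K (length us) (drop K (ys @ ys')))
         (run W (seq_g x0 K us) (seq_d e0 lf K us) (length us * K + r)))"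
    using run_then[OF lf, of W K "fst u" "seq_g x0 K us" "snd u" "seq_d e0 lf K us" "length us * K + r"]
    by (simp add: out_def map_bind_pmf map_pmf_comp case_prod_unfold add.assoc)
  also have "\<dots> = bind_pmf (run W (fst u) (snd u) K) (\<lambda>(xs, ys, es).
         map_pmf ((#) ys) (map_pmf (blocks K (length us)) (out W (seq_g x0 K us) (seq_d e0 lf K us) (length us * K + r))))"
    by (intro bind_pmf_cong refl) (auto dest!: run_length simp: out_def map_pmf_comp case_prod_unfold)
  also have "\<dots> = memoryless (\<lambda>u. out W (fst u) (snd u) K) (u # us)"
    unfolding Cons.IH by (simp add: out_def bind_map_pmf case_prod_unfold flip: map_pmf_def)
  finally show ?case .
qed

lemma cost_ok_then:
  assumes lf: "is_clock lf"
    and a: "cost_ok \<E> \<Gamma> a K" and b: "cost_ok \<E> \<Gamma> b k"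
  shows "cost_ok \<E> \<Gamma> (then_d lf K a b) (K + k)"
  unfolding cost_ok_def
proof (intro allI impI, elim conjE)
  fix xs :: "'a list" and ys :: "'b list"
  assume len: "length xs = K + k" "length ys = K + k"
  let ?d = "\<lambda>t. then_d lf K a b (take t xs) (take t ys)"
  have 1: "?d t = a (take t (take K xs)) (take t (take K ys))" if "t < K" for t
    using that len by (simp add: then_d_def is_clockD[OF lf] min_absorb1)
  have 2: "?d (K + t) = b (take t (drop K xs)) (take t (drop K ys))" if "t < k" for t
    using that len by (simp add: then_d_def is_clockD[OF lf] take_drop add.commute)
  have A: "\<forall>t<K. ?d t \<in> \<E>" "(\<Sum>t<K. ?d t) \<le> real K * \<Gamma>"
    using a[unfolded cost_ok_def, rule_format, of "take K xs" "take K ys"] len 1 by auto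
  have B: "\<forall>t<k. ?d (K + t) \<in> \<E>" "(\<Sum>t<k. ?d (K + t)) \<le> real k * \<Gamma>"
    using b[unfolded cost_ok_def, rule_format, of "drop K xs" "drop K ys"] len 2 by auto
  have "(\<Sum>t<K + k. ?d t) = (\<Sum>t<K. ?d t) + (\<Sum>t<k. ?d (K + t))"
    by (induction k) (simp_all add: add.assoc)
  moreover have "?d t \<in> \<E>" if "t < K + k" for t
    using that A(1) B(1)[rule_format, of "t - K"] by (cases "t < K") auto
  ultimately show "(\<forall>t<K + k. ?d t \<in> \<E>) \<and> (\<Sum>t<K + k. ?d t) \<le> real (K + k) * \<Gamma>"
    using A(2) B(2) by (simp add: distrib_right)
qed

lemma cost_ok_seq:
  assumes lf: "is_clock lf"
    and e0: "e0 \<in> \<E>" "e0 \<le> \<Gamma>" and us: "\<And>u. u \<in> set us \<Longrightarrow> cost_ok \<E> \<Gamma> (snd u) K"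
  shows "cost_ok \<E> \<Gamma> (seq_d e0 lf K us) (length us * K + r)"
  using us
proof (induction us)
  case Nil
  then show ?case using e0 by (simp add: cost_ok_def mult_left_mono)
next
  case (Cons u us)
  then show ?case using cost_ok_then[OF lf, of \<E> \<Gamma> "snd u" K "seq_d e0 lf K us" "length us * K + r"]
    by (simp add: add.assoc)
qed

lemma run_cost_ok:
  assumes "cost_ok \<E> \<Gamma> d n" "(xs, ys, es) \<in> set_pmf (run W g d n)"
  shows "set es \<subseteq> \<E>" "(\<Sum>t<n. es ! t) \<le> real n * \<Gamma>"
proof -
  have "length xs = n" "length ys = n" "map (\<lambda>t. d (take t xs) (take t ys)) [0..<n] = es"
    using run_length[OF assms(2)] run_inputs[OF assms(2)] by auto
  then show "set es \<subseteq> \<E>" "(\<Sum>t<n. es ! t) \<le> real n * \<Gamma>"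
    using assms(1) unfolding cost_ok_def by auto
qed

text \<open>Each block hands a full battery to the next, so feasibility from a full battery carries
  over block by block, and the idle tail costs nothing.\<close>

lemma feas_seq:
  assumes lf: "is_clock lf"
    and x0: "\<phi> x0 = 0" and B: "0 \<le> B" and e0: "0 \<le> e0"
    and us: "\<And>u xs ys es. u \<in> set us \<Longrightarrow> (xs, ys, es) \<in> set_pmf (run W (fst u) (snd u) K) \<Longrightarrow>
       feas \<phi> B B xs es \<and> level \<phi> B B xs es = B"
  shows "\<forall>(xs, ys, es)\<in>set_pmf (run W (seq_g x0 K us) (seq_d e0 lf K us) (length us * K + r)). feas \<phi> B B xs es"
  using us
proof (induction us)
  case Nil
  have "feas \<phi> B B xs es" if "(xs, ys, es) \<in> set_pmf (run W (\<lambda>_. x0) (\<lambda>_ _. e0) r)" for xs ys es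
    using run_inputs[OF that] run_length[OF that] x0 B e0
    by (intro feas_zero_cost[THEN conjunct1]) auto
  then show ?case by auto
next
  case (Cons u us)
  have run: "run W (seq_g x0 K (u # us)) (seq_d e0 lf K (u # us)) (length (u # us) * K + r) =
      bind_pmf (run W (fst u) (snd u) K) (\<lambda>(xs, ys, es).
      map_pmf (\<lambda>(xs', ys', es'). (xs @ xs', ys @ ys', es @ es'))
        (run W (seq_g x0 K us) (seq_d e0 lf K us) (length us * K + r)))"
    using run_then[OF lf, of W K "fst u" "seq_g x0 K us" "snd u" "seq_d e0 lf K us" "length us * K + r"]
    by (simp add: add.assoc)
  have IH: "\<forall>(xs, ys, es)\<in>set_pmf (run W (seq_g x0 K us) (seq_d e0 lf K us) (length us * K + r)). feas \<phi> B B xs es"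
    by (rule Cons.IH) (rule Cons.prems, simp_all)
  show ?case
    unfolding run
  proof clarsimp
    fix xs ys es xs' ys' es'
    assume 1: "(xs, ys, es) \<in> set_pmf (run W (fst u) (snd u) K)"
      and 2: "(xs', ys', es') \<in> set_pmf (run W (seq_g x0 K us) (seq_d e0 lf K us) (length us * K + r))"
    have "feas \<phi> B B xs' es'" using IH 2 by blast
    moreover have "feas \<phi> B B xs es \<and> level \<phi> B B xs es = B" by (rule Cons.prems[OF _ 1]) simp
    ultimately show "feas \<phi> B B (xs @ xs') (es @ es')"
      using run_length[OF 1] by (simp add: feas_append)
  qed
qed

section \<open>Likelihoods and costs along a run\<close>

lemma pmf_bind_single:
  assumes "\<And>w. w \<in> set_pmf p \<Longrightarrow> w \<noteq> w0 \<Longrightarrow> z \<notin> set_pmf (f w)"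
  shows "pmf (bind_pmf p f) z = pmf p w0 * pmf (f w0) z"
proof -
  have "pmf (bind_pmf p f) z = E p (\<lambda>w. indicator {w0} w * pmf (f w0) z)"
    unfolding pmf_bind using assms by (intro expectation_cong) (auto simp: set_pmf_iff indicator_def)
  also have "\<dots> = pmf p w0 * pmf (f w0) z" by (simp add: pmf.rep_eq)
  finally show ?thesis .
qed

lemma run_SucE:
  assumes "(xs, ys, es) \<in> set_pmf (run W g d (Suc n))"
  obtains xs' ys' es' y where "(xs', ys', es') \<in> set_pmf (run W g d n)"
    "es = es' @ [d xs' ys']" "xs = xs' @ [g es]" "ys = ys' @ [y]" "y \<in> set_pmf (W (g es))"
  using assms by (auto simp: run_Suc)

text \<open>Under a deterministic policy the outputs determine charges and inputs step by step. Each
  output sequence therefore has a single history, and its probability is a product of channel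
  probabilities even with feedback.\<close>

lemma run_unique:
  "(xs, ys, es) \<in> set_pmf (run W g d n) \<Longrightarrow> (xs', ys, es') \<in> set_pmf (run W g d n) \<Longrightarrow> xs' = xs \<and> es' = es"
proof (induction n arbitrary: xs ys es xs' es')
  case (Suc n)
  show ?case
    using Suc.prems by (elim run_SucE) (use Suc.IH in blast)
qed (simp add: run_0)

lemma pmf_run:
  "(xs, ys, es) \<in> set_pmf (run W g d n) \<Longrightarrow>
     pmf (run W g d n) (xs, ys, es) = (\<Prod>t<n. pmf (W (xs ! t)) (ys ! t))"
proof (induction n arbitrary: xs ys es)
  case (Suc n)
  then obtain xs' ys' es' y where *: "(xs', ys', es') \<in> set_pmf (run W g d n)"
    "es = es' @ [d xs' ys']" "xs = xs' @ [g es]" "ys = ys' @ [y]" by (elim run_SucE)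
  have len: "length xs' = n" "length ys' = n" using run_length[OF *(1)] by auto
  define h where "h = (\<lambda>y. (xs' @ [g (es' @ [d xs' ys'])], ys' @ [y], es' @ [d xs' ys']))"
  have h: "inj h" by (auto simp: inj_on_def h_def)
  have z: "(xs, ys, es) = h y" by (simp add: *(2-) h_def)
  have "pmf (run W g d (Suc n)) (xs, ys, es) = pmf (run W g d n) (xs', ys', es') * pmf (map_pmf h (W (g es))) (h y)"
    unfolding run_Suc
    by (subst pmf_bind_single[of _ "(xs', ys', es')"]) (auto simp: *(2-) h_def)
  also have "\<dots> = (\<Prod>t<n. pmf (W (xs' ! t)) (ys' ! t)) * pmf (W (g es)) y"
    by (simp add: Suc.IH[OF *(1)] pmf_map_inj'[OF h])
  also have "\<dots> = (\<Prod>t<Suc n. pmf (W (xs ! t)) (ys ! t))"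
    using len by (simp add: *(3,4) nth_append)
  finally show ?case .
qed (simp add: run_0)

lemma pmf_out:
  assumes "(xs, ys, es) \<in> set_pmf (run W g d n)"
  shows "pmf (out W g d n) ys = (\<Prod>t<n. pmf (W (xs ! t)) (ys ! t))"
proof -
  have "pmf (out W g d n) ys = pmf (run W g d n) (xs, ys, es) * pmf (return_pmf ys) ys"
    unfolding out_def map_pmf_def
    by (subst pmf_bind_single[of _ "(xs, ys, es)"]) (auto dest: run_unique[OF assms])
  then show ?thesis by (simp add: pmf_run[OF assms])
qed

text \<open>Tower rule: given the past, \<open>ys ! t\<close> has law \<open>W (xs ! t)\<close>.
  Later inputs may depend on this output through the charger, so the terms are replaced one step at
  a time.\<close>

lemma expectation_run_sum:
  fixes W :: "'x \<Rightarrow> 'y::finite pmf" and h :: "'x \<Rightarrow> 'y \<Rightarrow> real"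
  shows "E (run W g d n) (\<lambda>(xs, ys, es). \<Sum>t<n. h (xs ! t) (ys ! t))
       = E (run W g d n) (\<lambda>(xs, ys, es). \<Sum>t<n. E (W (xs ! t)) (h (xs ! t)))"
proof (induction n)
  case (Suc n)
  have *: "E (run W g d (Suc n)) f = E (run W g d n) (\<lambda>(xs, ys, es).
      E (W (g (es @ [d xs ys]))) (\<lambda>y. f (xs @ [g (es @ [d xs ys])], ys @ [y], es @ [d xs ys])))" for f :: "_ \<Rightarrow> real"
    unfolding run_Suc by (subst expectation_bind) (auto simp: finite_run case_prod_unfold)
  have "E (run W g d (Suc n)) (\<lambda>(xs, ys, es). \<Sum>t<Suc n. h (xs ! t) (ys ! t))
     = E (run W g d n) (\<lambda>(xs, ys, es). (\<Sum>t<n. h (xs ! t) (ys ! t)) + E (W (g (es @ [d xs ys]))) (h (g (es @ [d xs ys]))))"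
    unfolding * by (intro expectation_cong)
      (auto dest!: run_length simp: nth_append integrable_measure_pmf_finite)
  also have "\<dots> = E (run W g d n) (\<lambda>(xs, ys, es). (\<Sum>t<n. E (W (xs ! t)) (h (xs ! t))) + E (W (g (es @ [d xs ys]))) (h (g (es @ [d xs ys]))))"
    using Suc by (simp add: case_prod_unfold integrable_measure_pmf_finite finite_run)
  also have "\<dots> = E (run W g d (Suc n)) (\<lambda>(xs, ys, es). \<Sum>t<Suc n. E (W (xs ! t)) (h (xs ! t)))"
    unfolding * by (intro expectation_cong)
      (auto dest!: run_length simp: nth_append integrable_measure_pmf_finite)
  finally show ?case .
qed simp

text \<open>Without incoming energy and with \<open>b \<le> B\<close> the cap is inactive, so each
  step lowers the level by its cost.\<close>

lemma sum_costs_le: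
  assumes \<phi>: "\<And>x. 0 \<le> \<phi> x"
    and "feas \<phi> B b xs es" "length xs = length es" "set es \<subseteq> {0}" "b \<le> B"
  shows "(\<Sum>t<length xs. \<phi> (xs ! t)) \<le> b - level \<phi> B b xs es"
  using assms(2-)
proof (induction xs arbitrary: b es)
  case (Cons x xs)
  then obtain es' where es: "es = 0 # es'" by (cases es) auto
  have b: "min b B = b" using Cons.prems by simp
  have "(\<Sum>t<length xs. \<phi> (xs ! t)) \<le> (b - \<phi> x) - level \<phi> B (b - \<phi> x) xs es'"
    using Cons.prems b \<phi>[of x] unfolding es by (intro Cons.IH) auto
  then show ?case
    using b unfolding es by (simp add: sum.lessThan_Suc_shift del: sum.lessThan_Suc)
qed simp

section \<open>Capacity of a class of chargers\<close>

lemma memoryless_map: "memoryless (\<lambda>u. map_pmf h (V u)) us = map_pmf (map h) (memoryless V us)"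
  by (induction us) (simp_all add: map_bind_pmf bind_map_pmf)

text \<open>Messages whose policies carry the same chargers obtain the same concatenated charger, as
  a charger ignorant of the message requires.\<close>

lemma seq_d_cong: "map snd us = map snd us' \<Longrightarrow> seq_d e0 lf K us = seq_d e0 lf K us'"
proof (induction us arbitrary: us')
  case (Cons u us)
  then obtain v vs where "us' = v # vs" by (cases us') auto
  then show ?case using Cons by auto
qed simp

lemma num_messages_bounds:
  assumes "0 \<le> R"
  shows "1 \<le> num_messages R n" "real (num_messages R n) \<le> 2 powr (real n * R) + 1"
    "real n * R \<le> log 2 (real (num_messages R n))"
proof -
  have p: "1 \<le> 2 powr (real n * R)" using assms by (simp add: ge_one_powr_ge_zero)
  have c: "real (num_messages R n) = of_int \<lceil>2 powr (real n * R)\<rceil>"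
    using p unfolding num_messages_def by (subst of_nat_nat) auto
  have le: "2 powr (real n * R) \<le> real (num_messages R n)" unfolding c by simp
  then show "1 \<le> num_messages R n" using p by linarith
  show "real (num_messages R n) \<le> 2 powr (real n * R) + 1" unfolding c by linarith
  have "real n * R = log 2 (2 powr (real n * R))" by simp
  also have "\<dots> \<le> log 2 (real (num_messages R n))" using le p by (intro log_mono) auto
  finally show "real n * R \<le> log 2 (real (num_messages R n))" .
qed

text \<open>The coding theorem gives codes for each \<epsilon> separately, while
  \<open>achievable\<close> asks for one sequence. Choosing for each \<open>n\<close> an error
  within \<open>1 / n\<close> of the infimum serves every \<epsilon> at once.\<close>

lemma choose_vanishing:
  fixes e :: "nat \<Rightarrow> 'a \<Rightarrow> real"
  assumes ex: "\<And>n. 1 \<le> n \<Longrightarrow> \<exists>x. Q n x" and e0: "\<And>n x. 0 \<le> e n x"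
    and small: "\<And>\<epsilon>. 0 < \<epsilon> \<Longrightarrow> \<forall>\<^sub>F n in sequentially. \<exists>x. Q n x \<and> e n x \<le> \<epsilon>"
  shows "\<exists>x. (\<forall>n\<ge>1. Q n (x n)) \<and> (\<lambda>n. e n (x n)) \<longlonglongrightarrow> 0"
proof -
  define m where "m n = Inf (e n ` {x. Q n x})" for n
  have bdd: "bdd_below (e n ` {x. Q n x})" for n by (rule bdd_belowI[of _ 0]) (use e0 in auto)
  have "\<exists>x. Q n x \<and> e n x < m n + 1 / real n" if "1 \<le> n" for n
  proof -
    have "e n ` {x. Q n x} \<noteq> {}" using ex[OF that] by auto
    moreover have "m n < m n + 1 / real n" using that by simp
    ultimately have "\<exists>v\<in>e n ` {x. Q n x}. v < m n + 1 / real n"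
      using cInf_less_iff[OF _ bdd] unfolding m_def by blast
    then show ?thesis by blast
  qed
  then obtain x where x: "\<And>n. 1 \<le> n \<Longrightarrow> Q n (x n) \<and> e n (x n) < m n + 1 / real n" by metis
  have "(\<lambda>n. e n (x n)) \<longlonglongrightarrow> 0"
  proof (rule order_tendstoI)
    fix a :: real assume "a < 0"
    then show "\<forall>\<^sub>F n in sequentially. a < e n (x n)" using e0 by (intro always_eventually allI) (meson less_le_trans)
  next
    fix a :: real assume a: "0 < a"
    have "(\<lambda>n. 1 / real n) \<longlonglongrightarrow> 0" by real_asymp
    then have "\<forall>\<^sub>F n in sequentially. 1 / real n < a / 2" using a by (intro order_tendstoD) auto
    moreover have "\<forall>\<^sub>F n in sequentially. \<exists>x. Q n x \<and> e n x \<le> a / 2" using a by (intro small) simp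
    ultimately show "\<forall>\<^sub>F n in sequentially. e n (x n) < a" using eventually_ge_at_top[of 1]
    proof eventually_elim
      case (elim n)
      then obtain x' where x': "Q n x'" "e n x' \<le> a / 2" by blast
      have "m n \<le> e n x'" unfolding m_def using x' bdd by (intro cInf_lower) auto
      then show ?case using x[of n] elim x' by linarith
    qed
  qed
  then show ?thesis using x by blast
qed

text \<open>\<open>e0\<close> is the cheapest energy symbol; some charger meets the budget if and
  only if \<open>e0 \<le> \<Gamma>\<close>.\<close>

locale remote_power =
  fixes W :: "'x::finite \<Rightarrow> 'y::finite pmf"
    and \<phi> :: "'x \<Rightarrow> real"
    and B :: real
    and \<E> :: "real set"
    and x0 :: 'x
    and \<Gamma> e0 :: real
  assumes \<phi>0: "\<And>x. 0 \<le> \<phi> x" and \<phi>B: "\<And>x. \<phi> x \<le> B" and x0: "\<phi> x0 = 0"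
    and \<E>_finite: "finite \<E>" and \<E>: "\<E> \<subseteq> {0..B}" and e1: "\<exists>e\<in>\<E>. 0 < e"
    and e0: "e0 \<in> \<E>" "\<And>e. e \<in> \<E> \<Longrightarrow> e0 \<le> e" and \<Gamma>0: "0 \<le> \<Gamma>"
begin

abbreviation adm :: "nat \<Rightarrow> ('x list \<times> real list) set" where
  "adm \<equiv> admissible \<phi> B \<E> \<Gamma>"

abbreviation code :: "real \<Rightarrow> nat \<Rightarrow> (nat \<Rightarrow> real list \<Rightarrow> 'x) \<Rightarrow> ('x, 'y) charger \<Rightarrow> ('y list \<Rightarrow> nat) \<Rightarrow> bool" where
  "code \<equiv> is_code \<phi> B \<E> \<Gamma>"

lemma B0: "0 \<le> B" using \<phi>0[of x0] \<phi>B[of x0] by linarith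

lemma \<E>_nonneg: "set es \<subseteq> \<E> \<Longrightarrow> set es \<subseteq> {0..}"
  using \<E> by auto

end

text \<open>
  \<open>Cs\<close> is the set of chargers for a fixed message, \<open>cog\<close> tells whether the charger may depend on the
  message. The clock \<open>lf\<close> reads the time off one of the two histories; both have the same length,
  but membership in \<open>Cs\<close> forbids looking at the wrong one.
\<close>

locale charger_class = remote_power W \<phi> B \<E> x0 \<Gamma> e0
  for W :: "'x::finite \<Rightarrow> 'y::finite pmf"
    and \<phi> :: "'x \<Rightarrow> real"
    and B :: real
    and \<E> :: "real set"
    and x0 :: 'x
    and \<Gamma> e0 :: real +
  fixes Cs :: "('x list \<Rightarrow> 'y list \<Rightarrow> real) set"
    and lf :: "'x list \<Rightarrow> 'y list \<Rightarrow> nat"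
    and cog :: bool
    and \<C> :: "('x, 'y) charger set"
  assumes clock: "is_clock lf"
    and Cs_clock: "\<And>h. (\<lambda>xs ys. h (lf xs ys)) \<in> Cs"
    and Cs_then: "\<And>a b K. a \<in> Cs \<Longrightarrow> b \<in> Cs \<Longrightarrow> then_d lf K a b \<in> Cs"
    and \<C>_I: "\<And>D. (\<And>m. D m \<in> Cs) \<Longrightarrow> (\<And>m m'. \<not> cog \<Longrightarrow> D m = D m') \<Longrightarrow> D \<in> \<C>"
begin

abbreviation ach :: "real \<Rightarrow> bool" where
  "ach \<equiv> achievable W \<phi> B \<E> \<Gamma> \<C>"

abbreviation cap :: ereal where
  "cap \<equiv> capacity W \<phi> B \<E> \<Gamma> \<C>"

lemma Cs_const: "(\<lambda>_ _. e) \<in> Cs"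
  using Cs_clock[of "\<lambda>_. e"] .

text \<open>A policy is \<open>good\<close> if it may be used for one block starting with a full battery; only a \<open>recharged\<close>
  one may be followed by another block.\<close>

definition good :: "nat \<Rightarrow> ('x, 'y) policy \<Rightarrow> bool" where
  "good K u \<longleftrightarrow> snd u \<in> Cs \<and> cost_ok \<E> \<Gamma> (snd u) K \<and>
     (\<forall>(xs, ys, es)\<in>set_pmf (run W (fst u) (snd u) K). feas \<phi> B B xs es)"

definition recharged :: "nat \<Rightarrow> ('x, 'y) policy \<Rightarrow> bool" where
  "recharged K u \<longleftrightarrow> (\<forall>(xs, ys, es)\<in>set_pmf (run W (fst u) (snd u) K). level \<phi> B B xs es = B)"

text \<open>\<open>h\<close> is what the decoder keeps of an output block: it discards the outputs
  of a gap, or unwraps a block of length one. Equal chargers in all words make the concatenated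
  charger independent of the message.\<close>

lemma code_from_blocks:
  assumes e0\<Gamma>: "e0 \<le> \<Gamma>" and R: "0 \<le> R"
    and len: "\<And>m. length (w m) = N" and n: "N * K \<le> n"
    and good: "\<And>m u. u \<in> set (w m) \<Longrightarrow> good K u \<and> recharged K u"
    and common: "\<And>m m' u v. \<not> cog \<Longrightarrow> u \<in> set (w m) \<Longrightarrow> v \<in> set (w m') \<Longrightarrow> snd u = snd v"
    and dec: "\<And>zs. dec zs \<in> {1..num_messages R n}"
    and err: "\<And>m. m \<in> {1..num_messages R n} \<Longrightarrow>
       pr (memoryless (\<lambda>u. map_pmf h (out W (fst u) (snd u) K)) (w m)) {zs. dec zs \<noteq> m} \<le> \<epsilon>"
  shows "\<exists>f c g. c \<in> \<C> \<and> code R n f c g \<and> error_prob W R n f c g \<le> \<epsilon>"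
proof -
  define f where "f m = safe \<phi> B x0 (seq_g x0 K (w m))" for m
  define c where "c m = seq_d e0 lf K (w m)" for m
  define g where "g ys = dec (map h (blocks K N ys))" for ys
  obtain r where r: "n = N * K + r" using n le_Suc_ex by blast
  have "seq_d e0 lf K us \<in> Cs" if "\<And>u. u \<in> set us \<Longrightarrow> snd u \<in> Cs" for us
    using that by (induction us) (auto intro: Cs_const Cs_then)
  then have "c m \<in> Cs" for m unfolding c_def using good by (auto simp: good_def)
  moreover have "c m = c m'" if "\<not> cog" for m m'
  proof -
    have "map snd (w m) = map snd (w m')"
    proof (rule nth_equalityI)
      fix i assume "i < length (map snd (w m))"
      then have i: "i < N" by (simp add: len)
      then have "w m ! i \<in> set (w m)" "w m' ! i \<in> set (w m')" by (simp_all add: len)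
      then have "snd (w m ! i) = snd (w m' ! i)" by (rule common[OF that])
      then show "map snd (w m) ! i = map snd (w m') ! i" using i by (simp add: len)
    qed (simp add: len)
    then show ?thesis unfolding c_def by (rule seq_d_cong)
  qed
  ultimately have "c \<in> \<C>" by (intro \<C>_I)
  have M: "1 \<le> num_messages R n" by (rule num_messages_bounds[OF R])
  have feasible: "energy_feasible \<phi> B n (map (\<lambda>t. f m (take (Suc t) es)) [0..<n]) es"
    if "length es = n" "set es \<subseteq> \<E>" for m es
  proof -
    have "set es \<subseteq> {0..}" using that \<E> by auto
    then have "feas \<phi> B B (safe_inputs \<phi> B x0 (seq_g x0 K (w m)) es n) (take n es)"
      using that by (intro feas_safe_inputs \<phi>0 x0 B0) auto
    then show ?thesis
      using that unfolding f_def by (simp add: energy_feasible_iff_feas map_safe)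
  qed
  have "cost_ok \<E> \<Gamma> (c m) n" for m
    using cost_ok_seq[OF clock e0(1) e0\<Gamma>, of "w m" K r] good len unfolding c_def r good_def by auto
  then have code: "code R n f c g"
    unfolding is_code_def using feasible dec by (auto simp: cost_ok_def g_def)
  have "pr (transmission W f c m n) {(xs, ys, es). g ys \<noteq> m} \<le> \<epsilon>" if m: "m \<in> {1..num_messages R n}" for m
  proof -
    have f: "\<forall>(xs, ys, es)\<in>set_pmf (run W (seq_g x0 K (w m)) (c m) n). feas \<phi> B B xs es"
      unfolding c_def r len[of m, symmetric]
    proof (rule feas_seq)
      fix u xs ys es
      assume "u \<in> set (w m)" "(xs, ys, es) \<in> set_pmf (run W (fst u) (snd u) K)"
      then show "feas \<phi> B B xs es \<and> level \<phi> B B xs es = B"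
        using good[of u m] unfolding good_def recharged_def by blast
    qed (use clock x0 B0 \<E> e0 in auto)
    have "pr (transmission W f c m n) {(xs, ys, es). g ys \<noteq> m} = pr (out W (seq_g x0 K (w m)) (c m) n) {ys. g ys \<noteq> m}"
      unfolding transmission_eq_run f_def run_safe[OF f] out_def by (simp add: vimage_def case_prod_unfold)
    also have "\<dots> = pr (map_pmf (map h) (map_pmf (blocks K N) (out W (seq_g x0 K (w m)) (c m) n))) {zs. dec zs \<noteq> m}"
      by (simp add: vimage_def g_def)
    also have "map_pmf (blocks K N) (out W (seq_g x0 K (w m)) (c m) n) = memoryless (\<lambda>u. out W (fst u) (snd u) K) (w m)"
      using out_seq[OF clock, of K "w m" W x0 e0 r] by (simp add: len r c_def)
    finally show ?thesis using err[OF m] by (simp add: memoryless_map)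
  qed
  then have "error_prob W R n f c g \<le> (\<Sum>m\<in>{1..num_messages R n}. \<epsilon>) / real (num_messages R n)"
    unfolding error_prob_def by (intro divide_right_mono sum_mono) auto
  also have "\<dots> = \<epsilon>" using M by simp
  finally show ?thesis using \<open>c \<in> \<C>\<close> code by blast
qed

lemma idle_code:
  assumes "e0 \<le> \<Gamma>" "0 \<le> R"
  shows "\<exists>f c g. c \<in> \<C> \<and> code R n f c g"
  \<comment> \<open>No block at all: the code only idles, and the error bound 1 is trivial. Such
    codes fill the block lengths that are too short for the construction.\<close>
  using code_from_blocks[of R "\<lambda>_. []" 0 1 n "\<lambda>_. 1" id 1] assms num_messages_bounds[OF assms(2)] by auto

lemma error_prob_nonneg: "0 \<le> error_prob W R n f c g"
  unfolding error_prob_def by (intro divide_nonneg_nonneg sum_nonneg) auto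

lemma achievableI:
  assumes "e0 \<le> \<Gamma>" and R: "0 \<le> R"
    and small: "\<And>\<epsilon>. 0 < \<epsilon> \<Longrightarrow> \<forall>\<^sub>F n in sequentially. \<exists>f c g. c \<in> \<C> \<and> code R n f c g \<and> error_prob W R n f c g \<le> \<epsilon>"
  shows "ach R"
proof -
  have "\<exists>x. (\<forall>n\<ge>1. case x n of (f, c, g) \<Rightarrow> c \<in> \<C> \<and> code R n f c g) \<and>
     (\<lambda>n. case x n of (f, c, g) \<Rightarrow> error_prob W R n f c g) \<longlonglongrightarrow> 0"
  proof (rule choose_vanishing)
    fix n show "\<exists>x. case x of (f, c, g) \<Rightarrow> c \<in> \<C> \<and> code R n f c g"
      using idle_code[OF assms(1,2), of n] by auto
  next
    fix \<epsilon> :: real assume "0 < \<epsilon>"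
    from small[OF this] show "\<forall>\<^sub>F n in sequentially. \<exists>x. (case x of (f, c, g) \<Rightarrow> c \<in> \<C> \<and> code R n f c g) \<and>
       (case x of (f, c, g) \<Rightarrow> error_prob W R n f c g) \<le> \<epsilon>"
      by eventually_elim auto
  qed (auto intro: error_prob_nonneg)
  then obtain x where x: "\<forall>n\<ge>1. case x n of (f, c, g) \<Rightarrow> c \<in> \<C> \<and> code R n f c g"
     "(\<lambda>n. case x n of (f, c, g) \<Rightarrow> error_prob W R n f c g) \<longlonglongrightarrow> 0" by blast
  then show ?thesis
    unfolding achievable_def using R
    by (intro conjI exI[of _ "\<lambda>n. fst (x n)"] exI[of _ "\<lambda>n. fst (snd (x n))"] exI[of _ "\<lambda>n. snd (snd (x n))"])
      (auto simp: case_prod_unfold)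
qed

lemma achievable_0:
  assumes "e0 \<le> \<Gamma>"
  shows "ach 0"
proof (rule achievableI[OF assms order_refl], rule always_eventually, rule allI)
  fix \<epsilon> :: real and n assume "0 < \<epsilon>"
  have "num_messages 0 n = 1" by (simp add: num_messages_def)
  then show "\<exists>f c g. c \<in> \<C> \<and> code 0 n f c g \<and> error_prob W 0 n f c g \<le> \<epsilon>"
    using \<open>0 < \<epsilon>\<close> by (intro code_from_blocks[OF assms, of 0 "\<lambda>_. []" 0 1 n "\<lambda>_. 1" id]) auto
qed

lemma achievable_from_blocks:
  assumes e0\<Gamma>: "e0 \<le> \<Gamma>" and K: "1 \<le> K" and fP: "finite (set_pmf P)"
    and good: "\<And>u. u \<in> set_pmf P \<Longrightarrow> good K u \<and> recharged K u"
    and common: "\<And>u v. \<not> cog \<Longrightarrow> u \<in> set_pmf P \<Longrightarrow> v \<in> set_pmf P \<Longrightarrow> snd u = snd v"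
    and R: "0 \<le> R" "R * real K < mixinfo P (\<lambda>u. map_pmf h (out W (fst u) (snd u) K))"
  shows "ach R"
proof (rule achievableI[OF e0\<Gamma> R(1)])
  fix \<epsilon> :: real assume \<epsilon>: "0 < \<epsilon>"
  define V where "V u = map_pmf h (out W (fst u) (snd u) K)" for u
  obtain R' where R': "R * real K < R'" "R' < mixinfo P V" using dense R(2) unfolding V_def by blast
  have fV: "finite (set_pmf (V u))" for u by (simp add: V_def finite_out)
  have N: "filterlim (\<lambda>n. n div K) at_top sequentially"
    unfolding filterlim_at_top
  proof
    fix Z
    have "Z \<le> n div K" if "Z * K \<le> n" for n
      using div_le_mono[OF that, of K] K by simp
    then show "\<forall>\<^sub>F n in sequentially. Z \<le> n div K"
      by (rule eventually_sequentiallyI)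
  qed
  \<comment> \<open>The slack \<open>1\<close> pays for rounding up the number of messages, the
    slack \<open>R * K\<close> for the incomplete last block.\<close>
  have "\<forall>\<^sub>F N in sequentially. 1 + R * real K + real N * (R * real K) \<le> real N * R'"
    using R'(1) by real_asymp
  then have e1: "\<forall>\<^sub>F n in sequentially. 1 + R * real K + real (n div K) * (R * real K) \<le> real (n div K) * R'"
    using N by (rule eventually_compose_filterlim)
  have e2: "\<forall>\<^sub>F n in sequentially. \<forall>M::nat. 1 \<le> M \<and> real M \<le> 2 powr (real (n div K) * R') \<longrightarrow>
     (\<exists>w d. (\<forall>m. length (w m) = n div K \<and> set (w m) \<subseteq> set_pmf P) \<and> (\<forall>zs. d zs \<in> {1..M}) \<and>
        (\<forall>m\<in>{1..M}. pr (memoryless V (w m)) {zs. d zs \<noteq> m} \<le> \<epsilon>))"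
    using coding_theorem[OF fP fV R'(2) \<epsilon>] N by (rule eventually_compose_filterlim)
  show "\<forall>\<^sub>F n in sequentially. \<exists>f c g. c \<in> \<C> \<and> code R n f c g \<and> error_prob W R n f c g \<le> \<epsilon>"
    using e1 e2
  proof eventually_elim
    case (elim n)
    have "real n \<le> (real (n div K) + 1) * real K"
    proof -
      have "n \<le> (n div K + 1) * K" using K dividend_less_div_times[of K n] by (simp add: algebra_simps)
      then show ?thesis by (metis of_nat_1 of_nat_add of_nat_le_iff of_nat_mult)
    qed
    then have "real n * R \<le> (real (n div K) + 1) * real K * R" using R(1) by (rule mult_right_mono)
    then have nR: "1 + real n * R \<le> real (n div K) * R'" using elim(1) by (simp add: algebra_simps)
    have "real (num_messages R n) \<le> 2 powr (real n * R) + 1" by (rule num_messages_bounds[OF R(1)])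
    also have "\<dots> \<le> 2 powr (1 + real n * R)"
      using R(1) by (simp add: powr_add ge_one_powr_ge_zero)
    also have "\<dots> \<le> 2 powr (real (n div K) * R')" using nR by simp
    finally obtain w d where wd: "\<And>m. length (w m) = n div K \<and> set (w m) \<subseteq> set_pmf P"
      "\<And>zs. d zs \<in> {1..num_messages R n}"
      "\<And>m. m \<in> {1..num_messages R n} \<Longrightarrow> pr (memoryless V (w m)) {zs. d zs \<noteq> m} \<le> \<epsilon>"
      using elim(2) num_messages_bounds(1)[OF R(1), of n] by metis
    show ?case
    proof (rule code_from_blocks[OF e0\<Gamma> R(1), of w "n div K" K n d h])
      show "good K u \<and> recharged K u" if "u \<in> set (w m)" for m u using wd(1) good that by blast
      show "snd u = snd v" if "\<not> cog" "u \<in> set (w m)" "v \<in> set (w m')" for m m' u v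
        using wd(1) common that by blast
      show "pr (memoryless (\<lambda>u. map_pmf h (out W (fst u) (snd u) K)) (w m)) {zs. d zs \<noteq> m} \<le> \<epsilon>"
        if "m \<in> {1..num_messages R n}" for m
        using wd(3)[OF that] by (simp add: V_def[abs_def])
    qed (use wd in auto)
  qed
qed

text \<open>The gap does not depend on the block length, so its rate loss vanishes.\<close>

lemma recharging_gap:
  assumes "e0 \<le> \<Gamma>" "0 < \<Gamma>"
  obtains L :: nat and h where "\<And>t. h t \<in> \<E>" "(\<Sum>t<L. h t) \<le> real L * \<Gamma>" "B \<le> (\<Sum>t<L. h t)"
proof (cases "0 < e0")
  case True
  obtain L :: nat where "B / e0 \<le> real L" using real_arch_simple by blast
  then have "B \<le> real L * e0" using True by (simp add: field_simps)
  then show ?thesis using that[of "\<lambda>_. e0" L] assms e0 by (simp add: mult_left_mono)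
next
  case False
  then have z: "e0 = 0" using e0(1) \<E> by auto
  obtain e where e: "e \<in> \<E>" "0 < e" using e1 by blast
  obtain k :: nat where "B / e \<le> real k" using real_arch_simple by blast
  then have k: "B \<le> real k * e" using e by (simp add: field_simps)
  obtain l :: nat where "real k * e / \<Gamma> \<le> real l" using real_arch_simple by blast
  then have l: "real k * e \<le> real l * \<Gamma>" using assms by (simp add: field_simps)
  \<comment> \<open>\<open>k\<close> charges of \<open>e\<close> fill an empty battery, and
    \<open>l\<close> further steps without charging bring the average down to at most
    \<open>\<Gamma>\<close>.\<close>
  define h where "h t = (if t < k then e else 0)" for t
  have s: "(\<Sum>t<k + l. h t) = real k * e"
    by (induction l) (simp_all add: h_def)
  show ?thesis
  proof (rule that[of h "k + l"])
    show "h t \<in> \<E>" for t using e e0(1) z by (simp add: h_def)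
    show "(\<Sum>t<k + l. h t) \<le> real (k + l) * \<Gamma>" unfolding s using l assms by (simp add: distrib_right add_increasing)
    show "B \<le> (\<Sum>t<k + l. h t)" unfolding s using k .
  qed
qed

lemma achievable_with_gap:
  assumes e0\<Gamma>: "e0 \<le> \<Gamma>" "0 < \<Gamma>"
  shows "\<exists>L::nat. \<forall>n\<ge>1. \<forall>P R. finite (set_pmf P) \<and> (\<forall>u\<in>set_pmf P. good n u) \<and>
     (\<not> cog \<longrightarrow> (\<forall>u\<in>set_pmf P. \<forall>v\<in>set_pmf P. snd u = snd v)) \<and> 0 \<le> R \<and>
     R * real (n + L) < mixinfo P (\<lambda>u. out W (fst u) (snd u) n) \<longrightarrow> ach R"
proof -
  obtain L :: nat and h where h: "\<And>t. h t \<in> \<E>" "(\<Sum>t<L. h t) \<le> real L * \<Gamma>" "B \<le> (\<Sum>t<L. h t)"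
    using recharging_gap[OF assms] by blast
  show ?thesis
  proof (intro exI[of _ L] allI impI, elim conjE)
    fix n :: nat and P :: "('x, 'y) policy pmf" and R :: real
    assume n: "1 \<le> n" and fP: "finite (set_pmf P)" and good: "\<forall>u\<in>set_pmf P. good n u"
      and common: "\<not> cog \<longrightarrow> (\<forall>u\<in>set_pmf P. \<forall>v\<in>set_pmf P. snd u = snd v)"
      and R: "0 \<le> R" "R * real (n + L) < mixinfo P (\<lambda>u. out W (fst u) (snd u) n)"
    \<comment> \<open>The gap charger reads only the clock and so belongs to every class. The
      decoder discards the outputs of the gap by \<open>take n\<close>.\<close>
    define gd where "gd = (\<lambda>(xs :: 'x list) (ys :: 'y list). h (lf xs ys))"
    define ext where "ext u = (then_g n (fst u) (\<lambda>_. x0), then_d lf n (snd u) gd)" for u :: "('x, 'y) policy"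
    have run_ext: "run W (fst (ext u)) (snd (ext u)) (n + L) = bind_pmf (run W (fst u) (snd u) n) (\<lambda>(xs, ys, es).
      map_pmf (\<lambda>(xs', ys', es'). (xs @ xs', ys @ ys', es @ es')) (run W (\<lambda>_. x0) gd L))" for u
      unfolding ext_def fst_conv snd_conv by (rule run_then[OF clock])
    have out_ext: "map_pmf (take n) (out W (fst (ext u)) (snd (ext u)) (n + L)) = out W (fst u) (snd u) n" for u
    proof -
      have "map_pmf (take n) (out W (fst (ext u)) (snd (ext u)) (n + L)) =
        bind_pmf (run W (fst u) (snd u) n) (\<lambda>(xs, ys, es). map_pmf (\<lambda>_. ys) (run W (\<lambda>_. x0) gd L))"
        unfolding out_def run_ext map_bind_pmf
        by (intro bind_pmf_cong refl) (auto dest!: run_length simp: map_pmf_comp case_prod_unfold)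
      then show ?thesis by (simp add: out_def case_prod_unfold flip: map_pmf_def)
    qed
    have gd: "cost_ok \<E> \<Gamma> gd L"
      unfolding cost_ok_def gd_def using h by (auto simp: is_clockD[OF clock] min_absorb1)
    have good_ext: "good (n + L) (ext u) \<and> recharged (n + L) (ext u)" if u: "u \<in> set_pmf P" for u
    proof -
      have gu: "good n u" using good u by blast
      have 1: "snd (ext u) \<in> Cs" "cost_ok \<E> \<Gamma> (snd (ext u)) (n + L)"
        using gu gd unfolding good_def ext_def
        by (auto intro!: Cs_then Cs_clock cost_ok_then clock simp: gd_def)
      have 2: "feas \<phi> B B (xs @ xs') (es @ es') \<and> level \<phi> B B (xs @ xs') (es @ es') = B"
        if a: "(xs, ys, es) \<in> set_pmf (run W (fst u) (snd u) n)"
          and b: "(xs', ys', es') \<in> set_pmf (run W (\<lambda>_. x0) gd L)" for xs ys es xs' ys' es'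
      proof -
        have f: "feas \<phi> B B xs es" using gu a by (auto simp: good_def)
        have "cost_ok \<E> \<Gamma> (snd u) n" using gu by (simp add: good_def)
        then have "set es \<subseteq> \<E>" by (rule run_cost_ok(1)[OF _ a])
        then have l: "0 \<le> level \<phi> B B xs es" "level \<phi> B B xs es \<le> B"
          using level_bounds[OF \<phi>0 B0 order_refl _ \<E>_nonneg f] run_length[OF a] by auto
        have es': "map (\<lambda>t. h (length (take t ys'))) [0..<L] = es'"
          using run_inputs[OF b] run_length[OF b] by (simp add: gd_def is_clockD[OF clock])
        have "sum_list es' = sum_list (map h [0..<L])"
          using run_length[OF b] by (subst es'[symmetric]) (auto intro!: arg_cong[of _ _ sum_list] map_cong)
        then have "sum_list es' = (\<Sum>t<L. h t)"
          by (simp add: interv_sum_list_conv_sum_set_nat atLeast0LessThan)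
        then have "B \<le> level \<phi> B B xs es + sum_list es'" using h(3) l by linarith
        moreover have "set es' \<subseteq> {0..}" using es' h(1) by (intro \<E>_nonneg) auto
        moreover have "\<phi> x = 0" if "x \<in> set xs'" for x
          using run_inputs[OF b] that x0 by auto
        ultimately have "feas \<phi> B (level \<phi> B B xs es) xs' es' \<and> level \<phi> B (level \<phi> B B xs es) xs' es' = B"
          using feas_zero_cost[of xs' \<phi> "level \<phi> B B xs es" B es'] l run_length[OF b] by auto
        then show ?thesis using f run_length[OF a] by (simp add: feas_append level_append)
      qed
      show ?thesis unfolding good_def recharged_def run_ext using 1 2 by fastforce
    qed
    show "ach R"
    proof (rule achievable_from_blocks[OF e0\<Gamma>(1), of "n + L" "map_pmf ext P" R "take n"])
      show "good (n + L) v \<and> recharged (n + L) v" if v: "v \<in> set_pmf (map_pmf ext P)" for v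
        using good_ext v by fastforce
      show "snd v = snd v'"
        if cog: "\<not> cog" and v: "v \<in> set_pmf (map_pmf ext P)" and v': "v' \<in> set_pmf (map_pmf ext P)" for v v'
      proof -
        obtain u u' where "u \<in> set_pmf P" "v = ext u" "u' \<in> set_pmf P" "v' = ext u'"
          using v v' by auto
        moreover from this have "snd u = snd u'" using common cog by blast
        ultimately show ?thesis by (simp add: ext_def)
      qed
      show "R * real (n + L) < mixinfo (map_pmf ext P) (\<lambda>u. map_pmf (take n) (out W (fst u) (snd u) (n + L)))"
        using R(2) unfolding mixinfo_map out_ext .
    qed (use fP R n in auto)
  qed
qed

end

text \<open>On a finite alphabet positive costs are bounded away from 0, so the excess divergence of
  a costly symbol is dominated by a linear price \<open>c * \<phi> x\<close>.\<close>

lemma divergence_le_zero_rate: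
  fixes W :: "'x::finite \<Rightarrow> 'y::finite pmf"
  assumes \<phi>: "\<And>x. 0 \<le> \<phi> x" and x0: "\<phi> x0 = 0" and l: "0 < l" "l < 1"
  shows "\<exists>P q c. (\<forall>x\<in>set_pmf P. \<phi> x = 0) \<and> (\<forall>x. set_pmf (W x) \<subseteq> set_pmf q) \<and> 0 \<le> c \<and>
    (\<forall>x. kl (W x) q \<le> mixinfo P W - log 2 (1 - l) + c * \<phi> x)"
proof -
  obtain P q where P: "set_pmf P \<subseteq> {x. \<phi> x = 0}"
    and q: "\<And>x y. y \<in> set_pmf (W x) \<Longrightarrow> y \<in> set_pmf q"
    and D0: "\<And>x. x \<in> {x. \<phi> x = 0} \<Longrightarrow> kl (W x) q \<le> mixinfo P W - log 2 (1 - l)"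
    and D1: "\<And>x. kl (W x) q \<le> log 2 (real CARD('x) / l)"
    using near_capacity_output[of "{x. \<phi> x = 0}" l W] x0 l by blast
  define a where "a = \<bar>mixinfo P W - log 2 (1 - l)\<bar> + \<bar>log 2 (real CARD('x) / l)\<bar>"
  \<comment> \<open>Division by zero gives 0, so free symbols add nothing to \<open>k\<close>, while
    \<open>k * \<phi> x\<close> is at least 1 for every costly symbol.\<close>
  define k where "k = (\<Sum>x\<in>UNIV. 1 / \<phi> x)"
  have k0: "0 \<le> k" unfolding k_def by (intro sum_nonneg) (simp add: \<phi>)
  have k: "1 \<le> k * \<phi> x" if "\<phi> x \<noteq> 0" for x
  proof -
    have "1 / \<phi> x \<le> k" unfolding k_def by (rule member_le_sum) (auto simp: \<phi>)
    then show ?thesis using that \<phi>[of x] by (simp add: field_simps less_le)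
  qed
  have "kl (W x) q \<le> mixinfo P W - log 2 (1 - l) + a * k * \<phi> x" for x
  proof (cases "\<phi> x = 0")
    case True
    then show ?thesis using D0[of x] by simp
  next
    case False
    have "a * 1 \<le> a * (k * \<phi> x)" using k[OF False] by (intro mult_left_mono) (auto simp: a_def)
    then show ?thesis using D1[of x] unfolding a_def by (simp add: mult.assoc)
  qed
  then show ?thesis using P q k0 by (intro exI[of _ P] exI[of _ q] exI[of _ "a * k"]) (auto simp: a_def)
qed

context charger_class
begin

lemma capacity_geI:
  assumes "e0 \<le> \<Gamma>" and ach: "\<And>R. 0 \<le> R \<Longrightarrow> R < a \<Longrightarrow> ach R"
  shows "ereal a \<le> cap"
proof (rule ccontr)
  assume "\<not> ?thesis"
  then have "cap < ereal a" by simp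
  then obtain r where r: "cap < ereal r" "ereal r < ereal a"
    using ereal_dense2 by blast
  have up: "ereal R \<le> cap" if "ach R" for R
    unfolding capacity_def using that by (intro SUP_upper) simp
  \<comment> \<open>Achievability of rate 0 makes \<open>r\<close> positive, so that the assumption
    applies to \<open>r\<close>.\<close>
  have "ereal 0 < ereal r" using up[OF achievable_0[OF assms(1)]] r(1) by (rule le_less_trans)
  then have "ereal r \<le> cap" using r ach by (intro up) simp
  then show False using r by simp
qed

lemma capacity_nonneg: "e0 \<le> \<Gamma> \<Longrightarrow> 0 \<le> cap"
  using capacity_geI[of 0] by (simp add: zero_ereal_def)

text \<open>Free symbols leave a full battery full even if nothing is charged, so a single symbol is
  already a recharged block of length one.\<close>

lemma mixinfo_zero_cost_le_capacity:
  assumes \<Gamma>: "\<Gamma> = 0" "e0 \<le> \<Gamma>" and P: "\<And>x. x \<in> set_pmf P \<Longrightarrow> \<phi> x = 0"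
  shows "ereal (mixinfo P W) \<le> cap"
proof (rule capacity_geI[OF \<Gamma>(2)])
  fix R assume R: "0 \<le> R" "R < mixinfo P W"
  have z: "e0 = 0" using e0(1) \<E> \<Gamma> by auto
  define pol :: "'x \<Rightarrow> ('x, 'y) policy" where "pol x = ((\<lambda>_. x), (\<lambda>_ _. 0))" for x
  have run: "run W (fst (pol x)) (snd (pol x)) 1 = map_pmf (\<lambda>y. ([x], [y], [0])) (W x)" for x
    by (simp add: pol_def run_Suc run_0 bind_return_pmf)
  show "ach R"
  proof (rule achievable_from_blocks[OF \<Gamma>(2), of 1 "map_pmf pol P" R hd])
    show "finite (set_pmf (map_pmf pol P))" by simp
    show "good 1 u \<and> recharged 1 u" if u: "u \<in> set_pmf (map_pmf pol P)" for u
    proof -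
      obtain x where "x \<in> set_pmf P" "u = pol x" using u by auto
      then have x: "u = pol x" "\<phi> x = 0" using P by auto
      have "snd (pol x) \<in> Cs" by (simp add: pol_def Cs_const)
      moreover have "cost_ok \<E> \<Gamma> (snd (pol x)) 1" using e0 z \<Gamma> by (simp add: pol_def cost_ok_def)
      ultimately show ?thesis
        unfolding good_def recharged_def x(1) run using x(2) B0 by auto
    qed
    show "R * real 1 < mixinfo (map_pmf pol P) (\<lambda>u. map_pmf hd (out W (fst u) (snd u) 1))"
      using R by (simp only: mixinfo_map out_def run) (simp add: map_pmf_comp)
  qed (use R in \<open>auto simp: pol_def\<close>)
qed

text \<open>The information is compared with the product law of \<open>q\<close>: the density adds
  up over time, and each term averages to a divergence. With nothing charged the total cost is at
  most the initial \<open>B\<close>, so the total price stays bounded in \<open>n\<close>.\<close>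

lemma mixinfo_zero_rate_le:
  fixes P :: "('x, 'y) policy pmf"
  assumes \<Gamma>: "\<Gamma> = 0" and fP: "finite (set_pmf P)" and good: "\<And>u. u \<in> set_pmf P \<Longrightarrow> good n u"
    and q: "\<And>x y. y \<in> set_pmf (W x) \<Longrightarrow> y \<in> set_pmf q" and c: "0 \<le> c"
    and D: "\<And>x. kl (W x) q \<le> a + c * \<phi> x"
  shows "mixinfo P (\<lambda>u. out W (fst u) (snd u) n) \<le> real n * a + c * B"
proof -
  define V where "V u = out W (fst u) (snd u) n" for u :: "('x, 'y) policy"
  define Q where "Q = memoryless (\<lambda>_. q) (replicate n ())"
  have fV: "finite (set_pmf (V u))" for u by (simp add: V_def finite_out)
  have W0: "pmf (W (xs ! t)) (ys ! t) \<noteq> 0" if "(xs, ys, es) \<in> set_pmf (run W g d n)" "t < n" for xs ys es g d t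
  proof -
    have "pmf (run W g d n) (xs, ys, es) \<noteq> 0" using that(1) by (simp add: set_pmf_iff)
    then show ?thesis using that(2) unfolding pmf_run[OF that(1)] by auto
  qed
  have q0: "pmf q (ys ! t) \<noteq> 0" if "(xs, ys, es) \<in> set_pmf (run W g d n)" "t < n" for xs ys es g d t
    using W0[OF that] q by (auto simp: set_pmf_iff)
  have Q: "pmf Q ys = (\<Prod>t<n. pmf q (ys ! t))" if "length ys = n" for ys
    using that by (simp add: Q_def pmf_memoryless)
  have "mixinfo P V \<le> E P (\<lambda>u. E (V u) (\<lambda>ys. log 2 (pmf (V u) ys / pmf Q ys)))"
  proof (rule mixinfo_le[OF fP fV])
    fix u ys assume "ys \<in> set_pmf (V u)"
    then obtain xs es where r: "(xs, ys, es) \<in> set_pmf (run W (fst u) (snd u) n)" by (auto simp: V_def out_def)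
    show "0 < pmf Q ys"
      using q0[OF r] run_length[OF r] by (auto simp: Q less_le intro!: prod_nonneg)
  next
    have "(\<Sum>y\<in>set_pmf (bind_pmf P V). pmf Q y) = pr Q (set_pmf (bind_pmf P V))"
      using fP fV by (intro measure_measure_pmf_finite[symmetric]) auto
    then show "(\<Sum>y\<in>set_pmf (bind_pmf P V). pmf Q y) \<le> 1" by simp
  qed
  also have "\<dots> \<le> E P (\<lambda>u. real n * a + c * B)"
  proof (rule expectation_mono[OF fP])
    fix u assume u: "u \<in> set_pmf P"
    define h where "h x y = log 2 (pmf (W x) y / pmf q y)" for x y
    have "E (V u) (\<lambda>ys. log 2 (pmf (V u) ys / pmf Q ys))
      = E (run W (fst u) (snd u) n) (\<lambda>(xs, ys, es). log 2 (pmf (V u) ys / pmf Q ys))"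
      by (simp add: V_def out_def case_prod_unfold)
    also have "\<dots> = E (run W (fst u) (snd u) n) (\<lambda>(xs, ys, es). \<Sum>t<n. h (xs ! t) (ys ! t))"
    proof (rule expectation_cong, clarify)
      fix xs ys es assume r: "(xs, ys, es) \<in> set_pmf (run W (fst u) (snd u) n)"
      have "log 2 (pmf (V u) ys / pmf Q ys) = log 2 (\<Prod>t<n. pmf (W (xs ! t)) (ys ! t) / pmf q (ys ! t))"
        using run_length[OF r] by (simp add: V_def pmf_out[OF r] Q prod_dividef)
      also have "\<dots> = (\<Sum>t<n. h (xs ! t) (ys ! t))"
        unfolding log_def h_def using W0[OF r] q0[OF r]
        by (subst ln_prod) (auto simp: sum_divide_distrib)
      finally show "log 2 (pmf (V u) ys / pmf Q ys) = (\<Sum>t<n. h (xs ! t) (ys ! t))" .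
    qed
    also have "\<dots> = E (run W (fst u) (snd u) n) (\<lambda>(xs, ys, es). \<Sum>t<n. E (W (xs ! t)) (h (xs ! t)))"
      by (rule expectation_run_sum)
    also have "\<dots> \<le> E (run W (fst u) (snd u) n) (\<lambda>_. real n * a + c * B)"
    proof (rule expectation_mono[OF finite_run], clarify)
      fix xs ys es assume r: "(xs, ys, es) \<in> set_pmf (run W (fst u) (snd u) n)"
      have g: "cost_ok \<E> \<Gamma> (snd u) n" "feas \<phi> B B xs es" using good[OF u] r by (auto simp: good_def)
      have es0: "set es \<subseteq> {0..}" using run_cost_ok(1)[OF g(1) r] \<E> by auto
      have "sum_list es \<le> 0"
        using run_cost_ok(2)[OF g(1) r] run_length[OF r] \<Gamma> by (simp add: sum_list_sum_nth atLeast0LessThan)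
      then have "set es \<subseteq> {0}"
        using es0 sum_list_nonneg_eq_0_iff[of es] by (force simp: antisym sum_list_nonneg)
      then have "(\<Sum>t<n. \<phi> (xs ! t)) \<le> B - level \<phi> B B xs es"
        using sum_costs_le[OF \<phi>0 g(2)] run_length[OF r] by auto
      moreover have "0 \<le> level \<phi> B B xs es"
        using level_bounds[OF \<phi>0 B0 order_refl _ es0 g(2)] run_length[OF r] by auto
      ultimately have "(\<Sum>t<n. \<phi> (xs ! t)) \<le> B" by linarith
      then have "c * (\<Sum>t<n. \<phi> (xs ! t)) \<le> c * B" using c by (rule mult_left_mono)
      moreover have "(\<Sum>t<n. E (W (xs ! t)) (h (xs ! t))) \<le> (\<Sum>t<n. a + c * \<phi> (xs ! t))"
        unfolding h_def using D by (intro sum_mono)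
      ultimately show "(\<Sum>t<n. E (W (xs ! t)) (h (xs ! t))) \<le> real n * a + c * B"
        by (simp add: sum.distrib sum_distrib_left)
    qed
    finally show "E (V u) (\<lambda>ys. log 2 (pmf (V u) ys / pmf Q ys)) \<le> real n * a + c * B" by simp
  qed
  finally show ?thesis by (simp add: V_def[abs_def])
qed

text \<open>A setting enters through three facts. \<open>mix\<close> turns an objective value into a
  random good policy and bounds the maxima from above, \<open>conv\<close> turns the policies of a
  code under a uniform message into an objective value and bounds them from below, and
  \<open>max\<close> provides the maxima.\<close>

theorem capacity_limit:
  fixes S :: "nat \<Rightarrow> real set"
  assumes mix: "\<And>n v. 1 \<le> n \<Longrightarrow> v \<in> S n \<Longrightarrow> \<exists>P. finite (set_pmf P) \<and>
       v = mixinfo P (\<lambda>u. out W (fst u) (snd u) n) \<and> (\<forall>u\<in>set_pmf P. good n u) \<and>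
       (\<not> cog \<longrightarrow> (\<forall>u\<in>set_pmf P. \<forall>v\<in>set_pmf P. snd u = snd v))"
    and conv: "\<And>n R f c g. 1 \<le> n \<Longrightarrow> 0 \<le> R \<Longrightarrow> c \<in> \<C> \<Longrightarrow> code R n f c g \<Longrightarrow>
       mixinfo (pmf_of_set {1..num_messages R n}) (\<lambda>m. out W (f m) (c m) n) \<in> S n"
    and max: "\<And>n. 1 \<le> n \<Longrightarrow> S n \<noteq> {} \<Longrightarrow> \<exists>s\<in>S n. \<forall>s'\<in>S n. s' \<le> s"
  shows "normalized_max_tendsto S (cap)"
proof (cases "e0 \<le> \<Gamma>")
  case False
  \<comment> \<open>If even the cheapest symbol exceeds the budget, there is neither a feasible law
    nor a code, and both sides are \<open>-\<infinity>\<close>.\<close>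
  have "S n = {}" if n: "1 \<le> n" for n
  proof (rule ccontr)
    assume "S n \<noteq> {}"
    then obtain P where P: "\<forall>u\<in>set_pmf P. good n u" using mix[OF n] by blast
    obtain u where "u \<in> set_pmf P" using set_pmf_not_empty by fast
    then have "cost_ok \<E> \<Gamma> (snd u) n" using P by (simp add: good_def)
    then have "length (replicate n x0) = n \<and> length (replicate n (undefined :: 'y)) = n \<longrightarrow>
       (\<forall>t<n. snd u (take t (replicate n x0)) (take t (replicate n (undefined :: 'y))) \<in> \<E>) \<and>
       (\<Sum>t<n. snd u (take t (replicate n x0)) (take t (replicate n (undefined :: 'y)))) \<le> real n * \<Gamma>"
      unfolding cost_ok_def by blast
    then have c: "\<forall>t<n. snd u (take t (replicate n x0)) (take t (replicate n (undefined :: 'y))) \<in> \<E>"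
      "(\<Sum>t<n. snd u (take t (replicate n x0)) (take t (replicate n (undefined :: 'y)))) \<le> real n * \<Gamma>"
      by (simp_all del: take_replicate)
    have "real n * e0 = (\<Sum>t<n. e0)" by simp
    also have "\<dots> \<le> real n * \<Gamma>" using c e0(2) by (intro order_trans[OF sum_mono c(2)]) auto
    finally show False using False n by simp
  qed
  moreover have none: "{R. ach R} = {}"
  proof -
    have False if ach: "ach R" for R
    proof -
      obtain f :: "nat \<Rightarrow> nat \<Rightarrow> real list \<Rightarrow> 'x" and c g where R: "0 \<le> R"
        and code: "\<forall>n\<ge>1. c n \<in> \<C> \<and> code R n (f n) (c n) (g n)"
        using ach unfolding achievable_def by blast
      have "1 \<in> {1..num_messages R 1}" using num_messages_bounds(1)[OF R] by simp
      then have "\<forall>xs ys. length xs = 1 \<and> length ys = 1 \<longrightarrow> (\<forall>t<1. c 1 1 (take t xs) (take t ys) \<in> \<E>) \<and>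
        (\<Sum>t<1. c 1 1 (take t xs) (take t ys)) \<le> real 1 * \<Gamma>"
        using code[rule_format, of 1] unfolding is_code_def by blast
      from this[rule_format, of "[x0]" "[undefined]"] have "c 1 1 [] [] \<in> \<E>" "c 1 1 [] [] \<le> \<Gamma>" by auto
      then show False using False e0(2)[of "c 1 1 [] []"] by simp
    qed
    then show ?thesis by auto
  qed
  moreover have "cap = -\<infinity>"
    unfolding capacity_def none by (simp add: bot_ereal_def)
  ultimately show ?thesis
    unfolding normalized_max_tendsto_def
    by (intro exI[of _ "\<lambda>_. -\<infinity>"] conjI tendsto_eventually eventually_sequentiallyI[of 1])
      (auto simp: is_maximum_def)
next
  case True
  have ne: "S n \<noteq> {}" if "1 \<le> n" for n
    using idle_code[OF True order_refl, of n] conv[OF that order_refl] by blast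
  obtain a where a: "\<And>n. 1 \<le> n \<Longrightarrow> a n \<in> S n" "\<And>n s. 1 \<le> n \<Longrightarrow> s \<in> S n \<Longrightarrow> s \<le> a n"
    using max[OF _ ne] by metis
  have C0: "0 \<le> cap" using True by (rule capacity_nonneg)
  \<comment> \<open>Achievability bounds the maxima from above: for \<open>\<Gamma> > 0\<close>
    through the block law itself, for \<open>\<Gamma> = 0\<close> through a single-letter law on
    free symbols, whose rate bounds the block maxima up to a small slack.\<close>
  have upper: "\<forall>\<^sub>F n in sequentially. a n / real n < r" if r: "cap < ereal r" for r
  proof -
    obtain c where c: "cap = ereal c" "c < r" using r C0 by (cases cap) auto
    show ?thesis
    proof (cases "0 < \<Gamma>")
      case \<Gamma>: True
      obtain L :: nat where L: "\<forall>n\<ge>1. \<forall>P R. finite (set_pmf P) \<and> (\<forall>u\<in>set_pmf P. good n u) \<and>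
        (\<not> cog \<longrightarrow> (\<forall>u\<in>set_pmf P. \<forall>v\<in>set_pmf P. snd u = snd v)) \<and> 0 \<le> R \<and>
        R * real (n + L) < mixinfo P (\<lambda>u. out W (fst u) (snd u) n) \<longrightarrow> ach R"
        using achievable_with_gap[OF True \<Gamma>] by (rule exE)
      have aL: "a n \<le> c * real (n + L)" if n: "1 \<le> n" for n
      proof -
        obtain P where P: "finite (set_pmf P)" "a n = mixinfo P (\<lambda>u. out W (fst u) (snd u) n)"
          "\<forall>u\<in>set_pmf P. good n u" "\<not> cog \<longrightarrow> (\<forall>u\<in>set_pmf P. \<forall>v\<in>set_pmf P. snd u = snd v)"
          using mix[OF n a(1)[OF n]] by (elim exE conjE)
        have "ereal (a n / real (n + L)) \<le> cap"
        proof (rule capacity_geI[OF True])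
          fix R assume R: "0 \<le> R" "R < a n / real (n + L)"
          then have "R * real (n + L) < mixinfo P (\<lambda>u. out W (fst u) (snd u) n)"
            using n unfolding P(2)[symmetric] by (simp add: pos_less_divide_eq)
          then show "ach R"
            using n R(1) P(1,3,4) by (intro L[rule_format, of n P R] conjI) blast+
        qed
        then show ?thesis using n unfolding c by (simp add: field_simps)
      qed
      have "(\<lambda>n. c * (real n + real L) / real n) \<longlonglongrightarrow> c" by real_asymp
      then have "\<forall>\<^sub>F n in sequentially. c * (real n + real L) / real n < r"
        using c(2) by (rule order_tendstoD)
      then show ?thesis using eventually_ge_at_top[of 1]
      proof eventually_elim
        case (elim n)
        have "a n / real n \<le> c * (real n + real L) / real n"
          using aL[of n] elim by (intro divide_right_mono) auto
        then show ?case using elim by linarith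
      qed
    next
      case False
      then have \<Gamma>: "\<Gamma> = 0" using \<Gamma>0 by simp
      \<comment> \<open>Chosen so that the loss \<open>- log 2 (1 - l)\<close> is half the distance
        from \<open>c\<close> to \<open>r\<close>; the other half absorbs
        \<open>k * B / n\<close>.\<close>
      define l where "l = 1 - 2 powr (- (r - c) / 2)"
      have "(2::real) powr (- (r - c) / 2) < 2 powr 0" using c(2) by (intro powr_less_mono) auto
      then have l: "0 < l" "l < 1" "- log 2 (1 - l) = (r - c) / 2" by (simp_all add: l_def diff_divide_distrib)
      obtain P q k where P: "\<forall>x\<in>set_pmf P. \<phi> x = 0"
        and q: "\<forall>x. set_pmf (W x) \<subseteq> set_pmf q" and k: "0 \<le> k"
        and D: "\<forall>x. kl (W x) q \<le> mixinfo P W - log 2 (1 - l) + k * \<phi> x"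
        using divergence_le_zero_rate[of \<phi> x0 l W, OF \<phi>0 x0 l(1,2)] by (elim exE conjE)
      have "mixinfo P W \<le> c"
        using mixinfo_zero_cost_le_capacity[OF \<Gamma> True P[rule_format]] unfolding c by simp
      then have D': "kl (W x) q \<le> (c + r) / 2 + k * \<phi> x" for x
        using D[rule_format, of x] l(3) by (simp add: field_simps)
      have an: "a n \<le> real n * ((c + r) / 2) + k * B" if n: "1 \<le> n" for n
      proof -
        obtain P where P: "finite (set_pmf P)" "a n = mixinfo P (\<lambda>u. out W (fst u) (snd u) n)"
          "\<forall>u\<in>set_pmf P. good n u" using mix[OF n a(1)[OF n]] by (elim exE conjE)
        show ?thesis
          unfolding P(2)
        proof (rule mixinfo_zero_rate_le[OF \<Gamma> P(1)])
          show "y \<in> set_pmf q" if "y \<in> set_pmf (W x)" for x y using q that by blast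
        qed (use P(3) k D' in auto)
      qed
      have "(\<lambda>n. (real n * ((c + r) / 2) + k * B) / real n) \<longlonglongrightarrow> (c + r) / 2" by real_asymp
      then have "\<forall>\<^sub>F n in sequentially. (real n * ((c + r) / 2) + k * B) / real n < r"
        by (rule order_tendstoD(2)) (use c(2) in \<open>simp add: field_simps\<close>)
      then show ?thesis using eventually_ge_at_top[of 1]
      proof eventually_elim
        case (elim n)
        have "a n / real n \<le> (real n * ((c + r) / 2) + k * B) / real n"
          using an[of n] elim by (intro divide_right_mono) auto
        then show ?case using elim by linarith
      qed
    qed
  qed
  \<comment> \<open>The converse: Fano's inequality costs one bit per block and a factor tending to
    1.\<close>
  have lower: "\<forall>\<^sub>F n in sequentially. l < ereal (a n / real n)" if l: "l < cap" for l
  proof -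
    obtain R where R: "ach R" "l < ereal R"
      using l unfolding capacity_def less_SUP_iff by blast
    then obtain f c g where R0: "0 \<le> R" and code: "\<And>n. 1 \<le> n \<Longrightarrow> c n \<in> \<C> \<and> code R n (f n) (c n) (g n)"
      and err: "(\<lambda>n. error_prob W R n (f n) (c n) (g n)) \<longlonglongrightarrow> 0"
      unfolding achievable_def by blast
    define p where "p n = error_prob W R n (f n) (c n) (g n)" for n
    have "(\<lambda>n. (1 - p n) * R - 1 / real n) \<longlonglongrightarrow> (1 - 0) * R - 0"
      using err unfolding p_def by (intro tendsto_intros) (auto intro: lim_1_over_n)
    then have "(\<lambda>n. ereal ((1 - p n) * R - 1 / real n)) \<longlonglongrightarrow> ereal R" by simp
    then have "\<forall>\<^sub>F n in sequentially. l < ereal ((1 - p n) * R - 1 / real n)"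
      using R(2) by (rule order_tendstoD)
    then show ?thesis using eventually_ge_at_top[of 1]
    proof eventually_elim
      case (elim n)
      let ?M = "num_messages R n"
      note M = num_messages_bounds[OF R0, where n = n]
      have p: "p n = (\<Sum>m\<in>{1..?M}. pr (out W (f n m) (c n m) n) {y. g n y \<noteq> m}) / real ?M"
        unfolding p_def error_prob_def transmission_eq_run out_def by (simp add: vimage_def case_prod_unfold)
      have "(\<Sum>m\<in>{1..?M}. pr (out W (f n m) (c n m) n) {y. g n y \<noteq> m}) \<le> (\<Sum>m\<in>{1..?M}. 1)"
        by (intro sum_mono) simp
      then have p1: "p n \<le> 1" using M(1) unfolding p by (simp add: field_simps)
      have "(1 - p n) * (real n * R) \<le> (1 - p n) * log 2 (real ?M)"
        using M(3) p1 by (intro mult_left_mono) auto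
      also have "\<dots> \<le> mixinfo (pmf_of_set {1..?M}) (\<lambda>m. out W (f n m) (c n m) n) + 1"
        unfolding p by (rule fano[OF finite_out M(1)])
      also have "\<dots> \<le> a n + 1"
        using code[of n] elim R0 by (intro add_right_mono a(2) conv[of n R "c n" "f n" "g n"]) auto
      finally have "((1 - p n) * (real n * R) - 1) / real n \<le> a n / real n"
        by (intro divide_right_mono) auto
      moreover have "((1 - p n) * (real n * R) - 1) / real n = (1 - p n) * R - 1 / real n"
        using elim(2) by (simp add: diff_divide_distrib)
      ultimately have "(1 - p n) * R - 1 / real n \<le> a n / real n" by simp
      then show ?case using elim(1) by (meson ereal_less_eq(3) less_le_trans)
    qed
  qed
  have "(\<lambda>n. ereal (a n / real n)) \<longlonglongrightarrow> cap"
  proof (rule order_tendstoI)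
    fix u assume "cap < u"
    then obtain r where r: "cap < ereal r" "ereal r < u" using ereal_dense2 by blast
    show "\<forall>\<^sub>F n in sequentially. ereal (a n / real n) < u"
      using upper[OF r(1)] by eventually_elim (meson r(2) ereal_less_eq less_trans less_ereal.simps(1))
  qed (rule lower)
  then have "(\<lambda>n. ereal (a n) / ereal (real n)) \<longlonglongrightarrow> cap"
    by (rule Lim_transform_eventually) (rule eventually_sequentiallyI[of 1], simp)
  then show ?thesis
    unfolding normalized_max_tendsto_def
    using a ne by (intro exI[of _ "\<lambda>n. ereal (a n)"]) (auto simp: is_maximum_def)
qed

end

section \<open>Chargers that do not see the channel outputs\<close>

lemma memoryless_snoc:
  "memoryless W (xs @ [x]) = bind_pmf (memoryless W xs) (\<lambda>ys. map_pmf (\<lambda>y. ys @ [y]) (W x))"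
  by (induction xs) (simp_all add: bind_return_pmf bind_assoc_pmf bind_map_pmf map_pmf_def)

lemma run_open_loop:
  assumes len: "length X = n" "length Es = n"
    and g: "\<And>t. t < n \<Longrightarrow> g (take (Suc t) Es) = X ! t"
    and d: "\<And>t ys. t < n \<Longrightarrow> length ys = t \<Longrightarrow> d (take t X) ys = Es ! t"
  shows "run W g d n = map_pmf (\<lambda>ys. (X, ys, Es)) (memoryless W X)"
proof -
  have "run W g d k = map_pmf (\<lambda>ys. (take k X, ys, take k Es)) (memoryless W (take k X))" if "k \<le> n" for k
    using that
  proof (induction k)
    case (Suc k)
    then have k: "k < n" by simp
    have X: "take (Suc k) X = take k X @ [X ! k]" and Es: "take (Suc k) Es = take k Es @ [Es ! k]"
      using k len by (simp_all add: take_Suc_conv_app_nth)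
    have IH: "run W g d k = map_pmf (\<lambda>ys. (take k X, ys, take k Es)) (memoryless W (take k X))"
      using Suc by simp
    show ?case
      unfolding run_Suc IH bind_map_pmf X Es memoryless_snoc map_bind_pmf
    proof (intro bind_pmf_cong refl)
      fix ys assume "ys \<in> set_pmf (memoryless W (take k X))"
      then have ys: "length ys = k" using length_memoryless[of ys W "take k X"] k len by simp
      show "(case (take k X, ys, take k Es) of (xs, ys, es) \<Rightarrow>
          map_pmf (\<lambda>y. (xs @ [g (es @ [d xs ys])], ys @ [y], es @ [d xs ys])) (W (g (es @ [d xs ys])))) =
         map_pmf (\<lambda>ys. (take k X @ [X ! k], ys, take k Es @ [Es ! k])) (map_pmf (\<lambda>y. ys @ [y]) (W (X ! k)))"
        using g[OF k] by (simp add: d[OF k ys] Es map_pmf_comp)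
    qed
  qed (simp add: run_0)
  from this[of n] len show ?thesis by simp
qed

lemma out_open_loop:
  assumes "length X = n" "length Es = n"
    and "\<And>t. t < n \<Longrightarrow> g (take (Suc t) Es) = X ! t"
    and "\<And>t ys. t < n \<Longrightarrow> length ys = t \<Longrightarrow> d (take t X) ys = Es ! t"
  shows "out W g d n = memoryless W X"
proof -
  have "run W g d n = map_pmf (\<lambda>ys. (X, ys, Es)) (memoryless W X)"
    by (rule run_open_loop[OF assms])
  then show ?thesis by (simp add: out_def map_pmf_comp)
qed

text \<open>Inputs depend on charges and charges on inputs, so both sequences are built together,
  one step at a time; outputs matter only through their length.\<close>

lemma open_loop_exists:
  assumes d: "\<And>xs ys ys'. length ys = length ys' \<Longrightarrow> d xs ys = d xs ys'"
  shows "\<exists>X Es. length X = n \<and> length Es = n \<and> (\<forall>t<n. g (take (Suc t) Es) = X ! t) \<and>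
     (\<forall>t<n. \<forall>ys. length ys = t \<longrightarrow> d (take t X) ys = Es ! t)"
proof (induction n)
  case (Suc n)
  then obtain X Es where *: "length X = n" "length Es = n" "\<forall>t<n. g (take (Suc t) Es) = X ! t"
    "\<forall>t<n. \<forall>ys. length ys = t \<longrightarrow> d (take t X) ys = Es ! t" by blast
  define e where "e = d X (replicate n undefined)"
  have e: "d X ys = e" if "length ys = n" for ys unfolding e_def using that by (intro d) simp
  define x where "x = g (Es @ [e])"
  have "\<forall>t<Suc n. g (take (Suc t) (Es @ [e])) = (X @ [x]) ! t"
    using * by (auto simp: less_Suc_eq nth_append x_def)
  moreover have "\<forall>t<Suc n. \<forall>ys. length ys = t \<longrightarrow> d (take t (X @ [x])) ys = (Es @ [e]) ! t"
    using * by (auto simp: less_Suc_eq nth_append e)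
  ultimately show ?case using * by (intro exI[of _ "X @ [x]"] exI[of _ "Es @ [e]"]) simp
qed simp

lemma mutual_info_eq_expectation:
  fixes p :: "'w pmf" and X :: "'w \<Rightarrow> 'a::countable" and Y :: "'w \<Rightarrow> 'b::countable"
  assumes "finite (set_pmf p)"
  shows "mutual_info p X Y = E p (\<lambda>w. log 2 (pmf (map_pmf (\<lambda>w. (X w, Y w)) p) (X w, Y w) /
     (pmf (map_pmf X p) (X w) * pmf (map_pmf Y p) (Y w))))"
proof -
  let ?q = "map_pmf (\<lambda>w. (X w, Y w)) p"
  have fin: "finite (set_pmf ?q)" using assms by simp
  have "mutual_info p X Y = E ?q (\<lambda>(x, y). log 2 (pmf ?q (x, y) / (pmf (map_pmf X p) x * pmf (map_pmf Y p) y)))"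
    unfolding mutual_info_eq_sum[OF fin] expectation_finite[OF fin order_refl] by (intro sum.cong) auto
  then show ?thesis by simp
qed

lemma mutual_info_channel_joint:
  fixes W :: "'x::finite \<Rightarrow> 'y::finite pmf"
  assumes fp: "finite (set_pmf p)"
  shows "mutual_info (channel_joint W p) fst snd = mixinfo p (memoryless W)"
proof -
  let ?J = "channel_joint W p"
  have J: "?J = bind_pmf p (\<lambda>xs. map_pmf (Pair xs) (memoryless W xs))"
    by (simp add: channel_joint_def map_pmf_def)
  have fm: "finite (set_pmf (memoryless W xs))" for xs by (rule finite_set_memoryless) simp
  have fJ: "finite (set_pmf ?J)" using fp fm by (simp add: J)
  have pJ: "pmf ?J (xs, ys) = pmf p xs * pmf (memoryless W xs) ys" for xs ys
    unfolding J by (subst pmf_bind_single[of _ xs]) (auto simp: pmf_map_inj' inj_on_def)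
  have fst: "map_pmf fst ?J = p" by (simp add: J map_bind_pmf map_pmf_comp bind_return_pmf')
  have snd: "map_pmf snd ?J = bind_pmf p (memoryless W)" by (simp add: J map_bind_pmf map_pmf_comp)
  have EJ: "E ?J h = E p (\<lambda>xs. E (memoryless W xs) (\<lambda>ys. h (xs, ys)))" for h :: "_ \<Rightarrow> real"
    unfolding J using fm by (subst expectation_bind[OF fp]) auto
  have "mutual_info ?J fst snd = E ?J (\<lambda>w. log 2 (pmf ?J w / (pmf p (fst w) * pmf (bind_pmf p (memoryless W)) (snd w))))"
    by (simp add: mutual_info_eq_expectation[OF fJ] fst snd)
  also have "\<dots> = E p (\<lambda>xs. E (memoryless W xs) (\<lambda>ys. log 2 (pmf ?J (xs, ys) / (pmf p xs * pmf (bind_pmf p (memoryless W)) ys))))"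
    unfolding EJ by simp
  also have "\<dots> = mixinfo p (memoryless W)"
    unfolding mixinfo_def by (intro expectation_cong) (simp add: pJ set_pmf_iff)
  finally show ?thesis .
qed

text \<open>Outside the sequences that respect the budget, the modified charger falls back to the cheapest symbol.\<close>

lemma budget_charger:
  fixes e :: "'z list \<Rightarrow> real"
  assumes e: "range e \<subseteq> \<E>" and e0: "e0 \<in> \<E>" "\<And>x. x \<in> \<E> \<Longrightarrow> e0 \<le> x" "e0 \<le> \<Gamma>"
  obtains e' where "range e' \<subseteq> \<E>"
    "\<And>z. length z = n \<Longrightarrow> (\<Sum>t<n. e' (take t z)) \<le> real n * \<Gamma>"
    "\<And>z t. length z = n \<Longrightarrow> (\<Sum>t<n. e (take t z)) \<le> real n * \<Gamma> \<Longrightarrow> e' (take t z) = e (take t z)"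
proof -
  define Z where "Z = {z. length z = n \<and> (\<Sum>t<n. e (take t z)) \<le> real n * \<Gamma>}"
  define e' where "e' p = (if \<exists>z\<in>Z. \<exists>t. p = take t z then e p else e0)" for p
  have eE: "e p \<in> \<E>" for p using e by auto
  show ?thesis
  proof (rule that[of e'])
    show "range e' \<subseteq> \<E>" using eE e0(1) by (auto simp: e'_def)
    show "e' (take t z) = e (take t z)" if "length z = n" "(\<Sum>t<n. e (take t z)) \<le> real n * \<Gamma>" for z t
      using that by (auto simp: e'_def Z_def)
    show "(\<Sum>t<n. e' (take t z)) \<le> real n * \<Gamma>" if z: "length z = n" for z
    proof -
      \<comment> \<open>Times at which \<open>z\<close> still runs along a sequence within the
        budget. Up to the last of them, \<open>k\<close>, the charges are at most those of such a
        sequence \<open>z'\<close>; later ones are the cheapest possible, so the total does not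
        exceed that of \<open>z'\<close>.\<close>
      define T where "T = {t. t \<le> n \<and> (\<exists>z'\<in>Z. \<exists>s. take t z = take s z')}"
      show ?thesis
      proof (cases "T = {}")
        case True
        then have "e' (take t z) = e0" if "t < n" for t
          using that by (force simp: T_def e'_def)
        then show ?thesis using e0(3) by (simp add: mult_left_mono)
      next
        case False
        have fT: "finite T" by (rule finite_subset[of _ "{..n}"]) (auto simp: T_def)
        define k where "k = Max T"
        have "k \<in> T" using fT False by (simp add: k_def)
        then obtain z' s where z': "z' \<in> Z" "take k z = take s z'" "k \<le> n" by (auto simp: T_def)
        have lz': "length z' = n" using z' by (simp add: Z_def)
        have pre: "take t z = take t z'" if "t \<le> k" for t
        proof -
          have "length (take k z) = length (take s z')" using z'(2) by simp
          then have "k = min n s" using z z'(3) lz' by simp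
          then have "t \<le> s" using that by simp
          have "take t z = take t (take k z)" using that by (simp add: min_absorb1)
          also have "\<dots> = take t z'" using \<open>t \<le> s\<close> by (simp add: z'(2) min_absorb1)
          finally show ?thesis .
        qed
        have "e' (take t z) \<le> e (take t z')" if t: "t < n" for t
        proof (cases "t \<le> k")
          case True
          then show ?thesis using z'(1) e0(2)[OF eE] by (auto simp: e'_def pre)
        next
          case False
          have "t \<notin> T" using Max_ge[OF fT, of t] False by (auto simp: k_def)
          then have "e' (take t z) = e0" using t by (auto simp: T_def e'_def)
          then show ?thesis using e0(2)[OF eE] by simp
        qed
        then have "(\<Sum>t<n. e' (take t z)) \<le> (\<Sum>t<n. e (take t z'))" by (intro sum_mono) auto
        then show ?thesis using z'(1) by (auto simp: Z_def)
      qed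
    qed
  qed
qed

lemma finite_lists_of_length: "finite {xs :: 'a::finite list. length xs = n}"
  using finite_lists_length_eq[of "UNIV :: 'a set" n] by simp

text \<open>A charger matters only through the set \<open>F\<close> of input sequences that it makes
  feasible. There are finitely many such sets even where there are infinitely many chargers, so the
  sets themselves serve as indices.\<close>

lemma channel_values_have_maximum:
  fixes W :: "'x::finite \<Rightarrow> 'y::finite pmf"
  assumes S: "S = {mutual_info (channel_joint W p) fst snd | p F. F \<in> I \<and> set_pmf p \<subseteq> F}"
    and I: "\<And>F. F \<in> I \<Longrightarrow> F \<subseteq> {xs. length xs = n}" and ne: "S \<noteq> {}"
  shows "\<exists>s\<in>S. \<forall>s'\<in>S. s' \<le> s"
proof (rule mixinfo_set_has_maximum[OF _ _ _ _ ne, of I "\<lambda>F. F" "\<lambda>_. memoryless W"])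
  have fin: "finite F" if "F \<in> I" for F using finite_subset[OF I[OF that]] finite_lists_of_length by blast
  have "I \<subseteq> Pow {xs. length xs = n}" using I by blast
  then show "finite I" by (rule finite_subset) (simp add: finite_lists_of_length)
  show "finite F" if "F \<in> I" for F using fin[OF that] .
  show "finite (set_pmf (memoryless W xs))" for xs by (rule finite_set_memoryless) simp
  have "mutual_info (channel_joint W p) fst snd = mixinfo p (memoryless W)" if "F \<in> I" "set_pmf p \<subseteq> F" for p F
    using that fin by (intro mutual_info_channel_joint) (auto intro: finite_subset)
  then show "S = {mixinfo p (memoryless W) | p F. F \<in> I \<and> set_pmf p \<subseteq> F}"
    unfolding S by (intro Collect_cong) metis
qed

lemma energy_seq_nth: "t < n \<Longrightarrow> energy_seq e n zs ! t = e (take t zs)"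
  by (simp add: energy_seq_def)

lemma length_energy_seq [simp]: "length (energy_seq e n zs) = n"
  by (simp add: energy_seq_def)

text \<open>The transmitter uses the charges only as a clock; the list includes the current charge,
  hence \<open>- 1\<close>.\<close>

definition input_policy :: "'x list \<Rightarrow> real list \<Rightarrow> 'x" where
  "input_policy xs es = xs ! (length es - 1)"

definition time_chargers :: "('x list \<Rightarrow> 'y list \<Rightarrow> real) set" where
  "time_chargers = {d. \<exists>e :: nat \<Rightarrow> real. d = (\<lambda>xs ys. e (length ys))}"

lemma time_chargers_then:
  assumes "a \<in> time_chargers" "b \<in> time_chargers"
  shows "then_d (\<lambda>xs ys. length ys) K a b \<in> time_chargers"
proof -
  obtain ea eb where "a = (\<lambda>xs ys. ea (length ys))" "b = (\<lambda>xs ys. eb (length ys))"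
    using assms by (auto simp: time_chargers_def)
  then have "then_d (\<lambda>xs ys. length ys) K a b = (\<lambda>xs ys. (\<lambda>t. if t < K then ea t else eb (t - K)) (length ys))"
    by (simp add: then_d_def fun_eq_iff)
  then show ?thesis
    unfolding time_chargers_def
    by (intro CollectI exI[of _ "\<lambda>t. if t < K then ea t else eb (t - K)"]) simp
qed

lemma set_pmf_messages: "0 \<le> R \<Longrightarrow> set_pmf (pmf_of_set {1..num_messages R n}) = {1..num_messages R n}"
  using num_messages_bounds(1)[of R n] by (intro set_pmf_of_set) auto

context remote_power
begin

lemma admissibleD:
  assumes "(xs, es) \<in> adm n"
  shows "length xs = n" "length es = n" "set es \<subseteq> \<E>" "feas \<phi> B B xs es" "(\<Sum>t<n. es ! t) \<le> real n * \<Gamma>"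
  using assms by (auto simp: admissible_def energy_feasible_iff_feas)

lemma admissible_e0_le:
  assumes "(xs, es) \<in> adm n" "1 \<le> n"
  shows "e0 \<le> \<Gamma>"
proof -
  note * = admissibleD[OF assms(1)]
  have "real n * e0 = (\<Sum>t<n. e0)" by simp
  also have "\<dots> \<le> (\<Sum>t<n. es ! t)" using *(2,3) by (intro sum_mono e0(2)) (auto dest!: nth_mem)
  also have "\<dots> \<le> real n * \<Gamma>" by (rule *(5))
  finally show ?thesis using assms(2) by simp
qed

lemma code_open_loop:
  fixes c :: "('x, 'y) charger"
  assumes code: "code R n f c g" and m: "m \<in> {1..num_messages R n}"
    and d: "\<And>xs ys ys'. length ys = length ys' \<Longrightarrow> c m xs ys = c m xs ys'"
  shows "\<exists>X Es. (X, Es) \<in> adm n \<and> out W (f m) (c m) n = memoryless W X \<and>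
     (\<forall>t<n. \<forall>ys. length ys = t \<longrightarrow> c m (take t X) ys = Es ! t)"
proof -
  obtain X Es where *: "length X = n" "length Es = n" "\<forall>t<n. f m (take (Suc t) Es) = X ! t"
    "\<forall>t<n. \<forall>ys. length ys = t \<longrightarrow> c m (take t X) ys = Es ! t"
    using open_loop_exists[of "c m" n "f m"] d by blast
  have "length (replicate n (undefined :: 'y)) = n" by simp
  then have c: "\<forall>t<n. c m (take t X) (take t (replicate n undefined)) \<in> \<E>"
    "(\<Sum>t<n. c m (take t X) (take t (replicate n undefined))) \<le> real n * \<Gamma>"
    using code m *(1) unfolding is_code_def by blast+
  have c': "c m (take t X) (take t (replicate n undefined)) = Es ! t" if "t < n" for t
    using *(4) that by simp
  have Es: "set Es \<subseteq> \<E>"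
  proof
    fix x assume "x \<in> set Es"
    then obtain t where "t < n" "x = Es ! t" using *(2) by (auto simp: in_set_conv_nth)
    then show "x \<in> \<E>" using c(1) c' by metis
  qed
  have "energy_feasible \<phi> B n (map (\<lambda>t. f m (take (Suc t) Es)) [0..<n]) Es"
    using code m Es *(2) unfolding is_code_def by blast
  moreover have "map (\<lambda>t. f m (take (Suc t) Es)) [0..<n] = X"
    using * by (intro nth_equalityI) auto
  moreover have "(\<Sum>t<n. Es ! t) \<le> real n * \<Gamma>" using c(2) c' by simp
  ultimately have "(X, Es) \<in> adm n" using * Es by (simp add: admissible_def)
  moreover have "out W (f m) (c m) n = memoryless W X"
    using * by (intro out_open_loop[of X n Es]) auto
  ultimately show ?thesis using *(4) by blast
qed

text \<open>If the charger ignores the outputs, a message determines its input and charging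
  sequences, so a code induces a law on input sequences. A list of \<open>undefined\<close> stands
  for an arbitrary output history of the right length.\<close>

lemma open_loop_code:
  assumes code: "code R n f c g" and R: "0 \<le> R"
    and d: "\<forall>m xs ys ys'. length ys = length ys' \<longrightarrow> c m xs ys = c m xs ys'"
  defines "M \<equiv> {1..num_messages R n}"
  shows "\<exists>X Es. (\<forall>m\<in>M. (X m, Es m) \<in> adm n) \<and>
    (\<forall>m\<in>M. \<forall>t<n. c m (take t (X m)) (replicate t undefined) = Es m ! t) \<and>
    mixinfo (pmf_of_set M) (\<lambda>m. out W (f m) (c m) n) =
      mutual_info (channel_joint W (map_pmf X (pmf_of_set M))) fst snd"
proof -
  have "\<exists>X Es. (X, Es) \<in> adm n \<and> out W (f m) (c m) n = memoryless W X \<and>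
     (\<forall>t<n. \<forall>ys. length ys = t \<longrightarrow> c m (take t X) ys = Es ! t)" if "m \<in> M" for m
    using code_open_loop[OF code that[unfolded M_def]] d by blast
  then obtain X Es where X: "\<And>m. m \<in> M \<Longrightarrow> (X m, Es m) \<in> adm n \<and>
     out W (f m) (c m) n = memoryless W (X m) \<and> (\<forall>t<n. \<forall>ys. length ys = t \<longrightarrow> c m (take t (X m)) ys = Es m ! t)"
    by metis
  have sM: "set_pmf (pmf_of_set M) = M" unfolding M_def by (rule set_pmf_messages[OF R])
  have "mixinfo (pmf_of_set M) (\<lambda>m. out W (f m) (c m) n) = mixinfo (map_pmf X (pmf_of_set M)) (memoryless W)"
    unfolding mixinfo_map by (rule mixinfo_cong) (simp only: sM X)
  also have "\<dots> = mutual_info (channel_joint W (map_pmf X (pmf_of_set M))) fst snd"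
    by (rule mutual_info_channel_joint[symmetric]) (simp only: set_map_pmf sM, simp add: M_def)
  finally show ?thesis using X by (intro exI[of _ X] exI[of _ Es]) auto
qed

lemma input_policy:
  assumes "(xs, es) \<in> adm n"
    and d: "\<And>t ys. t < n \<Longrightarrow> length ys = t \<Longrightarrow> d (take t xs) ys = es ! t"
  shows "out W (input_policy xs) d n = memoryless W xs"
    and "\<forall>(xs, ys, es)\<in>set_pmf (run W (input_policy xs) d n). feas \<phi> B B xs es"
proof -
  note * = admissibleD[OF assms(1)]
  have g: "input_policy xs (take (Suc t) es) = xs ! t" if "t < n" for t
    using that *(2) by (simp add: input_policy_def min_absorb2)
  show "out W (input_policy xs) d n = memoryless W xs"
    using out_open_loop[of xs n es "input_policy xs" d W] * g d by blast
  have "run W (input_policy xs) d n = map_pmf (\<lambda>ys. (xs, ys, es)) (memoryless W xs)"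
    using run_open_loop[of xs n es "input_policy xs" d W] * g d by blast
  then show "\<forall>(xs, ys, es)\<in>set_pmf (run W (input_policy xs) d n). feas \<phi> B B xs es"
    using *(4) by auto
qed

interpretation generic: charger_class W \<phi> B \<E> x0 \<Gamma> e0 time_chargers "\<lambda>xs ys. length ys" False generic_chargers
proof
  show "then_d (\<lambda>xs ys. length ys) K a b \<in> time_chargers"
    if "a \<in> time_chargers" "b \<in> time_chargers" for a b K using that by (rule time_chargers_then)
  show "D \<in> generic_chargers" if D: "\<And>m. D m \<in> time_chargers" "\<And>m m'. \<not> False \<Longrightarrow> D m = D m'" for D
  proof -
    obtain e where "D 0 = (\<lambda>xs ys. e (length ys))" using D(1)[of 0] by (auto simp: time_chargers_def)
    then have "D = (\<lambda>m xs ys. e (length ys))" using D(2) by (metis (full_types))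
    then show ?thesis by (auto simp: generic_chargers_def)
  qed
qed (auto simp: is_clock_def time_chargers_def)

interpretation cognitive: charger_class W \<phi> B \<E> x0 \<Gamma> e0 time_chargers "\<lambda>xs ys. length ys" True cognitive_chargers
proof
  show "then_d (\<lambda>xs ys. length ys) K a b \<in> time_chargers"
    if "a \<in> time_chargers" "b \<in> time_chargers" for a b K using that by (rule time_chargers_then)
  show "D \<in> cognitive_chargers" if D: "\<And>m. D m \<in> time_chargers" for D
  proof -
    have "\<forall>m. \<exists>e. D m = (\<lambda>xs ys. e (length ys))" using D by (auto simp: time_chargers_def)
    then obtain e where "\<And>m. D m = (\<lambda>xs ys. e m (length ys))" by metis
    then show ?thesis by (auto simp: cognitive_chargers_def fun_eq_iff)
  qed
qed (auto simp: is_clock_def time_chargers_def)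

interpretation adjacent: charger_class W \<phi> B \<E> x0 \<Gamma> e0
  "{d. \<exists>e :: 'x list \<Rightarrow> real. d = (\<lambda>(xs :: 'x list) (ys :: 'y list). e xs)}" "\<lambda>xs ys. length xs" False adjacent_chargers
proof
  show "then_d (\<lambda>xs ys. length xs) K a b \<in> {d. \<exists>e. d = (\<lambda>xs ys. e xs)}"
    if ab: "a \<in> {d. \<exists>e. d = (\<lambda>xs ys. e xs)}" "b \<in> {d. \<exists>e. d = (\<lambda>xs ys. e xs)}"
    for a b :: "'x list \<Rightarrow> 'y list \<Rightarrow> real" and K
  proof -
    obtain ea eb where "a = (\<lambda>xs ys. ea xs)" "b = (\<lambda>xs ys. eb xs)" using ab by auto
    then have "then_d (\<lambda>xs ys. length xs) K a b = (\<lambda>xs ys. (\<lambda>zs. if length zs < K then ea zs else eb (drop K zs)) xs)"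
      by (simp add: then_d_def fun_eq_iff)
    then show ?thesis
      by (intro CollectI exI[of _ "\<lambda>zs. if length zs < K then ea zs else eb (drop K zs)"]) simp
  qed
  show "D \<in> adjacent_chargers"
    if D: "\<And>m. D m \<in> {d. \<exists>e. d = (\<lambda>xs ys. e xs)}" "\<And>m m'. \<not> False \<Longrightarrow> D m = D m'" for D
  proof -
    obtain e where "D 0 = (\<lambda>xs ys. e xs)" using D(1)[of 0] by auto
    then have "D = (\<lambda>m xs ys. e xs)" using D(2) by (metis (full_types))
    then show ?thesis by (auto simp: adjacent_chargers_def)
  qed
qed (auto simp: is_clock_def)

lemma admissible_finite: "finite {xs. \<exists>es. (xs, es) \<in> adm n}"
  by (rule finite_subset[OF _ finite_lists_of_length[of n]]) (auto dest: admissibleD)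

lemma time_charger_good:
  assumes "(xs, es) \<in> adm n"
  shows "generic.good n (input_policy xs, \<lambda>xs ys. es ! length ys)"
    and "cognitive.good n (input_policy xs, \<lambda>xs ys. es ! length ys)"
proof -
  have "es ! t \<in> \<E>" if "t < n" for t using admissibleD(2,3)[OF assms] that by (auto dest!: nth_mem)
  then have "cost_ok \<E> \<Gamma> (\<lambda>(xs :: 'x list) (ys :: 'y list). es ! length ys) n"
    using admissibleD[OF assms] by (auto simp: cost_ok_def min_absorb1)
  moreover have "(\<lambda>(xs :: 'x list) (ys :: 'y list). es ! length ys) \<in> time_chargers"
    unfolding time_chargers_def by (intro CollectI exI[of _ "\<lambda>t. es ! t"]) simp
  ultimately show "generic.good n (input_policy xs, \<lambda>xs ys. es ! length ys)"
    "cognitive.good n (input_policy xs, \<lambda>xs ys. es ! length ys)"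
    unfolding generic.good_def cognitive.good_def
    using input_policy(2)[OF assms, of "\<lambda>xs ys. es ! length ys"] by auto
qed

lemma generic_limit:
  "normalized_max_tendsto (generic_values W \<phi> B \<E> \<Gamma>) (capacity W \<phi> B \<E> \<Gamma> generic_chargers)"
proof (rule generic.capacity_limit)
  fix n v assume "v \<in> generic_values W \<phi> B \<E> \<Gamma> n"
  then obtain p es where v: "v = mutual_info (channel_joint W p) fst snd"
    and adm: "\<And>xs. xs \<in> set_pmf p \<Longrightarrow> (xs, es) \<in> adm n"
    by (auto simp: generic_values_def)
  have fp: "finite (set_pmf p)" by (rule finite_subset[OF _ admissible_finite[of n]]) (use adm in auto)
  define pol :: "'x list \<Rightarrow> ('x, 'y) policy" where "pol xs = (input_policy xs, \<lambda>xs ys. es ! length ys)" for xs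
  have "v = mixinfo (map_pmf pol p) (\<lambda>u. out W (fst u) (snd u) n)"
    unfolding v mutual_info_channel_joint[OF fp] mixinfo_map
    by (rule mixinfo_cong) (simp add: pol_def input_policy(1)[OF adm])
  then show "\<exists>P. finite (set_pmf P) \<and> v = mixinfo P (\<lambda>u. out W (fst u) (snd u) n) \<and>
      (\<forall>u\<in>set_pmf P. generic.good n u) \<and> (\<not> False \<longrightarrow> (\<forall>u\<in>set_pmf P. \<forall>v\<in>set_pmf P. snd u = snd v))"
    using fp time_charger_good(1)[OF adm]
    by (intro exI[of _ "map_pmf pol p"]) (auto simp: pol_def)
next
  fix n R f g and c :: "('x, 'y) charger"
  assume R: "0 \<le> R" and c: "c \<in> generic_chargers" and code: "code R n f c g"
  obtain e where e: "c = (\<lambda>m xs ys. e (length ys))" using c by (auto simp: generic_chargers_def)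
  let ?M = "{1..num_messages R n}"
  obtain X Es where X: "\<forall>m\<in>?M. (X m, Es m) \<in> adm n"
    and c: "\<forall>m\<in>?M. \<forall>t<n. c m (take t (X m)) (replicate t undefined) = Es m ! t"
    and I: "mixinfo (pmf_of_set ?M) (\<lambda>m. out W (f m) (c m) n) = mutual_info (channel_joint W (map_pmf X (pmf_of_set ?M))) fst snd"
    using open_loop_code[OF code R] unfolding e by auto
  have "Es m = map e [0..<n]" if m: "m \<in> ?M" for m
    using admissibleD(2)[OF X[rule_format, OF m]] c m by (intro nth_equalityI) (simp_all add: e)
  then have "\<forall>xs\<in>set_pmf (map_pmf X (pmf_of_set ?M)). (xs, map e [0..<n]) \<in> adm n"
    using X unfolding set_map_pmf set_pmf_messages[OF R] by fastforce
  then show "mixinfo (pmf_of_set ?M) (\<lambda>m. out W (f m) (c m) n) \<in> generic_values W \<phi> B \<E> \<Gamma> n"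
    unfolding generic_values_def I by blast
next
  fix n assume ne: "generic_values W \<phi> B \<E> \<Gamma> n \<noteq> {}"
  let ?I = "range (\<lambda>es. {xs. (xs, es) \<in> adm n})"
  have "generic_values W \<phi> B \<E> \<Gamma> n = {mutual_info (channel_joint W p) fst snd | p F. F \<in> ?I \<and> set_pmf p \<subseteq> F}"
    unfolding generic_values_def subset_iff by blast
  from channel_values_have_maximum[OF this _ ne, of n]
  show "\<exists>s\<in>generic_values W \<phi> B \<E> \<Gamma> n. \<forall>s'\<in>generic_values W \<phi> B \<E> \<Gamma> n. s' \<le> s"
    by (auto dest: admissibleD)
qed

lemma cognitive_limit:
  "normalized_max_tendsto (cognitive_values W \<phi> B \<E> \<Gamma>) (capacity W \<phi> B \<E> \<Gamma> cognitive_chargers)"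
proof (rule cognitive.capacity_limit)
  fix n v assume "v \<in> cognitive_values W \<phi> B \<E> \<Gamma> n"
  then obtain p where v: "v = mutual_info (channel_joint W (map_pmf fst p)) fst snd"
    and adm: "\<And>xs es. (xs, es) \<in> set_pmf p \<Longrightarrow> (xs, es) \<in> adm n"
    by (auto simp: cognitive_values_def)
  have fp1: "finite (set_pmf (map_pmf fst p))"
    by (rule finite_subset[OF _ admissible_finite[of n]]) (use adm in fastforce)
  have "set_pmf p \<subseteq> {xs. length xs = n} \<times> {es. set es \<subseteq> \<E> \<and> length es = n}"
    using adm by (auto dest: admissibleD)
  then have fp: "finite (set_pmf p)"
    by (rule finite_subset) (intro finite_cartesian_product finite_lists_of_length finite_lists_length_eq \<E>_finite)
  define pol :: "'x list \<times> real list \<Rightarrow> ('x, 'y) policy" where "pol = (\<lambda>(xs, es). (input_policy xs, \<lambda>xs ys. es ! length ys))"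
  have "v = mixinfo (map_pmf pol p) (\<lambda>u. out W (fst u) (snd u) n)"
    unfolding v mutual_info_channel_joint[OF fp1] mixinfo_map
    by (rule mixinfo_cong) (auto simp: pol_def input_policy(1)[OF adm])
  then show "\<exists>P. finite (set_pmf P) \<and> v = mixinfo P (\<lambda>u. out W (fst u) (snd u) n) \<and>
      (\<forall>u\<in>set_pmf P. cognitive.good n u) \<and> (\<not> True \<longrightarrow> (\<forall>u\<in>set_pmf P. \<forall>v\<in>set_pmf P. snd u = snd v))"
    using fp time_charger_good(2)[OF adm]
    by (intro exI[of _ "map_pmf pol p"]) (auto simp: pol_def)
next
  fix n R f g and c :: "('x, 'y) charger"
  assume R: "0 \<le> R" and c: "c \<in> cognitive_chargers" and code: "code R n f c g"
  obtain e where e: "c = (\<lambda>m xs ys. e m (length ys))" using c by (auto simp: cognitive_chargers_def)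
  let ?M = "{1..num_messages R n}"
  obtain X Es where X: "\<forall>m\<in>?M. (X m, Es m) \<in> adm n"
    and I: "mixinfo (pmf_of_set ?M) (\<lambda>m. out W (f m) (c m) n) = mutual_info (channel_joint W (map_pmf X (pmf_of_set ?M))) fst snd"
    using open_loop_code[OF code R] unfolding e by auto
  define p where "p = map_pmf (\<lambda>m. (X m, Es m)) (pmf_of_set ?M)"
  have "set_pmf p \<subseteq> adm n" using X unfolding p_def set_map_pmf set_pmf_messages[OF R] by blast
  moreover have "map_pmf X (pmf_of_set ?M) = map_pmf fst p" by (simp add: p_def map_pmf_comp)
  ultimately show "mixinfo (pmf_of_set ?M) (\<lambda>m. out W (f m) (c m) n) \<in> cognitive_values W \<phi> B \<E> \<Gamma> n"
    unfolding cognitive_values_def I by auto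
next
  fix n assume ne: "cognitive_values W \<phi> B \<E> \<Gamma> n \<noteq> {}"
  let ?F = "{xs. \<exists>es. (xs, es) \<in> adm n}"
  \<comment> \<open>Only the input marginal enters the objective, so one feasible charging sequence
    chosen for each input sequence suffices, and a single feasible set remains.\<close>
  have "\<exists>p'. p = map_pmf fst p' \<and> set_pmf p' \<subseteq> adm n" if "set_pmf p \<subseteq> ?F" for p :: "'x list pmf"
  proof -
    have "\<forall>xs\<in>set_pmf p. \<exists>es. (xs, es) \<in> adm n" using that by blast
    from bchoice[OF this] obtain es where es: "\<forall>xs\<in>set_pmf p. (xs, es xs) \<in> adm n" ..
    show ?thesis
      using es by (intro exI[of _ "map_pmf (\<lambda>xs. (xs, es xs)) p"]) (auto simp: map_pmf_comp)
  qed
  then have "cognitive_values W \<phi> B \<E> \<Gamma> n = {mutual_info (channel_joint W p) fst snd | p F. F \<in> {?F} \<and> set_pmf p \<subseteq> F}"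
    unfolding cognitive_values_def by fastforce
  from channel_values_have_maximum[OF this _ ne, of n]
  show "\<exists>s\<in>cognitive_values W \<phi> B \<E> \<Gamma> n. \<forall>s'\<in>cognitive_values W \<phi> B \<E> \<Gamma> n. s' \<le> s"
    by (auto dest: admissibleD)
qed

lemma adjacent_limit:
  "normalized_max_tendsto (adjacent_values W \<phi> B \<E> \<Gamma>) (capacity W \<phi> B \<E> \<Gamma> adjacent_chargers)"
proof (rule adjacent.capacity_limit)
  fix n :: nat and v assume n: "1 \<le> n" and "v \<in> adjacent_values W \<phi> B \<E> \<Gamma> n"
  then obtain p and e :: "'x list \<Rightarrow> real" where v: "v = mutual_info (channel_joint W p) fst snd" and e: "range e \<subseteq> \<E>"
    and adm: "\<And>xs. xs \<in> set_pmf p \<Longrightarrow> (xs, energy_seq e n xs) \<in> adm n"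
    by (auto simp: adjacent_values_def)
  have fp: "finite (set_pmf p)" by (rule finite_subset[OF _ admissible_finite[of n]]) (use adm in auto)
  obtain xs where "xs \<in> set_pmf p" using set_pmf_not_empty by fast
  then have "e0 \<le> \<Gamma>" using admissible_e0_le[OF adm n] by blast
  \<comment> \<open>\<open>e\<close> respects the budget only along inputs of positive probability;
    a good policy needs a charger that respects it along all inputs.\<close>
  then obtain e' where e': "range e' \<subseteq> \<E>"
    "\<And>z. length z = n \<Longrightarrow> (\<Sum>t<n. e' (take t z)) \<le> real n * \<Gamma>"
    "\<And>z t. length z = n \<Longrightarrow> (\<Sum>t<n. e (take t z)) \<le> real n * \<Gamma> \<Longrightarrow> e' (take t z) = e (take t z)"
    using budget_charger[OF e e0] by blast
  have d: "e' (take t xs) = energy_seq e n xs ! t" if "xs \<in> set_pmf p" "t < n" for xs t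
    using admissibleD(1,5)[OF adm[OF that(1)]] that(2) by (simp add: energy_seq_nth e'(3))
  define pol :: "'x list \<Rightarrow> ('x, 'y) policy" where "pol xs = (input_policy xs, \<lambda>xs ys. e' xs)" for xs
  have "v = mixinfo (map_pmf pol p) (\<lambda>u. out W (fst u) (snd u) n)"
    unfolding v mutual_info_channel_joint[OF fp] mixinfo_map
    by (rule mixinfo_cong) (simp add: pol_def input_policy(1)[OF adm d])
  moreover have "adjacent.good n (pol xs)" if "xs \<in> set_pmf p" for xs
    unfolding adjacent.good_def pol_def fst_conv snd_conv
  proof (intro conjI)
    show "cost_ok \<E> \<Gamma> (\<lambda>(xs :: 'x list) (ys :: 'y list). e' xs) n"
      using e' by (auto simp: cost_ok_def)
    show "\<forall>(xs, ys, es)\<in>set_pmf (run W (input_policy xs) (\<lambda>xs ys. e' xs) n). feas \<phi> B B xs es"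
      using input_policy(2)[OF adm[OF that], of "\<lambda>xs ys. e' xs"] d[OF that] by blast
  qed auto
  ultimately show "\<exists>P. finite (set_pmf P) \<and> v = mixinfo P (\<lambda>u. out W (fst u) (snd u) n) \<and>
      (\<forall>u\<in>set_pmf P. adjacent.good n u) \<and> (\<not> False \<longrightarrow> (\<forall>u\<in>set_pmf P. \<forall>v\<in>set_pmf P. snd u = snd v))"
    using fp by (intro exI[of _ "map_pmf pol p"]) (auto simp: pol_def)
next
  fix n R f g and c :: "('x, 'y) charger"
  assume R: "0 \<le> R" and c: "c \<in> adjacent_chargers" and code: "code R n f c g"
  obtain e where e: "c = (\<lambda>m xs ys. e xs)" using c by (auto simp: adjacent_chargers_def)
  let ?M = "{1..num_messages R n}"
  obtain X Es where X: "\<forall>m\<in>?M. (X m, Es m) \<in> adm n"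
    and c: "\<forall>m\<in>?M. \<forall>t<n. c m (take t (X m)) (replicate t undefined) = Es m ! t"
    and I: "mixinfo (pmf_of_set ?M) (\<lambda>m. out W (f m) (c m) n) = mutual_info (channel_joint W (map_pmf X (pmf_of_set ?M))) fst snd"
    using open_loop_code[OF code R] unfolding e by auto
  have M1: "1 \<in> ?M" using num_messages_bounds(1)[OF R, of n] by simp
  \<comment> \<open>A code constrains its charger only on histories shorter than \<open>n\<close>,
    while \<open>adjacent_values\<close> asks for values in \<open>\<E>\<close> everywhere.\<close>
  define e' where "e' xs = (if length xs < n then e xs else e0)" for xs
  have eE: "e xs \<in> \<E>" if xs: "length xs < n" for xs
  proof -
    define xs' where "xs' = xs @ replicate (n - length xs) undefined"
    have "length xs' = n \<and> length (replicate n (undefined :: 'y)) = n" using xs by (simp add: xs'_def)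
    then have "c 1 (take (length xs) xs') (take (length xs) (replicate n undefined)) \<in> \<E>"
      using code M1 xs unfolding is_code_def by blast
    then show ?thesis by (simp add: e xs'_def)
  qed
  have e': "range e' \<subseteq> \<E>" using eE e0(1) by (auto simp: e'_def)
  have "Es m = energy_seq e' n (X m)" if m: "m \<in> ?M" for m
    using admissibleD(1,2)[OF X[rule_format, OF m]] c m by (intro nth_equalityI) (simp_all add: e energy_seq_nth e'_def)
  then have "\<forall>xs\<in>set_pmf (map_pmf X (pmf_of_set ?M)). (xs, energy_seq e' n xs) \<in> adm n"
    using X unfolding set_map_pmf set_pmf_messages[OF R] by fastforce
  then show "mixinfo (pmf_of_set ?M) (\<lambda>m. out W (f m) (c m) n) \<in> adjacent_values W \<phi> B \<E> \<Gamma> n"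
    unfolding adjacent_values_def I using e' by blast
next
  fix n assume ne: "adjacent_values W \<phi> B \<E> \<Gamma> n \<noteq> {}"
  let ?I = "(\<lambda>e. {xs. (xs, energy_seq e n xs) \<in> adm n}) ` {e. range e \<subseteq> \<E>}"
  have "adjacent_values W \<phi> B \<E> \<Gamma> n = {mutual_info (channel_joint W p) fst snd | p F. F \<in> ?I \<and> set_pmf p \<subseteq> F}"
  proof (intro set_eqI iffI)
    fix v assume "v \<in> adjacent_values W \<phi> B \<E> \<Gamma> n"
    then obtain p e where "v = mutual_info (channel_joint W p) fst snd" "range e \<subseteq> \<E>"
      "\<forall>xs\<in>set_pmf p. (xs, energy_seq e n xs) \<in> adm n"
      unfolding adjacent_values_def by blast
    then show "v \<in> {mutual_info (channel_joint W p) fst snd | p F. F \<in> ?I \<and> set_pmf p \<subseteq> F}"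
      by (intro CollectI exI[of _ p] exI[of _ "{xs. (xs, energy_seq e n xs) \<in> adm n}"]) auto
  next
    fix v assume "v \<in> {mutual_info (channel_joint W p) fst snd | p F. F \<in> ?I \<and> set_pmf p \<subseteq> F}"
    then obtain p e where "v = mutual_info (channel_joint W p) fst snd" "range e \<subseteq> \<E>"
      "set_pmf p \<subseteq> {xs. (xs, energy_seq e n xs) \<in> adm n}" by auto
    then show "v \<in> adjacent_values W \<phi> B \<E> \<Gamma> n"
      unfolding adjacent_values_def by (intro CollectI exI[of _ p] exI[of _ e]) auto
  qed
  from channel_values_have_maximum[OF this _ ne, of n]
  show "\<exists>s\<in>adjacent_values W \<phi> B \<E> \<Gamma> n. \<forall>s'\<in>adjacent_values W \<phi> B \<E> \<Gamma> n. s' \<le> s"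
    by (auto dest: admissibleD)
qed

end

section \<open>Charger that sees the channel outputs\<close>

lemma energy_seq_Suc: "energy_seq e (Suc t) ys = energy_seq e t ys @ [e (take t ys)]"
  by (simp add: energy_seq_def)

lemma take_energy_seq: "t \<le> n \<Longrightarrow> take t (energy_seq e n ys) = energy_seq e t ys"
  by (simp add: energy_seq_def take_map)

lemma energy_seq_append: "t \<le> Suc (length ys) \<Longrightarrow> energy_seq e t (ys @ zs) = energy_seq e t ys"
  by (simp add: energy_seq_def)

lemma causal_joint_Suc:
  "causal_joint W q e (Suc t) = bind_pmf (causal_joint W q e t) (\<lambda>(xs, ys).
     bind_pmf (q xs (energy_seq e (Suc t) ys)) (\<lambda>x. map_pmf (\<lambda>y. (xs @ [x], ys @ [y])) (W x)))"
  by (simp add: map_pmf_def)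

lemma causal_joint_length:
  "(xs, ys) \<in> set_pmf (causal_joint W q e n) \<Longrightarrow> length xs = n \<and> length ys = n"
  by (induction n arbitrary: xs ys) (auto simp: causal_joint_Suc simp del: causal_joint.simps(2))

lemma finite_causal_joint:
  fixes W :: "'x::finite \<Rightarrow> 'y::finite pmf"
  shows "finite (set_pmf (causal_joint W q e n))"
  by (induction n) (auto simp: causal_joint_Suc simp del: causal_joint.simps(2))

lemma pmf_causal_joint_snoc:
  "pmf (causal_joint W q e (Suc t)) (xs @ [x], ys @ [y]) =
     pmf (causal_joint W q e t) (xs, ys) * pmf (q xs (energy_seq e (Suc t) ys)) x * pmf (W x) y"
proof -
  have inj: "inj (\<lambda>y. (xs @ [x], ys @ [y]))" by (auto simp: inj_on_def)
  have "pmf (bind_pmf (q xs (energy_seq e (Suc t) ys)) (\<lambda>x. map_pmf (\<lambda>y. (xs @ [x], ys @ [y])) (W x))) (xs @ [x], ys @ [y])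
      = pmf (q xs (energy_seq e (Suc t) ys)) x * pmf (W x) y"
    by (subst pmf_bind_single[of _ x]) (auto simp: pmf_map_inj'[OF inj])
  then show ?thesis
    unfolding causal_joint_Suc by (subst pmf_bind_single[of _ "(xs, ys)"]) auto
qed

lemma pmf_causal_joint:
  "pmf (causal_joint W q e n) (xs, ys) = (if length xs = n \<and> length ys = n
     then \<Prod>t<n. pmf (q (take t xs) (energy_seq e (Suc t) ys)) (xs ! t) * pmf (W (xs ! t)) (ys ! t) else 0)"
proof (cases "length xs = n \<and> length ys = n")
  case True
  then show ?thesis
  proof (induction n arbitrary: xs ys)
    case (Suc n)
    obtain xs' x ys' y where *: "xs = xs' @ [x]" "ys = ys' @ [y]" "length xs' = n" "length ys' = n"
      using Suc.prems by (metis length_Suc_conv_rev)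
    have "pmf (causal_joint W q e n) (xs', ys') =
      (\<Prod>t<n. pmf (q (take t xs) (energy_seq e (Suc t) ys)) (xs ! t) * pmf (W (xs ! t)) (ys ! t))"
      using Suc.IH[of xs' ys'] * by (auto simp: nth_append energy_seq_append intro!: prod.cong)
    then show ?case
      using * unfolding *(1,2) pmf_causal_joint_snoc
      by (simp add: energy_seq_append nth_append mult.assoc)
  qed simp
next
  case False
  then have "(xs, ys) \<notin> set_pmf (causal_joint W q e n)" using causal_joint_length by blast
  then show ?thesis using False by (auto simp: set_pmf_iff)
qed

lemma causal_joint_cong:
  assumes "\<And>ys. length ys < n \<Longrightarrow> e ys = e' ys"
  shows "causal_joint W q e n = causal_joint W q e' n"
proof (rule pmf_eqI, clarify)
  fix xs ys
  have "energy_seq e (Suc t) ys = energy_seq e' (Suc t) ys" if "length ys = n" "t < n" for t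
    using that assms by (auto simp: energy_seq_def)
  then show "pmf (causal_joint W q e n) (xs, ys) = pmf (causal_joint W q e' n) (xs, ys)"
    unfolding pmf_causal_joint by (auto intro!: prod.cong)
qed

abbreviation policy_joint ::
  "('x \<Rightarrow> 'y pmf) \<Rightarrow> (real list \<Rightarrow> 'x) \<Rightarrow> ('y list \<Rightarrow> real) \<Rightarrow> nat \<Rightarrow> ('x list \<times> 'y list) pmf" where
  "policy_joint W g \<equiv> causal_joint W (\<lambda>_ es. return_pmf (g es))"

lemma run_eq_causal_joint:
  "run W g (\<lambda>xs ys. e ys) n =
     map_pmf (\<lambda>(xs, ys). (xs, ys, energy_seq e n ys)) (policy_joint W g e n)"
proof (induction n)
  case (Suc n)
  show ?case
    unfolding run_Suc Suc bind_map_pmf causal_joint_Suc map_bind_pmf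
    by (intro bind_pmf_cong refl)
      (auto simp: bind_return_pmf map_pmf_comp energy_seq_Suc energy_seq_append dest!: causal_joint_length)
qed (simp add: run_0 energy_seq_def)

lemma out_eq_causal_joint:
  "out W g (\<lambda>xs ys. e ys) n = map_pmf snd (policy_joint W g e n)"
  unfolding out_def run_eq_causal_joint by (simp add: map_pmf_comp case_prod_unfold)

lemma pmf_causal_joint_return:
  "pmf (policy_joint W g e n) (xs, ys) =
    (if length xs = n \<and> length ys = n
     then indicator {g. \<forall>t<n. g (energy_seq e (Suc t) ys) = xs ! t} g * (\<Prod>t<n. pmf (W (xs ! t)) (ys ! t)) else 0)"
  unfolding pmf_causal_joint prod.distrib by (auto simp: indicator_def intro!: prod.neutral)

text \<open>Given inputs and outputs, the channel factor is the same for all policies; mixing only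
  weighs those consistent with the inputs.\<close>

lemma pmf_policy_mixture:
  "pmf (bind_pmf P (\<lambda>g. policy_joint W g e n)) (xs, ys) =
    (if length xs = n \<and> length ys = n
     then pr P {g. \<forall>t<n. g (energy_seq e (Suc t) ys) = xs ! t} * (\<Prod>t<n. pmf (W (xs ! t)) (ys ! t)) else 0)"
  unfolding pmf_bind pmf_causal_joint_return by auto

text \<open>Arbitrary on histories that no policy in the support of \<open>P\<close> produces.\<close>

definition posterior_input :: "(real list \<Rightarrow> 'x) pmf \<Rightarrow> 'x list \<Rightarrow> real list \<Rightarrow> 'x pmf" where
  "posterior_input P xs es =
     (let A = {g. \<forall>s<length xs. g (take (Suc s) es) = xs ! s}
      in if set_pmf P \<inter> A = {} then return_pmf undefined else map_pmf (\<lambda>g. g es) (cond_pmf P A))"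

text \<open>By the chain rule, the probability of consistency with \<open>xs\<close> is the product
  of the posterior probabilities of its symbols. The common channel factors cancel in Bayes' rule,
  so the posterior depends on the outputs only through the charges, as a causally conditioned law
  must.\<close>

lemma causal_joint_posterior:
  fixes W :: "'x::finite \<Rightarrow> 'y::finite pmf"
  assumes fP: "finite (set_pmf P)"
  shows "causal_joint W (posterior_input P) e n =
     bind_pmf P (\<lambda>g. policy_joint W g e n)"
proof (rule pmf_eqI, clarify)
  fix xs ys
  have step: "pr P {g. \<forall>s<Suc t. g (energy_seq e (Suc s) ys) = xs ! s} =
      pr P {g. \<forall>s<t. g (energy_seq e (Suc s) ys) = xs ! s} *
      pmf (posterior_input P (take t xs) (energy_seq e (Suc t) ys)) (xs ! t)" if t: "t < length xs" for t
  proof -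
    define A where "A = {g. \<forall>s<t. g (energy_seq e (Suc s) ys) = xs ! s}"
    define X where "X = {g. g (energy_seq e (Suc t) ys) = xs ! t}"
    have A: "{g. \<forall>s<length (take t xs). g (take (Suc s) (energy_seq e (Suc t) ys)) = take t xs ! s} = A"
      using t by (auto simp: A_def take_energy_seq)
    have AX: "{g. \<forall>s<Suc t. g (energy_seq e (Suc s) ys) = xs ! s} = A \<inter> X"
      by (auto simp: A_def X_def less_Suc_eq)
    have "pr P (A \<inter> X) = pr P A * pmf (posterior_input P (take t xs) (energy_seq e (Suc t) ys)) (xs ! t)"
    proof (cases "set_pmf P \<inter> A = {}")
      case True
      then have "pr P A = 0" by (simp add: measure_pmf_zero_iff)
      moreover have "pr P (A \<inter> X) \<le> pr P A" by (intro measure_pmf.finite_measure_mono) auto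
      ultimately show ?thesis using measure_nonneg[of P "A \<inter> X"] by simp
    next
      case False
      then have pos: "pr P A \<noteq> 0" by (simp add: measure_pmf_zero_iff)
      have "pmf (posterior_input P (take t xs) (energy_seq e (Suc t) ys)) (xs ! t) = pr (cond_pmf P A) X"
        unfolding posterior_input_def Let_def A using False by (simp add: pmf_map X_def vimage_def)
      also have "\<dots> = E (cond_pmf P A) (indicator X)" by simp
      also have "\<dots> = (\<Sum>g\<in>set_pmf P. pmf P g * indicator (A \<inter> X) g / pr P A)"
        using False by (subst expectation_finite[OF fP]) (auto simp: pmf_cond[OF False] indicator_def of_bool_def intro!: sum.cong split: if_splits)
      also have "\<dots> = E P (indicator (A \<inter> X)) / pr P A"
        by (simp only: expectation_finite[OF fP order_refl] sum_divide_distrib)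
      finally show ?thesis using pos by simp
    qed
    then show ?thesis unfolding AX A_def .
  qed
  have "pr P {g. \<forall>s<t. g (energy_seq e (Suc s) ys) = xs ! s} =
      (\<Prod>s<t. pmf (posterior_input P (take s xs) (energy_seq e (Suc s) ys)) (xs ! s))" if "t \<le> length xs" for t
    using that
  proof (induction t)
    case (Suc t)
    then show ?case unfolding step[of t, OF Suc_le_lessD[OF Suc.prems]] by simp
  qed simp
  then show "pmf (causal_joint W (posterior_input P) e n) (xs, ys) =
     pmf (bind_pmf P (\<lambda>g. policy_joint W g e n)) (xs, ys)"
    unfolding pmf_policy_mixture pmf_causal_joint prod.distrib by auto
qed

text \<open>Conversely, drawing the reaction to every possible history in advance and independently turns
  a causally conditioned law into a law on deterministic policies (Kuhn's theorem).\<close>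

primrec replay :: "('x list \<times> real list \<Rightarrow> 'x) \<Rightarrow> real list \<Rightarrow> nat \<Rightarrow> 'x list" where
  "replay U es 0 = []"
| "replay U es (Suc t) = replay U es t @ [U (replay U es t, take (Suc t) es)]"

lemma length_replay [simp]: "length (replay U es t) = t"
  by (induction t) auto

lemma replay_take: "t \<le> k \<Longrightarrow> k \<le> length es \<Longrightarrow> replay U (take k es) t = replay U es t"
  by (induction t) (simp_all add: min_absorb1)

text \<open>\<open>U\<close> answers to pairs of past inputs and charges, whereas a policy sees
  charges only; it recovers its past inputs by replaying its own answers.\<close>

definition policy_of :: "('x list \<times> real list \<Rightarrow> 'x) \<Rightarrow> real list \<Rightarrow> 'x" where
  "policy_of U es = U (replay U es (length es - 1), es)"

text \<open>The replayed inputs agree with \<open>xs\<close> as long as all earlier answers do, so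
  this agreement is carried along in the induction.\<close>

lemma policy_of_consistent:
  assumes "n \<le> length xs"
  shows "(\<forall>t<n. policy_of U (energy_seq e (Suc t) ys) = xs ! t) \<longleftrightarrow>
     (\<forall>t<n. U (take t xs, energy_seq e (Suc t) ys) = xs ! t)"
proof -
  have p: "policy_of U (energy_seq e (Suc t) ys) = U (replay U (energy_seq e n ys) t, energy_seq e (Suc t) ys)" if "t < n" for t
  proof -
    have "replay U (energy_seq e (Suc t) ys) t = replay U (energy_seq e n ys) t"
      using replay_take[of t "Suc t" "energy_seq e n ys" U] that by (simp add: take_energy_seq)
    then show ?thesis by (simp add: policy_of_def)
  qed
  have "((\<forall>t<k. U (replay U (energy_seq e n ys) t, energy_seq e (Suc t) ys) = xs ! t) \<longleftrightarrow>
      (\<forall>t<k. U (take t xs, energy_seq e (Suc t) ys) = xs ! t)) \<and>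
     ((\<forall>t<k. U (take t xs, energy_seq e (Suc t) ys) = xs ! t) \<longrightarrow> replay U (energy_seq e n ys) k = take k xs)"
    if "k \<le> n" for k
    using that
  proof (induction k)
    case (Suc k)
    then have k: "k < length xs" "take (Suc k) (energy_seq e n ys) = energy_seq e (Suc k) ys"
      using assms by (simp_all add: take_energy_seq)
    show ?case
      using Suc.IH Suc.prems
      by (simp add: All_less_Suc k(2) take_Suc_conv_app_nth[OF k(1)]) metis
  qed simp
  from this[of n] p show ?thesis by simp
qed

lemma causal_joint_eq_policy_mixture:
  fixes W :: "'x::finite \<Rightarrow> 'y::finite pmf"
  assumes \<E>: "finite \<E>" and e: "range e \<subseteq> \<E>"
  shows "\<exists>P. finite (set_pmf P) \<and>
     causal_joint W q e n = bind_pmf P (\<lambda>g. policy_joint W g e n)"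
proof -
  \<comment> \<open>All histories that can be queried within the block; finiteness of both alphabets
    makes them finitely many and gives the product law finite support.\<close>
  define H where "H = {xs :: 'x list. length xs \<le> n} \<times> {es. set es \<subseteq> \<E> \<and> length es \<le> n}"
  have fH: "finite H"
    unfolding H_def using finite_lists_length_le[of "UNIV :: 'x set" n] finite_lists_length_le[OF \<E>, of n] by simp
  define PU where "PU = Pi_pmf H undefined (\<lambda>(xs, es). q xs es)"
  have fPU: "finite (set_pmf PU)"
  proof (rule finite_subset)
    show "set_pmf PU \<subseteq> PiE_dflt H undefined (\<lambda>h. set_pmf (case h of (xs, es) \<Rightarrow> q xs es))"
      unfolding PU_def by (rule set_Pi_pmf_subset'[OF fH, THEN order_trans]) (auto simp: comp_def)
  qed (auto intro!: finite_PiE_dflt fH)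
  have "pr PU {U. \<forall>t<n. U (take t xs, energy_seq e (Suc t) ys) = xs ! t} =
      (\<Prod>t<n. pmf (q (take t xs) (energy_seq e (Suc t) ys)) (xs ! t))" if xs: "length xs = n" for xs ys
  proof -
    define h where "h t = (take t xs, energy_seq e (Suc t) ys)" for t
    \<comment> \<open>Queries at different times have charge prefixes of different lengths, so they
      are distinct coordinates of \<open>PU\<close>, whose values are independent.\<close>
    have inj: "inj_on h {..<n}"
      by (rule inj_onI) (metis h_def length_energy_seq nat.inject prod.inject)
    have hH: "h ` {..<n} \<subseteq> H"
    proof -
      have "e p \<in> \<E>" for p using e by blast
      then show ?thesis using xs by (auto simp: h_def H_def energy_seq_def)
    qed
    \<comment> \<open>The constraint that \<open>xs\<close> puts on the answer to \<open>z\<close>.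
      The time of a query is read off its charge prefix, which includes the current charge; all
      other answers are free and contribute a factor 1.\<close>
    define X where "X z = (if z \<in> h ` {..<n} then {xs ! (length (snd z) - 1)} else UNIV)" for z :: "'x list \<times> real list"
    have "{U. \<forall>t<n. U (h t) = xs ! t} = Pi H X"
    proof (intro set_eqI iffI)
      fix U assume "U \<in> Pi H X"
      then have "U (h t) \<in> X (h t)" if "t < n" for t using hH that by (auto simp: Pi_iff)
      then show "U \<in> {U. \<forall>t<n. U (h t) = xs ! t}" by (force simp: X_def h_def)
    qed (auto simp: X_def h_def)
    then have "pr PU {U. \<forall>t<n. U (h t) = xs ! t} = (\<Prod>z\<in>H. pr (case z of (xs, es) \<Rightarrow> q xs es) (X z))"
      unfolding PU_def by (simp add: measure_Pi_pmf_Pi[OF fH])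
    also have "\<dots> = (\<Prod>z\<in>h ` {..<n}. pr (case z of (xs, es) \<Rightarrow> q xs es) (X z))"
      using hH fH by (intro prod.mono_neutral_right) (auto simp: X_def)
    also have "\<dots> = (\<Prod>t<n. pmf (q (take t xs) (energy_seq e (Suc t) ys)) (xs ! t))"
      unfolding prod.reindex[OF inj] by (intro prod.cong) (auto simp: X_def h_def measure_pmf_single)
    finally show ?thesis by (simp add: h_def)
  qed
  then have "causal_joint W q e n = bind_pmf (map_pmf policy_of PU) (\<lambda>g. policy_joint W g e n)"
    by (intro pmf_eqI) (auto simp: pmf_policy_mixture pmf_causal_joint prod.distrib vimage_def policy_of_consistent)
  then show ?thesis using fPU by (intro exI[of _ "map_pmf policy_of PU"]) simp
qed

section \<open>Directed information as an expected log-likelihood ratio\<close>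

lemma cond_mutual_info_eq_diff:
  fixes p :: "'w pmf" and X :: "'w \<Rightarrow> 'a::countable" and Y :: "'w \<Rightarrow> 'b::countable" and Z :: "'w \<Rightarrow> 'c::countable"
  shows "cond_mutual_info p X Y Z = mutual_info p X (\<lambda>w. (Y w, Z w)) - mutual_info p X Z"
  unfolding cond_mutual_info_def mutual_info_def
    prob_space.conditional_mutual_information_def[OF measure_pmf.prob_space_axioms]
  by (simp add: pair_measure_countable)

lemma cond_mutual_info_eq_expectation:
  fixes p :: "'w pmf" and X :: "'w \<Rightarrow> 'a::countable" and Y :: "'w \<Rightarrow> 'b::countable" and Z :: "'w \<Rightarrow> 'c::countable"
  assumes fp: "finite (set_pmf p)"
  shows "cond_mutual_info p X Y Z = E p (\<lambda>w.
     log 2 (pmf (map_pmf (\<lambda>w. (X w, Y w, Z w)) p) (X w, Y w, Z w) / pmf (map_pmf (\<lambda>w. (X w, Z w)) p) (X w, Z w))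
     + log 2 (pmf (map_pmf Z p) (Z w)) - log 2 (pmf (map_pmf (\<lambda>w. (Y w, Z w)) p) (Y w, Z w)))"
  unfolding cond_mutual_info_eq_diff mutual_info_eq_expectation[OF fp]
proof (subst Bochner_Integration.integral_diff[symmetric], goal_cases)
  case 3
  show ?case
  proof (rule expectation_cong)
    fix w assume w: "w \<in> set_pmf p"
    let ?XYZ = "pmf (map_pmf (\<lambda>w. (X w, Y w, Z w)) p) (X w, Y w, Z w)" and ?X = "pmf (map_pmf X p) (X w)"
    let ?YZ = "pmf (map_pmf (\<lambda>w. (Y w, Z w)) p) (Y w, Z w)" and ?XZ = "pmf (map_pmf (\<lambda>w. (X w, Z w)) p) (X w, Z w)"
    let ?Z = "pmf (map_pmf Z p) (Z w)"
    have "0 < ?XYZ" "0 < ?X" "0 < ?YZ" "0 < ?XZ" "0 < ?Z" using w by (auto intro!: pmf_positive)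
    then show "log 2 (?XYZ / (?X * ?YZ)) - log 2 (?XZ / (?X * ?Z)) = log 2 (?XYZ / ?XZ) + log 2 ?Z - log 2 ?YZ"
      by (simp add: log_divide log_mult)
  qed
qed (auto simp: integrable_measure_pmf_finite fp)

lemma map_take_causal_joint:
  "t \<le> n \<Longrightarrow> map_pmf (\<lambda>(xs, ys). (take t xs, take t ys)) (causal_joint W q e n) = causal_joint W q e t"
proof (induction n)
  case (Suc n)
  show ?case
  proof (cases "t = Suc n")
    case True
    have "map_pmf (\<lambda>(xs, ys). (take t xs, take t ys)) (causal_joint W q e (Suc n)) = map_pmf id (causal_joint W q e (Suc n))"
      using True by (intro map_pmf_cong refl) (auto dest!: causal_joint_length simp del: causal_joint.simps)
    then show ?thesis using True by (simp del: causal_joint.simps)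
  next
    case False
    then have t: "t \<le> n" using Suc.prems by simp
    have "map_pmf (\<lambda>(xs, ys). (take t xs, take t ys)) (causal_joint W q e (Suc n)) =
      bind_pmf (causal_joint W q e n) (\<lambda>(xs, ys). return_pmf (take t xs, take t ys))"
      unfolding causal_joint_Suc map_bind_pmf
      by (intro bind_pmf_cong refl)
        (use t in \<open>auto dest!: causal_joint_length simp: map_pmf_comp map_bind_pmf map_pmf_const\<close>)
    also have "\<dots> = causal_joint W q e t"
      using Suc.IH[OF t] by (simp add: map_pmf_def case_prod_unfold)
    finally show ?thesis .
  qed
qed simp

lemma take_in_causal_joint:
  assumes "(xs, ys) \<in> set_pmf (causal_joint W q e n)" "t \<le> n"
  shows "(take t xs, take t ys) \<in> set_pmf (causal_joint W q e t)"
  unfolding map_take_causal_joint[OF assms(2), symmetric] set_map_pmf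
  by (rule image_eqI[OF _ assms(1)]) simp

text \<open>Given the past, the output at time \<open>t\<close> depends on the inputs only through
  the current one. The density of the corresponding term is therefore the channel probability over
  the conditional output probability, and the denominators telescope to the probability of the whole
  output.\<close>

lemma directed_info_causal_joint:
  fixes W :: "'x::finite \<Rightarrow> 'y::finite pmf" and q e
  defines "J \<equiv> causal_joint W q e"
  shows "directed_info n (J n) = E (J n) (\<lambda>(xs, ys).
     log 2 ((\<Prod>t<n. pmf (W (xs ! t)) (ys ! t)) / pmf (map_pmf snd (J n)) ys))"
proof -
  have fJ: "finite (set_pmf (J t))" for t unfolding J_def by (rule finite_causal_joint)
  define out where "out t = map_pmf snd (J t)" for t
  let ?X = "\<lambda>t (xs :: 'x list, ys :: 'y list). take (Suc t) xs"
  let ?Y = "\<lambda>t (xs :: 'x list, ys :: 'y list). ys ! t"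
  let ?Z = "\<lambda>t (xs :: 'x list, ys :: 'y list). take t ys"
  let ?i = "\<lambda>t xs ys. log 2 (pmf (W (xs ! t)) (ys ! t)) + log 2 (pmf (out t) (take t ys))
     - log 2 (pmf (out (Suc t)) (take (Suc t) ys))"
  have W0: "0 < pmf (W (xs ! t)) (ys ! t)" if "(xs, ys) \<in> set_pmf (J n)" "t < n" for xs ys t
  proof -
    have "pmf (J n) (xs, ys) \<noteq> 0" using that by (simp add: set_pmf_iff)
    then show ?thesis using that(2) unfolding J_def pmf_causal_joint by (auto simp: less_le split: if_splits)
  qed
  have out0: "0 < pmf (out t) (take t ys)" if "(xs, ys) \<in> set_pmf (J n)" "t \<le> n" for xs ys t
  proof -
    have "(take t xs, take t ys) \<in> set_pmf (J t)"
      using that unfolding J_def by (rule take_in_causal_joint)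
    then show ?thesis unfolding out_def by (intro pmf_positive) force
  qed
  have cmi: "cond_mutual_info (J n) (?X t) (?Y t) (?Z t)
      = E (J n) (\<lambda>(xs, ys). ?i t xs ys)"
    if t: "t < n" for t
  proof -
    define JS where "JS = map_pmf (\<lambda>(xs, ys). (take (Suc t) xs, take (Suc t) ys)) (J n)"
    have JS: "JS = J (Suc t)" unfolding JS_def J_def using t by (intro map_take_causal_joint) simp
    have lenS: "length xs = Suc t \<and> length ys = Suc t" if "(xs, ys) \<in> set_pmf (J (Suc t))" for xs ys
      using that unfolding J_def by (rule causal_joint_length)
    have len: "length xs = n \<and> length ys = n" if "(xs, ys) \<in> set_pmf (J n)" for xs ys
      using that unfolding J_def by (rule causal_joint_length)
    \<comment> \<open>Rearrangements that split off the last output, to match the variables of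
      \<open>cond_mutual_info\<close>. They are injective only on lists of the right length, so
      injectivity is shown on the supports.\<close>
    define s3 where "s3 = (\<lambda>(xs :: 'x list, ys :: 'y list). (xs, ys ! t, take t ys))"
    define s2 where "s2 = (\<lambda>ys :: 'y list. (ys ! t, take t ys))"
    have s2I: "ys = ys'" if "s2 ys = s2 ys'" "length ys = Suc t" "length ys' = Suc t" for ys ys' :: "'y list"
      using take_Suc_conv_app_nth[of t ys] take_Suc_conv_app_nth[of t ys'] that by (simp add: s2_def)
    have i2: "inj_on s2 (set_pmf (out (Suc t)))"
    proof (rule inj_onI)
      fix a b assume "a \<in> set_pmf (out (Suc t))" "b \<in> set_pmf (out (Suc t))" and eq: "s2 a = s2 b"
      then have "length a = Suc t" "length b = Suc t" unfolding out_def using lenS by auto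
      with eq show "a = b" by (rule s2I)
    qed
    have i3: "inj_on s3 (set_pmf (J (Suc t)))"
    proof (rule inj_onI)
      fix a b assume ab: "a \<in> set_pmf (J (Suc t))" "b \<in> set_pmf (J (Suc t))" and eq: "s3 a = s3 b"
      have "length (snd a) = Suc t" "length (snd b) = Suc t"
        using lenS[of "fst a" "snd a"] lenS[of "fst b" "snd b"] ab by auto
      moreover have "fst a = fst b" "s2 (snd a) = s2 (snd b)"
        using eq by (simp_all add: s3_def s2_def case_prod_unfold)
      ultimately show "a = b" using s2I by (simp add: prod_eq_iff)
    qed
    have 3: "map_pmf (\<lambda>w. (?X t w, ?Y t w, ?Z t w)) (J n)
        = map_pmf s3 (J (Suc t))"
      unfolding JS[symmetric] JS_def map_pmf_comp using t
      by (intro map_pmf_cong refl) (auto simp: s3_def min_absorb1 dest: len)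
    have 2: "map_pmf (\<lambda>w. (?Y t w, ?Z t w)) (J n) = map_pmf s2 (out (Suc t))"
      unfolding out_def JS[symmetric] JS_def map_pmf_comp using t
      by (intro map_pmf_cong refl) (auto simp: s2_def min_absorb1 dest: len)
    have 1: "map_pmf (\<lambda>(xs, ys). take t ys) (J n) = out t"
      unfolding out_def J_def map_take_causal_joint[OF less_imp_le[OF t], of W q e, symmetric] map_pmf_comp
      by (simp add: case_prod_unfold)
    \<comment> \<open>The joint law just before the channel acts: the current input is drawn, its
      output is still missing. The full joint law divided by \<open>H\<close> is exactly the channel
      probability.\<close>
    define H where "H = bind_pmf (J t) (\<lambda>(xs, ys). map_pmf (\<lambda>x. (xs @ [x], ys)) (q xs (energy_seq e (Suc t) ys)))"
    have H: "map_pmf (\<lambda>w. (?X t w, ?Z t w)) (J n) = H"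
    proof -
      have "map_pmf (\<lambda>w. (?X t w, ?Z t w)) (J n)
          = map_pmf (\<lambda>(xs, ys). (xs, take t ys)) JS"
        unfolding JS_def map_pmf_comp by (intro map_pmf_cong refl) (auto simp: min_absorb1)
      also have "\<dots> = H"
        unfolding JS H_def J_def causal_joint_Suc map_bind_pmf
        by (intro bind_pmf_cong refl)
          (auto dest!: causal_joint_length simp: map_pmf_comp map_bind_pmf map_pmf_def[of "\<lambda>x. (_ @ [x], _)"])
      finally show ?thesis .
    qed
    have pH: "pmf H (xs @ [x], ys) = pmf (J t) (xs, ys) * pmf (q xs (energy_seq e (Suc t) ys)) x" for xs x ys
    proof -
      have inj: "inj (\<lambda>x. (xs @ [x], ys))" by (auto simp: inj_on_def)
      show ?thesis unfolding H_def
        by (subst pmf_bind_single[of _ "(xs, ys)"]) (auto simp: pmf_map_inj'[OF inj])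
    qed
    have "cond_mutual_info (J n) (?X t) (?Y t) (?Z t)
      = E (J n) (\<lambda>w. log 2 (pmf (map_pmf s3 (J (Suc t))) (?X t w, ?Y t w, ?Z t w)
         / pmf H (?X t w, ?Z t w))
         + log 2 (pmf (out t) (?Z t w))
         - log 2 (pmf (map_pmf s2 (out (Suc t))) (?Y t w, ?Z t w)))"
      unfolding cond_mutual_info_eq_expectation[OF fJ] 1 2 3 H ..
    also have "\<dots> = E (J n) (\<lambda>(xs, ys). ?i t xs ys)"
    proof (rule expectation_cong, clarify)
      fix xs ys assume w: "(xs, ys) \<in> set_pmf (J n)"
      have l: "length xs = n" "length ys = n" using len[OF w] by auto
      have xS: "take (Suc t) xs = take t xs @ [xs ! t]" and yS: "take (Suc t) ys = take t ys @ [ys ! t]"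
        using l t by (simp_all add: take_Suc_conv_app_nth)
      have mem: "(take (Suc t) xs, take (Suc t) ys) \<in> set_pmf (J (Suc t))"
        using w Suc_leI[OF t] unfolding J_def by (rule take_in_causal_joint)
      then have mem2: "take (Suc t) ys \<in> set_pmf (out (Suc t))" unfolding out_def by force
      have "s3 (take (Suc t) xs, take (Suc t) ys) = (take (Suc t) xs, ys ! t, take t ys)"
        using l t by (simp add: s3_def min_absorb1)
      then have p3: "pmf (map_pmf s3 (J (Suc t))) (take (Suc t) xs, ys ! t, take t ys) = pmf (J (Suc t)) (take (Suc t) xs, take (Suc t) ys)"
        using pmf_map_inj[OF i3 mem] by simp
      have "s2 (take (Suc t) ys) = (ys ! t, take t ys)" using l t by (simp add: s2_def min_absorb1)
      then have p2: "pmf (map_pmf s2 (out (Suc t))) (ys ! t, take t ys) = pmf (out (Suc t)) (take (Suc t) ys)"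
        using pmf_map_inj[OF i2 mem2] by simp
      have "pmf (J (Suc t)) (take (Suc t) xs, take (Suc t) ys) = pmf H (take (Suc t) xs, take t ys) * pmf (W (xs ! t)) (ys ! t)"
        unfolding xS yS J_def pmf_causal_joint_snoc unfolding pH J_def by simp
      moreover have "pmf (J (Suc t)) (take (Suc t) xs, take (Suc t) ys) \<noteq> 0" using mem by (simp add: set_pmf_iff)
      ultimately have "pmf (J (Suc t)) (take (Suc t) xs, take (Suc t) ys) / pmf H (take (Suc t) xs, take t ys) = pmf (W (xs ! t)) (ys ! t)"
        by auto
      then show "log 2 (pmf (map_pmf s3 (J (Suc t))) (take (Suc t) xs, ys ! t, take t ys) / pmf H (take (Suc t) xs, take t ys))
         + log 2 (pmf (out t) (take t ys)) - log 2 (pmf (map_pmf s2 (out (Suc t))) (ys ! t, take t ys))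
         = ?i t xs ys"
        by (simp add: p2 p3)
    qed
    finally show ?thesis .
  qed
  have "directed_info n (J n) = E (J n) (\<lambda>(xs, ys). \<Sum>t<n. ?i t xs ys)"
  proof -
    have "directed_info n (J n) = (\<Sum>t<n. E (J n) (\<lambda>(xs, ys). ?i t xs ys))"
      unfolding directed_info_def by (intro sum.cong refl cmi) simp
    then show ?thesis by (simp add: case_prod_unfold integrable_measure_pmf_finite fJ)
  qed
  also have "\<dots> = E (J n) (\<lambda>(xs, ys). log 2 ((\<Prod>t<n. pmf (W (xs ! t)) (ys ! t)) / pmf (map_pmf snd (J n)) ys))"
  proof (rule expectation_cong, clarify)
    fix xs ys assume w: "(xs, ys) \<in> set_pmf (J n)"
    have l: "length ys = n" using w causal_joint_length unfolding J_def by blast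
    have o0: "pmf (out 0) [] = 1" by (simp add: out_def J_def)
    \<comment> \<open>The telescope starts at the empty output sequence, which has probability
      1.\<close>
    have tele: "(\<Sum>t<n. log 2 (pmf (out t) (take t ys)) - log 2 (pmf (out (Suc t)) (take (Suc t) ys))) = - log 2 (pmf (out n) ys)"
      using sum_lessThan_telescope'[of "\<lambda>t. log 2 (pmf (out t) (take t ys))" n] l by (simp add: o0)
    have "(\<Sum>t<n. ?i t xs ys)
       = (\<Sum>t<n. log 2 (pmf (W (xs ! t)) (ys ! t))) + (\<Sum>t<n. log 2 (pmf (out t) (take t ys)) - log 2 (pmf (out (Suc t)) (take (Suc t) ys)))"
      unfolding sum.distrib[symmetric] by (intro sum.cong) auto
    also have "(\<Sum>t<n. log 2 (pmf (W (xs ! t)) (ys ! t))) = log 2 (\<Prod>t<n. pmf (W (xs ! t)) (ys ! t))"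
      using W0[OF w] unfolding log_def by (subst ln_prod) (force simp: sum_divide_distrib)+
    finally show "(\<Sum>t<n. ?i t xs ys)
      = log 2 ((\<Prod>t<n. pmf (W (xs ! t)) (ys ! t)) / pmf (map_pmf snd (J n)) ys)"
      using out0[OF w, of n] l W0[OF w] unfolding tele
      by (simp add: log_divide out_def prod_pos less_imp_neq[THEN not_sym])
  qed
  finally show ?thesis .
qed

text \<open>For a single policy, \<open>pmf_out\<close> identifies the product of channel
  probabilities with the output probability, so both informations average the same density.\<close>

lemma directed_info_policy_mixture:
  fixes W :: "'x::finite \<Rightarrow> 'y::finite pmf"
  assumes fP: "finite (set_pmf P)"
    and J: "causal_joint W q e n = bind_pmf P (\<lambda>g. policy_joint W g e n)"
  shows "directed_info n (causal_joint W q e n) = mixinfo P (\<lambda>g. out W g (\<lambda>xs ys. e ys) n)"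
proof -
  let ?V = "\<lambda>g. out W g (\<lambda>xs ys. e ys) n"
  have snd: "map_pmf snd (causal_joint W q e n) = bind_pmf P ?V"
    unfolding J map_bind_pmf out_eq_causal_joint ..
  have "directed_info n (causal_joint W q e n) = E (causal_joint W q e n) (\<lambda>(xs, ys).
     log 2 ((\<Prod>t<n. pmf (W (xs ! t)) (ys ! t)) / pmf (bind_pmf P ?V) ys))"
    unfolding directed_info_causal_joint snd ..
  also have "\<dots> = E P (\<lambda>g. E (policy_joint W g e n) (\<lambda>(xs, ys).
     log 2 ((\<Prod>t<n. pmf (W (xs ! t)) (ys ! t)) / pmf (bind_pmf P ?V) ys)))"
    unfolding J by (rule expectation_bind[OF fP finite_causal_joint])
  also have "\<dots> = E P (\<lambda>g. E (policy_joint W g e n) (\<lambda>(xs, ys).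
     log 2 (pmf (?V g) ys / pmf (bind_pmf P ?V) ys)))"
  proof (intro expectation_cong, clarify)
    fix g xs ys assume "(xs, ys) \<in> set_pmf (policy_joint W g e n)"
    then have "(xs, ys, energy_seq e n ys) \<in> set_pmf (run W g (\<lambda>xs ys. e ys) n)"
      unfolding run_eq_causal_joint by force
    then show "log 2 ((\<Prod>t<n. pmf (W (xs ! t)) (ys ! t)) / pmf (bind_pmf P ?V) ys) = log 2 (pmf (?V g) ys / pmf (bind_pmf P ?V) ys)"
      by (simp add: pmf_out)
  qed
  also have "\<dots> = mixinfo P ?V"
    unfolding mixinfo_def out_eq_causal_joint by (simp add: case_prod_unfold)
  finally show ?thesis .
qed

text \<open>Agreement is demanded only along histories of the original run; this is what allows
  altering a policy or charger off its support.\<close>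

lemma run_cong:
  assumes "\<forall>(xs, ys, es)\<in>set_pmf (run W g d n). \<forall>t<n.
     d' (take t xs) (take t ys) = d (take t xs) (take t ys) \<and> g' (take (Suc t) es) = g (take (Suc t) es)"
  shows "run W g' d' n = run W g d n"
  using assms
proof (induction n)
  case (Suc n)
  have f: "d' (take t xs) (take t ys) = d (take t xs) (take t ys) \<and>
      g' (take (Suc t) (es @ [d xs ys])) = g (take (Suc t) (es @ [d xs ys]))"
    if r: "(xs, ys, es) \<in> set_pmf (run W g d n)" and t: "t \<le> n" for xs ys es t
  proof -
    obtain y where "y \<in> set_pmf (W (g (es @ [d xs ys])))" using set_pmf_not_empty by fast
    then have "(xs @ [g (es @ [d xs ys])], ys @ [y], es @ [d xs ys]) \<in> set_pmf (run W g d (Suc n))"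
      using r by (force simp: run_Suc)
    from Suc.prems[rule_format, OF this, simplified, rule_format, of t] show ?thesis
      using t run_length[OF r] by simp
  qed
  have IH: "run W g' d' n = run W g d n"
  proof (rule Suc.IH, clarify)
    fix xs ys es t assume r: "(xs, ys, es) \<in> set_pmf (run W g d n)" and t: "t < n"
    from f[OF r, of t] show "d' (take t xs) (take t ys) = d (take t xs) (take t ys) \<and> g' (take (Suc t) es) = g (take (Suc t) es)"
      using t run_length[OF r] by simp
  qed
  have "d' xs ys = d xs ys \<and> g' (es @ [d xs ys]) = g (es @ [d xs ys])" if r: "(xs, ys, es) \<in> set_pmf (run W g d n)" for xs ys es
    using f[OF r order_refl] run_length[OF r] by simp
  then show ?case unfolding run_Suc IH by (intro bind_pmf_cong refl) auto
qed (simp add: run_0)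

context remote_power
begin

interpretation receiver: charger_class W \<phi> B \<E> x0 \<Gamma> e0
  "{d. \<exists>e :: 'y list \<Rightarrow> real. d = (\<lambda>(xs :: 'x list) (ys :: 'y list). e ys)}" "\<lambda>xs ys. length ys" False receiver_chargers
proof
  show "then_d (\<lambda>xs ys. length ys) K a b \<in> {d. \<exists>e. d = (\<lambda>xs ys. e ys)}"
    if ab: "a \<in> {d. \<exists>e. d = (\<lambda>xs ys. e ys)}" "b \<in> {d. \<exists>e. d = (\<lambda>xs ys. e ys)}"
    for a b :: "'x list \<Rightarrow> 'y list \<Rightarrow> real" and K
  proof -
    obtain ea eb where "a = (\<lambda>xs ys. ea ys)" "b = (\<lambda>xs ys. eb ys)" using ab by auto
    then have "then_d (\<lambda>xs ys. length ys) K a b = (\<lambda>xs ys. (\<lambda>zs. if length zs < K then ea zs else eb (drop K zs)) ys)"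
      by (simp add: then_d_def fun_eq_iff)
    then show ?thesis
      by (intro CollectI exI[of _ "\<lambda>zs. if length zs < K then ea zs else eb (drop K zs)"]) simp
  qed
  show "D \<in> receiver_chargers"
    if D: "\<And>m. D m \<in> {d. \<exists>e. d = (\<lambda>xs ys. e ys)}" "\<And>m m'. \<not> False \<Longrightarrow> D m = D m'" for D
  proof -
    obtain e where "D 0 = (\<lambda>xs ys. e ys)" using D(1)[of 0] by auto
    then have "D = (\<lambda>m xs ys. e ys)" using D(2) by (metis (full_types))
    then show ?thesis by (auto simp: receiver_chargers_def)
  qed
qed (auto simp: is_clock_def)

definition feasible_policies :: "nat \<Rightarrow> ('y list \<Rightarrow> real) \<Rightarrow> (real list \<Rightarrow> 'x) set" where
  "feasible_policies n e = {g. \<forall>(xs, ys, es)\<in>set_pmf (run W g (\<lambda>xs ys. e ys) n). (xs, es) \<in> adm n}"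

text \<open>With \<open>receiver_value_is_mixture\<close> this describes the directed-information
  objective entirely by random policies. In the converse it is applied to the policies of a code
  under a uniform message.\<close>

lemma mixture_in_receiver_values:
  assumes fP: "finite (set_pmf P)" and e: "range e \<subseteq> \<E>" and P: "set_pmf P \<subseteq> feasible_policies n e"
  shows "mixinfo P (\<lambda>g. out W g (\<lambda>xs ys. e ys) n) \<in> receiver_values W \<phi> B \<E> \<Gamma> n"
proof -
  note J = causal_joint_posterior[OF fP, of W e n]
  have "(xs, energy_seq e n ys) \<in> adm n"
    if xy: "(xs, ys) \<in> set_pmf (causal_joint W (posterior_input P) e n)" for xs ys
  proof -
    obtain g where g: "g \<in> set_pmf P" "(xs, ys) \<in> set_pmf (policy_joint W g e n)"
      using xy unfolding J by auto
    then have "(xs, ys, energy_seq e n ys) \<in> set_pmf (run W g (\<lambda>xs ys. e ys) n)"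
      unfolding run_eq_causal_joint by force
    then show ?thesis using P g(1) unfolding feasible_policies_def by blast
  qed
  then show ?thesis
    unfolding receiver_values_def directed_info_policy_mixture[OF fP J, symmetric]
    using e by blast
qed

lemma receiver_value_is_mixture:
  assumes "v \<in> receiver_values W \<phi> B \<E> \<Gamma> n"
  obtains P e where "finite (set_pmf P)" "range e \<subseteq> \<E>" "set_pmf P \<subseteq> feasible_policies n e"
    "v = mixinfo P (\<lambda>g. out W g (\<lambda>xs ys. e ys) n)"
proof -
  obtain q e where v: "v = directed_info n (causal_joint W q e n)" and e: "range e \<subseteq> \<E>"
    and adm: "\<forall>(xs, ys)\<in>set_pmf (causal_joint W q e n). (xs, energy_seq e n ys) \<in> adm n"
    using assms unfolding receiver_values_def by blast
  obtain P where P: "finite (set_pmf P)" "causal_joint W q e n = bind_pmf P (\<lambda>g. policy_joint W g e n)"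
    using causal_joint_eq_policy_mixture[OF \<E>_finite e] by blast
  have "(xs, es) \<in> adm n"
    if g: "g \<in> set_pmf P" "(xs, ys, es) \<in> set_pmf (run W g (\<lambda>xs ys. e ys) n)" for g xs ys es
  proof -
    have "(xs, ys) \<in> set_pmf (policy_joint W g e n)" "es = energy_seq e n ys"
      using g(2) unfolding run_eq_causal_joint by auto
    then show ?thesis using g(1) adm unfolding P(2) by auto
  qed
  then have "set_pmf P \<subseteq> feasible_policies n e" unfolding feasible_policies_def by blast
  then show ?thesis using that P(1) e directed_info_policy_mixture[OF P] v by blast
qed

lemma receiver_limit:
  "normalized_max_tendsto (receiver_values W \<phi> B \<E> \<Gamma>) (capacity W \<phi> B \<E> \<Gamma> receiver_chargers)"
proof (rule receiver.capacity_limit)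
  fix n :: nat and v assume n: "1 \<le> n" and "v \<in> receiver_values W \<phi> B \<E> \<Gamma> n"
  then obtain P e where fP: "finite (set_pmf P)" and e: "range e \<subseteq> \<E>" and P: "set_pmf P \<subseteq> feasible_policies n e"
    and v: "v = mixinfo P (\<lambda>g. out W g (\<lambda>xs ys. e ys) n)"
    using receiver_value_is_mixture by blast
  have adm: "(xs, es) \<in> adm n"
    if "g \<in> set_pmf P" "(xs, ys, es) \<in> set_pmf (run W g (\<lambda>xs ys. e ys) n)" for g xs ys es
    using P that unfolding feasible_policies_def by blast
  obtain g where "g \<in> set_pmf P" using set_pmf_not_empty by fast
  moreover obtain xs ys es where "(xs, ys, es) \<in> set_pmf (run W g (\<lambda>xs ys. e ys) n)"
    using set_pmf_not_empty by (metis all_not_in_conv prod_cases3)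
  ultimately have "e0 \<le> \<Gamma>" using admissible_e0_le[OF adm n] by blast
  then obtain e' where e': "range e' \<subseteq> \<E>"
    "\<And>z. length z = n \<Longrightarrow> (\<Sum>t<n. e' (take t z)) \<le> real n * \<Gamma>"
    "\<And>z t. length z = n \<Longrightarrow> (\<Sum>t<n. e (take t z)) \<le> real n * \<Gamma> \<Longrightarrow> e' (take t z) = e (take t z)"
    using budget_charger[OF e e0] by blast
  \<comment> \<open>Runs are admissible, so their outputs lie within the budget of \<open>e\<close>,
    where \<open>e'\<close> agrees with \<open>e\<close>.\<close>
  have run: "run W g (\<lambda>xs ys. e' ys) n = run W g (\<lambda>xs ys. e ys) n" if g: "g \<in> set_pmf P" for g
  proof (rule run_cong, clarify)
    fix xs ys es t assume r: "(xs, ys, es) \<in> set_pmf (run W g (\<lambda>xs ys. e ys) n)" and t: "t < n"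
    have es: "map (\<lambda>t. e (take t ys)) [0..<n] = es" using run_inputs[OF r] by blast
    have "es ! s = e (take s ys)" if "s < n" for s using that by (simp flip: es)
    then have "(\<Sum>t<n. e (take t ys)) \<le> real n * \<Gamma>" using admissibleD(5)[OF adm[OF g r]] by simp
    then show "e' (take t ys) = e (take t ys) \<and> g (take (Suc t) es) = g (take (Suc t) es)"
      using e'(3)[of ys t] run_length[OF r] by simp
  qed
  define pol :: "(real list \<Rightarrow> 'x) \<Rightarrow> ('x, 'y) policy" where "pol g = (g, \<lambda>xs ys. e' ys)" for g
  have "v = mixinfo (map_pmf pol P) (\<lambda>u. out W (fst u) (snd u) n)"
    unfolding v mixinfo_map by (rule mixinfo_cong) (simp add: pol_def out_def run)
  moreover have "receiver.good n (pol g)" if g: "g \<in> set_pmf P" for g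
    unfolding receiver.good_def pol_def fst_conv snd_conv run[OF g]
  proof (intro conjI)
    show "cost_ok \<E> \<Gamma> (\<lambda>(xs :: 'x list) (ys :: 'y list). e' ys) n"
      using e' by (auto simp: cost_ok_def)
    show "\<forall>(xs, ys, es)\<in>set_pmf (run W g (\<lambda>xs ys. e ys) n). feas \<phi> B B xs es"
      using admissibleD(4)[OF adm[OF g]] by blast
  qed auto
  ultimately show "\<exists>P. finite (set_pmf P) \<and> v = mixinfo P (\<lambda>u. out W (fst u) (snd u) n) \<and>
      (\<forall>u\<in>set_pmf P. receiver.good n u) \<and> (\<not> False \<longrightarrow> (\<forall>u\<in>set_pmf P. \<forall>v\<in>set_pmf P. snd u = snd v))"
    using fP by (intro exI[of _ "map_pmf pol P"]) (auto simp: pol_def)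
next
  fix n R f g and c :: "('x, 'y) charger"
  assume R: "0 \<le> R" and c: "c \<in> receiver_chargers" and code: "code R n f c g"
  obtain e where e: "c = (\<lambda>m xs ys. e ys)" using c by (auto simp: receiver_chargers_def)
  let ?M = "{1..num_messages R n}"
  have M1: "1 \<in> ?M" using num_messages_bounds(1)[OF R] by simp
  note sM = set_pmf_messages[OF R, of n]
  have cost: "cost_ok \<E> \<Gamma> (c m) n" if "m \<in> ?M" for m
    using code that unfolding is_code_def cost_ok_def by blast
  define e' where "e' ys = (if length ys < n then e ys else e0)" for ys
  have eE: "e ys \<in> \<E>" if ys: "length ys < n" for ys
  proof -
    define ys' where "ys' = ys @ replicate (n - length ys) undefined"
    have "length (replicate n (undefined :: 'x)) = n \<and> length ys' = n" using ys by (simp add: ys'_def)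
    then have "c 1 (take (length ys) (replicate n undefined)) (take (length ys) ys') \<in> \<E>"
      using cost[OF M1] ys unfolding cost_ok_def by blast
    then show ?thesis by (simp add: e ys'_def)
  qed
  have e': "range e' \<subseteq> \<E>" using eE e0(1) by (auto simp: e'_def)
  have run: "run W (f m) (\<lambda>xs ys. e' ys) n = run W (f m) (c m) n" for m
    unfolding run_eq_causal_joint e
    by (subst causal_joint_cong[of n e' e]) (auto simp: e'_def energy_seq_def intro!: map_pmf_cong dest!: causal_joint_length)
  have "f m \<in> feasible_policies n e'" if m: "m \<in> ?M" for m
    unfolding feasible_policies_def mem_Collect_eq run
  proof clarify
    fix xs ys es assume r: "(xs, ys, es) \<in> set_pmf (run W (f m) (c m) n)"
    note * = run_length[OF r] run_cost_ok[OF cost[OF m] r]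
    have "energy_feasible \<phi> B n (map (\<lambda>t. f m (take (Suc t) es)) [0..<n]) es"
      using code m * unfolding is_code_def by blast
    then show "(xs, es) \<in> adm n"
      using * run_inputs[OF r] by (simp add: admissible_def)
  qed
  then have "set_pmf (map_pmf f (pmf_of_set ?M)) \<subseteq> feasible_policies n e'"
    unfolding set_map_pmf sM by blast
  from mixture_in_receiver_values[OF _ e' this]
  show "mixinfo (pmf_of_set ?M) (\<lambda>m. out W (f m) (c m) n) \<in> receiver_values W \<phi> B \<E> \<Gamma> n"
    unfolding mixinfo_map set_map_pmf sM by (simp add: out_def run)
next
  fix n assume ne: "receiver_values W \<phi> B \<E> \<Gamma> n \<noteq> {}"
  \<comment> \<open>Normal forms: outside the finitely many histories that a feasible run can meet,
    chargers take the value \<open>e0\<close> and policies the value \<open>x0\<close>. This leaves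
    finite sets of both without changing any feasible run.\<close>
  define I where "I = {e :: 'y list \<Rightarrow> real. \<forall>ys. (ys \<in> {ys. length ys < n} \<longrightarrow> e ys \<in> \<E>) \<and> (ys \<notin> {ys. length ys < n} \<longrightarrow> e ys = e0)}"
  define H where "H = {es. set es \<subseteq> \<E> \<and> length es \<le> n}"
  define G where "G = {g. \<forall>es. (es \<in> H \<longrightarrow> g es \<in> (UNIV :: 'x set)) \<and> (es \<notin> H \<longrightarrow> g es = x0)}"
  define V where "V = (\<lambda>(e :: 'y list \<Rightarrow> real) g. out W g (\<lambda>xs ys. e ys) n)"
  have "finite {ys :: 'y list. length ys < n}"
    by (rule finite_subset[OF _ finite_lists_length_le[of "UNIV :: 'y set" n]]) auto
  then have fI: "finite I" unfolding I_def using \<E>_finite by (intro finite_set_of_finite_funs)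
  have fG: "finite G" unfolding G_def H_def
    by (intro finite_set_of_finite_funs finite_lists_length_le \<E>_finite) simp
  have IE: "range e \<subseteq> \<E>" if "e \<in> I" for e
  proof clarify
    fix ys show "e ys \<in> \<E>" using that e0(1) unfolding I_def by (cases "length ys < n") auto
  qed
  show "\<exists>s\<in>receiver_values W \<phi> B \<E> \<Gamma> n. \<forall>s'\<in>receiver_values W \<phi> B \<E> \<Gamma> n. s' \<le> s"
  proof (rule mixinfo_set_has_maximum[OF fI _ _ _ ne, of "\<lambda>e. feasible_policies n e \<inter> G" V])
    show "receiver_values W \<phi> B \<E> \<Gamma> n = {mixinfo P (V e) | P e. e \<in> I \<and> set_pmf P \<subseteq> feasible_policies n e \<inter> G}"
    proof (intro set_eqI iffI)
      fix v assume "v \<in> receiver_values W \<phi> B \<E> \<Gamma> n"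
      then obtain P e where e: "range e \<subseteq> \<E>" and P: "set_pmf P \<subseteq> feasible_policies n e"
        and v: "v = mixinfo P (\<lambda>g. out W g (\<lambda>xs ys. e ys) n)"
        using receiver_value_is_mixture by blast
      define e' where "e' ys = (if length ys < n then e ys else e0)" for ys
      define r where "r g es = (if es \<in> H then g es else x0)" for g :: "real list \<Rightarrow> 'x" and es
      have run: "run W (r g) (\<lambda>xs ys. e' ys) n = run W g (\<lambda>xs ys. e ys) n" if g: "g \<in> set_pmf P" for g
      proof (rule run_cong, clarify)
        fix xs ys es t assume r: "(xs, ys, es) \<in> set_pmf (run W g (\<lambda>xs ys. e ys) n)" and t: "t < n"
        have len: "length xs = n" "length ys = n" "length es = n" using run_length[OF r] by auto
        have "(xs, es) \<in> adm n" using P g r unfolding feasible_policies_def by blast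
        then have "take (Suc t) es \<in> H" using t len set_take_subset[of "Suc t" es] by (auto simp: H_def dest!: admissibleD(3))
        then show "e' (take t ys) = e (take t ys) \<and> r g (take (Suc t) es) = g (take (Suc t) es)"
          using t len by (simp add: r_def e'_def)
      qed
      have "v = mixinfo (map_pmf r P) (V e')"
        unfolding v mixinfo_map V_def by (rule mixinfo_cong) (simp add: out_def run)
      moreover have "e' \<in> I" using e by (auto simp: I_def e'_def)
      moreover have "set_pmf (map_pmf r P) \<subseteq> feasible_policies n e' \<inter> G"
      proof -
        have "r g \<in> feasible_policies n e'" if g: "g \<in> set_pmf P" for g
          using P g unfolding feasible_policies_def mem_Collect_eq run[OF g] by blast
        moreover have "r g \<in> G" for g by (simp add: G_def r_def)
        ultimately show ?thesis by auto
      qed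
      ultimately show "v \<in> {mixinfo P (V e) | P e. e \<in> I \<and> set_pmf P \<subseteq> feasible_policies n e \<inter> G}" by blast
    next
      fix v assume "v \<in> {mixinfo P (V e) | P e. e \<in> I \<and> set_pmf P \<subseteq> feasible_policies n e \<inter> G}"
      then obtain P e where v: "v = mixinfo P (V e)" and e: "e \<in> I" and P: "set_pmf P \<subseteq> feasible_policies n e \<inter> G" by blast
      have "finite (set_pmf P)" using P fG by (meson finite_subset le_inf_iff)
      then show "v \<in> receiver_values W \<phi> B \<E> \<Gamma> n"
        unfolding v V_def using P IE[OF e] by (intro mixture_in_receiver_values) auto
    qed
  qed (use fG in \<open>auto simp: V_def finite_out\<close>)
qed

end

theorem theorem1:
  fixes W :: "'x::finite \<Rightarrow> 'y::finite pmf"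
    and \<phi> :: "'x \<Rightarrow> real"
    and B :: real
    and \<E> :: "real set"
    and x0 :: 'x
    and \<Gamma> :: real
  assumes "\<And>x. 0 \<le> \<phi> x"
    and "\<And>x. \<phi> x \<le> B"
    and "\<phi> x0 = 0"
    and "finite \<E>"
    and "\<E> \<subseteq> {0..B}"
    and "\<exists>e\<in>\<E>. 0 < e"
    and "0 \<le> \<Gamma>"
  shows "normalized_max_tendsto (generic_values W \<phi> B \<E> \<Gamma>)
           (capacity W \<phi> B \<E> \<Gamma> generic_chargers)
    \<and> normalized_max_tendsto (receiver_values W \<phi> B \<E> \<Gamma>)
           (capacity W \<phi> B \<E> \<Gamma> receiver_chargers)
    \<and> normalized_max_tendsto (adjacent_values W \<phi> B \<E> \<Gamma>)
           (capacity W \<phi> B \<E> \<Gamma> adjacent_chargers)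
    \<and> normalized_max_tendsto (cognitive_values W \<phi> B \<E> \<Gamma>)
           (capacity W \<phi> B \<E> \<Gamma> cognitive_chargers)"
proof -
  have "\<E> \<noteq> {}" using assms(6) by blast
  then interpret remote_power W \<phi> B \<E> x0 \<Gamma> "Min \<E>"
    using assms by unfold_locales auto
  show ?thesis
    using generic_limit receiver_limit adjacent_limit cognitive_limit by blast
qed

end
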